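(* Let $k$ be a commutative unital ring with $\mathbb{Q}\subseteq k$. There exists an injective natural transformation $\eta\colon \mathrm{red}\circ C^\bullet\Rightarrow C^\bullet\circ\mathrm{red}$ of functors from the category of coisotropic $k$-algebras with invertible morphisms to the category of DGLAs over $k$, i.e. a natural transformation all of whose components $\eta_A\colon C^\bullet(A)_{\mathrm{red}}\to C^\bullet(A_{\mathrm{red}})$ are injective.
   Context: A coisotropic $k$-algebra $A$ consists of unital associative $k$-algebras $A_{\mathrm{tot}},A_N$, a unital algebra homomorphism $\iota_A\colon A_N\to A_{\mathrm{tot}}$ and a two-sided ideal $A_0\subseteq A_N$. A morphism $\phi\colon A\to B$ is a pair of unital algebra homomorphisms $\phi_{\mathrm{tot}}\colon A_{\mathrm{tot}}\to B_{\mathrm{tot}}$, $\phi_N\colon A_N\to B_N$ with $\iota_B\phi_N=\phi_{\mathrm{tot}}\iota_A$, $\phi_N(A_0)\subseteq B_0$. Reduction: $A_{\mathrm{red}}=A_N/A_0$. A coisotropic DGLA $\mathfrak g$ consists of DGLAs $\mathfrak g_{\mathrm{tot}},\mathfrak g_N$, a degree $0$ DGLA morphism $\iota\colon\mathfrak g_N\to\mathfrak g_{\mathrm{tot}}$ and a graded Lie ideal $\mathfrak g_0\subseteq\mathfrak g_N$ stable under the differential; morphisms are pairs of DGLA morphisms compatible with $\iota$ whose $N$-part preserves the $0$-components; $\mathfrak g_{\mathrm{red}}=\mathfrak g_N/\mathfrak g_0$. Ordinary Hochschild complex: for an associative $k$-algebra $(B,\mu)$, $C^n(B)=\mathrm{Hom}_k(B^{\otimes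 n},B)$, with the usual Gerstenhaber bracket $[f,g]=f\circ g-(-1)^{(m-1)(n-1)}g\circ f$ for $f\in C^m(B),g\in C^n(B)$, $(f\circ g)(a_1,\dots,a_{m+n-1})=\sum_{i=0}^{m-1}(-1)^{i(n-1)}f(a_1,\dots,a_i,g(a_{i+1},\dots,a_{i+n}),a_{i+n+1},\dots)$ (so $n$-cochains have Lie degree $n-1$), and the Hochschild differential $\delta=-[\,\cdot\,,\mu]$, the signs being chosen so that it is the usual Hochschild differential. Coisotropic Hochschild complex of $A$: $C^n(A)_{\mathrm{tot}}=C^n(A_{\mathrm{tot}})$; $C^n(A)_N$ is the set of pairs $(f_{\mathrm{tot}},f_N)\in C^n(A_{\mathrm{tot}})\times C^n(A_N)$ with $f_{\mathrm{tot}}\circ\iota_A^{\otimes n}=\iota_A\circ f_N$ and $f_N(a_1,\dots,a_n)\in A_0$ whenever some $a_i\in A_0$; $C^n(A)_0$ is the subset of pairs with $f_N(A_N^{\otimes n})\subseteq A_0$; $\iota(f_{\mathrm{tot}},f_N)=f_{\mathrm{tot}}$; bracket and differential are componentwise the Gerstenhaber brackets and Hochschild differentials of $A_{\mathrm{tot}}$ and $A_N$, i.e. $\delta_{\mathrm{tot}}=-[\,\cdot\,,\mu_{\mathrm{tot}}]$ and $\delta_N=-[\,\cdot\,,\mu]_N$ with $\mu=(\mu_{\mathrm{tot}},\mu_N)$ the multiplication of $A$. With these structures $C^\bullet(A)$ is regarded as a coisotropic DGLA. On an isomorphism $\phi\colon A\to B$ (of coisotropic or of ordinary algebras) the functor $C^\bullet$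 is given by $C^\bullet(\phi)(f)=\phi\circ f\circ(\phi^{-1})^{\otimes n}$ for $f\in C^n$ (componentwise in the coisotropic case). *)

theory Defs
  imports Complex_Main "HOL-Algebra.Module" "HOL-Algebra.QuotRing"
begin

section \<open>Categories, functors, groupoids of isomorphisms\<close>

text \<open>Morphisms in the categories below are (families of) functions that are extensional outside
  the carriers, so that equality of morphisms is equality in HOL.  As composition of extensional
  functions restricts to the carrier of the source, the composition operation takes the source object
  as an additional argument: \<open>Cmp C A g f\<close> is \<open>g \<circ> f\<close> for \<open>f\<close> with source \<open>A\<close>.  Similarly the
  morphism part of a functor receives source and target of the morphism.\<close>

record ('o, 'm) category =
  Ob :: "'o set"
  Mor :: "'o \<Rightarrow> 'o \<Rightarrow> 'm set"
  Idt :: "'o \<Rightarrow> 'm"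
  Cmp :: "'o \<Rightarrow> 'm \<Rightarrow> 'm \<Rightarrow> 'm"

definition core_groupoid :: "('o, 'm) category \<Rightarrow> ('o, 'm) category" where
  "core_groupoid C = C\<lparr>Mor := \<lambda>A B. {f \<in> Mor C A B.
     \<exists>g \<in> Mor C B A. Cmp C A g f = Idt C A \<and> Cmp C B f g = Idt C B}\<rparr>"

record ('o, 'm, 'p, 'q) func =
  src :: "('o, 'm) category"
  tgt :: "('p, 'q) category"
  om :: "'o \<Rightarrow> 'p"
  mm :: "'o \<Rightarrow> 'o \<Rightarrow> 'm \<Rightarrow> 'q"

definition is_functor :: "('o, 'm, 'p, 'q) func \<Rightarrow> bool" where
  "is_functor F \<longleftrightarrow>
     (\<forall>A \<in> Ob (src F). om F A \<in> Ob (tgt F)) \<and>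
     (\<forall>A \<in> Ob (src F). \<forall>B \<in> Ob (src F). \<forall>f \<in> Mor (src F) A B.
        mm F A B f \<in> Mor (tgt F) (om F A) (om F B)) \<and>
     (\<forall>A \<in> Ob (src F). mm F A A (Idt (src F) A) = Idt (tgt F) (om F A)) \<and>
     (\<forall>A \<in> Ob (src F). \<forall>B \<in> Ob (src F). \<forall>D \<in> Ob (src F).
        \<forall>f \<in> Mor (src F) A B. \<forall>g \<in> Mor (src F) B D.
          mm F A D (Cmp (src F) A g f) = Cmp (tgt F) (om F A) (mm F B D g) (mm F A B f))"

definition func_comp ::
    "('p, 'q, 'r, 's) func \<Rightarrow> ('o, 'm, 'p, 'q) func \<Rightarrow> ('o, 'm, 'r, 's) func" where
  "func_comp G F = \<lparr>src = src F, tgt = tgt G,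
     om = (\<lambda>A. om G (om F A)),
     mm = (\<lambda>A B f. mm G (om F A) (om F B) (mm F A B f))\<rparr>"


section \<open>Modules and associative algebras\<close>

text \<open>\<open>\<rat> \<subseteq> k\<close>: there is a unital embedding of the field of rational numbers.\<close>

definition contains_rationals :: "('k, 'r) ring_scheme \<Rightarrow> bool" where
  "contains_rationals K \<longleftrightarrow>
     (\<exists>h \<in> ring_hom \<lparr>carrier = UNIV, mult = (*), one = 1, zero = 0, add = (+)\<rparr> K.
        inj (h :: rat \<Rightarrow> 'k))"

text \<open>\<open>(- 1)\<^sup>p x\<close>\<close>

definition signed :: "('k, 'a, 'm) module_scheme \<Rightarrow> int \<Rightarrow> 'a \<Rightarrow> 'a" where
  "signed M p x = (if even p then x else \<ominus>\<^bsub>M\<^esub> x)"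

definition linear_maps ::
    "('k, 'r) ring_scheme \<Rightarrow> ('k, 'a, 'm) module_scheme \<Rightarrow> ('k, 'b, 'n) module_scheme \<Rightarrow> ('a \<Rightarrow> 'b) set"
  where
  "linear_maps K M N = {h \<in> carrier M \<rightarrow>\<^sub>E carrier N.
     (\<forall>x \<in> carrier M. \<forall>y \<in> carrier M. h (x \<oplus>\<^bsub>M\<^esub> y) = h x \<oplus>\<^bsub>N\<^esub> h y) \<and>
     (\<forall>r \<in> carrier K. \<forall>x \<in> carrier M. h (r \<odot>\<^bsub>M\<^esub> x) = r \<odot>\<^bsub>N\<^esub> h x)}"

text \<open>For a submodule \<open>I\<close> of \<open>M\<close> and a two-sided ideal \<open>I\<close> of \<open>M\<close>, respectively.  The ring
  multiplication and unit of a \<^type>\<open>module\<close> record play no role when it is used as a module.\<close>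

definition quot_module :: "('k, 'a, 'm) module_scheme \<Rightarrow> 'a set \<Rightarrow> ('k, 'a set) module" where
  "quot_module M I = \<lparr>carrier = a_rcosets\<^bsub>M\<^esub> I, mult = undefined, one = undefined,
     zero = I, add = set_add M, smult = (\<lambda>r X. \<Union>x\<in>X. I +>\<^bsub>M\<^esub> (r \<odot>\<^bsub>M\<^esub> x))\<rparr>"

definition quot_algebra :: "('k, 'a, 'm) module_scheme \<Rightarrow> 'a set \<Rightarrow> ('k, 'a set) module" where
  "quot_algebra M I = ring.extend (M Quot I)
     (module.fields (\<lambda>r X. \<Union>x\<in>X. I +>\<^bsub>M\<^esub> (r \<odot>\<^bsub>M\<^esub> x)))"

definition quot_map :: "('k, 'a, 'm) module_scheme \<Rightarrow> 'a set \<Rightarrow> ('k, 'b, 'n) module_scheme \<Rightarrow> 'b set \<Rightarrow>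
    ('a \<Rightarrow> 'b) \<Rightarrow> 'a set \<Rightarrow> 'b set" where
  "quot_map M I N J h = (\<lambda>X \<in> a_rcosets\<^bsub>M\<^esub> I. \<Union>x\<in>X. J +>\<^bsub>N\<^esub> h x)"

text \<open>Unital associative algebras; the locale \<^locale>\<open>algebra\<close> of the library is restricted to
  commutative ones.\<close>

locale assoc_algebra = module K A + A: ring A for K (structure) and A (structure) +
  assumes smult_mult_left: "\<lbrakk>r \<in> carrier K; a \<in> carrier A; b \<in> carrier A\<rbrakk> \<Longrightarrow>
      (r \<odot>\<^bsub>A\<^esub> a) \<otimes>\<^bsub>A\<^esub> b = r \<odot>\<^bsub>A\<^esub> (a \<otimes>\<^bsub>A\<^esub> b)"
    and smult_mult_right: "\<lbrakk>r \<in> carrier K; a \<in> carrier A; b \<in> carrier A\<rbrakk> \<Longrightarrow>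
      a \<otimes>\<^bsub>A\<^esub> (r \<odot>\<^bsub>A\<^esub> b) = r \<odot>\<^bsub>A\<^esub> (a \<otimes>\<^bsub>A\<^esub> b)"

definition algebra_homs ::
    "('k, 'r) ring_scheme \<Rightarrow> ('k, 'a, 'm) module_scheme \<Rightarrow> ('k, 'b, 'n) module_scheme \<Rightarrow> ('a \<Rightarrow> 'b) set"
  where "algebra_homs K A B = linear_maps K A B \<inter> ring_hom A B"

definition alg_cat :: "('k, 'r) ring_scheme \<Rightarrow> (('k, 'a) module, 'a \<Rightarrow> 'a) category" where
  "alg_cat K = \<lparr>Ob = {A. assoc_algebra K A}, Mor = algebra_homs K,
     Idt = (\<lambda>A. \<lambda>x \<in> carrier A. x), Cmp = (\<lambda>A. compose (carrier A))\<rparr>"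


section \<open>Coisotropic algebras and their reduction\<close>

record ('k, 't, 'n) coiso_alg =
  atot :: "('k, 't) module"
  aN :: "('k, 'n) module"
  aiota :: "'n \<Rightarrow> 't"
  azero :: "'n set"

definition coiso_algebra :: "('k, 'r) ring_scheme \<Rightarrow> ('k, 't, 'n) coiso_alg \<Rightarrow> bool" where
  "coiso_algebra K A \<longleftrightarrow> assoc_algebra K (atot A) \<and> assoc_algebra K (aN A) \<and>
     aiota A \<in> algebra_homs K (aN A) (atot A) \<and> ideal (azero A) (aN A)"

definition coiso_alg_homs :: "('k, 'r) ring_scheme \<Rightarrow> ('k, 't, 'n) coiso_alg \<Rightarrow>
    ('k, 't, 'n) coiso_alg \<Rightarrow> (('t \<Rightarrow> 't) \<times> ('n \<Rightarrow> 'n)) set" where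
  "coiso_alg_homs K A B = {(\<phi>tot, \<phi>N).
     \<phi>tot \<in> algebra_homs K (atot A) (atot B) \<and> \<phi>N \<in> algebra_homs K (aN A) (aN B) \<and>
     (\<forall>a \<in> carrier (aN A). aiota B (\<phi>N a) = \<phi>tot (aiota A a)) \<and>
     \<phi>N ` azero A \<subseteq> azero B}"

definition coiso_alg_cat :: "('k, 'r) ring_scheme \<Rightarrow>
    (('k, 't, 'n) coiso_alg, ('t \<Rightarrow> 't) \<times> ('n \<Rightarrow> 'n)) category" where
  "coiso_alg_cat K = \<lparr>Ob = {A. coiso_algebra K A}, Mor = coiso_alg_homs K,
     Idt = (\<lambda>A. (\<lambda>x \<in> carrier (atot A). x, \<lambda>x \<in> carrier (aN A). x)),
     Cmp = (\<lambda>A g f. (compose (carrier (atot A)) (fst g) (fst f),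
                     compose (carrier (aN A)) (snd g) (snd f)))\<rparr>"

definition red_alg :: "('k, 'r) ring_scheme \<Rightarrow>
    (('k, 't, 'n) coiso_alg, ('t \<Rightarrow> 't) \<times> ('n \<Rightarrow> 'n), ('k, 'n set) module, 'n set \<Rightarrow> 'n set) func" where
  "red_alg K = \<lparr>src = core_groupoid (coiso_alg_cat K), tgt = core_groupoid (alg_cat K),
     om = (\<lambda>A. quot_algebra (aN A) (azero A)),
     mm = (\<lambda>A B \<phi>. quot_map (aN A) (azero A) (aN B) (azero B) (snd \<phi>))\<rparr>"


section \<open>Differential graded Lie algebras\<close>

text \<open>A graded \<open>K\<close>-module \<open>gr\<close>, a bracket \<open>brk p q : gr p \<times> gr q \<rightarrow> gr (p + q)\<close> and a differential
  \<open>dif p : gr p \<rightarrow> gr (p + 1)\<close>.\<close>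

record ('k, 'x) dgla =
  gr :: "int \<Rightarrow> ('k, 'x) module"
  brk :: "int \<Rightarrow> int \<Rightarrow> 'x \<Rightarrow> 'x \<Rightarrow> 'x"
  dif :: "int \<Rightarrow> 'x \<Rightarrow> 'x"

text \<open>The Leibniz rule is the one of a differential acting from the right,
  \<open>d [x, y] = [x, d y] + (- 1)\<^bsup>|y|\<^esup> [d x, y]\<close>.  This is the rule satisfied by the usual Hochschild
  differential \<open>\<delta> = - [\<cdot>, \<mu>]\<close> with respect to the Gerstenhaber bracket (already
  \<open>\<delta> [f, g] = [\<delta> f, g] + (- 1)\<^bsup>|f|\<^esup> [f, \<delta> g]\<close> fails in general for \<open>f\<close> of arity 0 and \<open>g\<close> of
  arity 1).  Replacing \<open>d x\<close> by \<open>(- 1)\<^bsup>|x|\<^esup> d x\<close> and keeping the morphisms identifies this category of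
  DGLAs with the one for the Leibniz rule from the left.\<close>

locale dgla =
  fixes K :: "('k, 'r) ring_scheme" and G :: "('k, 'x) dgla"
  assumes gr_module: "module K (gr G p)"
    and brk_closed: "\<lbrakk>x \<in> carrier (gr G p); y \<in> carrier (gr G q)\<rbrakk> \<Longrightarrow>
      brk G p q x y \<in> carrier (gr G (p + q))"
    and brk_add_left: "\<lbrakk>x \<in> carrier (gr G p); x' \<in> carrier (gr G p); y \<in> carrier (gr G q)\<rbrakk> \<Longrightarrow>
      brk G p q (x \<oplus>\<^bsub>gr G p\<^esub> x') y = brk G p q x y \<oplus>\<^bsub>gr G (p + q)\<^esub> brk G p q x' y"
    and brk_add_right: "\<lbrakk>x \<in> carrier (gr G p); y \<in> carrier (gr G q); y' \<in> carrier (gr G q)\<rbrakk> \<Longrightarrow>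
      brk G p q x (y \<oplus>\<^bsub>gr G q\<^esub> y') = brk G p q x y \<oplus>\<^bsub>gr G (p + q)\<^esub> brk G p q x y'"
    and brk_smult_left: "\<lbrakk>r \<in> carrier K; x \<in> carrier (gr G p); y \<in> carrier (gr G q)\<rbrakk> \<Longrightarrow>
      brk G p q (r \<odot>\<^bsub>gr G p\<^esub> x) y = r \<odot>\<^bsub>gr G (p + q)\<^esub> brk G p q x y"
    and brk_smult_right: "\<lbrakk>r \<in> carrier K; x \<in> carrier (gr G p); y \<in> carrier (gr G q)\<rbrakk> \<Longrightarrow>
      brk G p q x (r \<odot>\<^bsub>gr G q\<^esub> y) = r \<odot>\<^bsub>gr G (p + q)\<^esub> brk G p q x y"
    and antisymmetry: "\<lbrakk>x \<in> carrier (gr G p); y \<in> carrier (gr G q)\<rbrakk> \<Longrightarrow>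
      brk G p q x y = \<ominus>\<^bsub>gr G (p + q)\<^esub> signed (gr G (p + q)) (p * q) (brk G q p y x)"
    and jacobi: "\<lbrakk>x \<in> carrier (gr G p); y \<in> carrier (gr G q); z \<in> carrier (gr G s)\<rbrakk> \<Longrightarrow>
      brk G p (q + s) x (brk G q s y z) =
        brk G (p + q) s (brk G p q x y) z \<oplus>\<^bsub>gr G (p + q + s)\<^esub>
        signed (gr G (p + q + s)) (p * q) (brk G q (p + s) y (brk G p s x z))"
    and dif_linear: "restrict (dif G p) (carrier (gr G p)) \<in> linear_maps K (gr G p) (gr G (p + 1))"
    and dif_dif: "x \<in> carrier (gr G p) \<Longrightarrow> dif G (p + 1) (dif G p x) = \<zero>\<^bsub>gr G (p + 2)\<^esub>"
    and leibniz: "\<lbrakk>x \<in> carrier (gr G p); y \<in> carrier (gr G q)\<rbrakk> \<Longrightarrow>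
      dif G (p + q) (brk G p q x y) =
        brk G p (q + 1) x (dif G q y) \<oplus>\<^bsub>gr G (p + q + 1)\<^esub>
        signed (gr G (p + q + 1)) q (brk G (p + 1) q (dif G p x) y)"

definition dgla_homs :: "('k, 'r) ring_scheme \<Rightarrow> ('k, 'x) dgla \<Rightarrow> ('k, 'y) dgla \<Rightarrow>
    (int \<Rightarrow> 'x \<Rightarrow> 'y) set" where
  "dgla_homs K G H = {h.
     (\<forall>p. h p \<in> linear_maps K (gr G p) (gr H p)) \<and>
     (\<forall>p q. \<forall>x \<in> carrier (gr G p). \<forall>y \<in> carrier (gr G q).
        h (p + q) (brk G p q x y) = brk H p q (h p x) (h q y)) \<and>
     (\<forall>p. \<forall>x \<in> carrier (gr G p). h (p + 1) (dif G p x) = dif H p (h p x))}"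

definition dgla_comp :: "('k, 'x) dgla \<Rightarrow> (int \<Rightarrow> 'y \<Rightarrow> 'z) \<Rightarrow> (int \<Rightarrow> 'x \<Rightarrow> 'y) \<Rightarrow> int \<Rightarrow> 'x \<Rightarrow> 'z" where
  "dgla_comp G g f = (\<lambda>p. compose (carrier (gr G p)) (g p) (f p))"

definition dgla_cat :: "('k, 'r) ring_scheme \<Rightarrow> (('k, 'x) dgla, int \<Rightarrow> 'x \<Rightarrow> 'x) category" where
  "dgla_cat K = \<lparr>Ob = {G. dgla K G}, Mor = dgla_homs K,
     Idt = (\<lambda>G p. \<lambda>x \<in> carrier (gr G p). x), Cmp = dgla_comp\<rparr>"

text \<open>Natural transformations between functors to DGLAs.  The underlying types of the DGLAs in the
  images of both functors may be different, whence the components and the naturality squares are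
  expressed by the heterogeneous \<^const>\<open>dgla_homs\<close> and \<^const>\<open>dgla_comp\<close>.\<close>

definition dgla_nat_trans :: "('k, 'r) ring_scheme \<Rightarrow>
    ('o, 'm, ('k, 'x) dgla, int \<Rightarrow> 'x \<Rightarrow> 'x) func \<Rightarrow>
    ('o, 'm, ('k, 'y) dgla, int \<Rightarrow> 'y \<Rightarrow> 'y) func \<Rightarrow> ('o \<Rightarrow> int \<Rightarrow> 'x \<Rightarrow> 'y) \<Rightarrow> bool" where
  "dgla_nat_trans K F G \<eta> \<longleftrightarrow>
     is_functor F \<and> is_functor G \<and> src F = src G \<and> tgt F = dgla_cat K \<and> tgt G = dgla_cat K \<and>
     (\<forall>A \<in> Ob (src F). \<eta> A \<in> dgla_homs K (om F A) (om G A)) \<and>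
     (\<forall>A \<in> Ob (src F). \<forall>B \<in> Ob (src F). \<forall>f \<in> Mor (src F) A B.
        dgla_comp (om F A) (\<eta> B) (mm F A B f) = dgla_comp (om F A) (mm G A B f) (\<eta> A))"


section \<open>Coisotropic DGLAs and their reduction\<close>

record ('k, 'x, 'y) coiso_dgla =
  dtot :: "('k, 'x) dgla"
  dN :: "('k, 'y) dgla"
  diota :: "int \<Rightarrow> 'y \<Rightarrow> 'x"
  dzero :: "int \<Rightarrow> 'y set"

definition dg_lie_ideal :: "('k, 'r) ring_scheme \<Rightarrow> (int \<Rightarrow> 'x set) \<Rightarrow> ('k, 'x) dgla \<Rightarrow> bool" where
  "dg_lie_ideal K I G \<longleftrightarrow>
     (\<forall>p. submodule (I p) K (gr G p)) \<and>
     (\<forall>p q. \<forall>x \<in> carrier (gr G p). \<forall>y \<in> I q. brk G p q x y \<in> I (p + q)) \<and>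
     (\<forall>p. \<forall>x \<in> I p. dif G p x \<in> I (p + 1))"

definition coiso_dgla :: "('k, 'r) ring_scheme \<Rightarrow> ('k, 'x, 'y) coiso_dgla \<Rightarrow> bool" where
  "coiso_dgla K G \<longleftrightarrow> dgla K (dtot G) \<and> dgla K (dN G) \<and>
     diota G \<in> dgla_homs K (dN G) (dtot G) \<and> dg_lie_ideal K (dzero G) (dN G)"

definition coiso_dgla_homs :: "('k, 'r) ring_scheme \<Rightarrow> ('k, 'x, 'y) coiso_dgla \<Rightarrow>
    ('k, 'x, 'y) coiso_dgla \<Rightarrow> ((int \<Rightarrow> 'x \<Rightarrow> 'x) \<times> (int \<Rightarrow> 'y \<Rightarrow> 'y)) set" where
  "coiso_dgla_homs K G H = {(htot, hN).
     htot \<in> dgla_homs K (dtot G) (dtot H) \<and> hN \<in> dgla_homs K (dN G) (dN H) \<and>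
     (\<forall>p. \<forall>x \<in> carrier (gr (dN G) p). diota H p (hN p x) = htot p (diota G p x)) \<and>
     (\<forall>p. hN p ` dzero G p \<subseteq> dzero H p)}"

definition coiso_dgla_cat :: "('k, 'r) ring_scheme \<Rightarrow>
    (('k, 'x, 'y) coiso_dgla, (int \<Rightarrow> 'x \<Rightarrow> 'x) \<times> (int \<Rightarrow> 'y \<Rightarrow> 'y)) category" where
  "coiso_dgla_cat K = \<lparr>Ob = {G. coiso_dgla K G}, Mor = coiso_dgla_homs K,
     Idt = (\<lambda>G. (\<lambda>p. \<lambda>x \<in> carrier (gr (dtot G) p). x, \<lambda>p. \<lambda>x \<in> carrier (gr (dN G) p). x)),
     Cmp = (\<lambda>G g f. (dgla_comp (dtot G) (fst g) (fst f), dgla_comp (dN G) (snd g) (snd f)))\<rparr>"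

definition quot_dgla :: "('k, 'x) dgla \<Rightarrow> (int \<Rightarrow> 'x set) \<Rightarrow> ('k, 'x set) dgla" where
  "quot_dgla G I = \<lparr>gr = (\<lambda>p. quot_module (gr G p) (I p)),
     brk = (\<lambda>p q X Y. \<Union>x\<in>X. \<Union>y\<in>Y. I (p + q) +>\<^bsub>gr G (p + q)\<^esub> brk G p q x y),
     dif = (\<lambda>p X. \<Union>x\<in>X. I (p + 1) +>\<^bsub>gr G (p + 1)\<^esub> dif G p x)\<rparr>"

definition red_dgla :: "('k, 'r) ring_scheme \<Rightarrow>
    (('k, 'x, 'y) coiso_dgla, (int \<Rightarrow> 'x \<Rightarrow> 'x) \<times> (int \<Rightarrow> 'y \<Rightarrow> 'y),
     ('k, 'y set) dgla, int \<Rightarrow> 'y set \<Rightarrow> 'y set) func" where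
  "red_dgla K = \<lparr>src = coiso_dgla_cat K, tgt = dgla_cat K,
     om = (\<lambda>G. quot_dgla (dN G) (dzero G)),
     mm = (\<lambda>G H h p. quot_map (gr (dN G) p) (dzero G p) (gr (dN H) p) (dzero H p) (snd h p))\<rparr>"


section \<open>The Hochschild complex\<close>

text \<open>Elements of \<open>Hom\<^sub>k (B\<^bsup>\<otimes>n\<^esup>, B)\<close> are rendered as \<open>n\<close>-fold multilinear maps, which are functions
  on lists of length \<open>n\<close> over the carrier of \<open>B\<close>; for \<open>n = 0\<close> this is an element of \<open>B\<close>.  The arity
  \<open>n\<close> is an integer since the Lie degree is \<open>n - 1\<close>: for \<open>n < 0\<close> there are no tuples at all, hence
  \<open>cochains K B n\<close> is the zero module.\<close>

definition tuples :: "('k, 'b, 'm) module_scheme \<Rightarrow> int \<Rightarrow> 'b list set" where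
  "tuples B n = {xs. int (length xs) = n \<and> set xs \<subseteq> carrier B}"

definition multilinear_maps ::
    "('k, 'r) ring_scheme \<Rightarrow> ('k, 'b, 'm) module_scheme \<Rightarrow> int \<Rightarrow> ('b list \<Rightarrow> 'b) set" where
  "multilinear_maps K B n = {f \<in> tuples B n \<rightarrow>\<^sub>E carrier B.
     (\<forall>xs a b ys. xs @ a # ys \<in> tuples B n \<and> b \<in> carrier B \<longrightarrow>
        f (xs @ (a \<oplus>\<^bsub>B\<^esub> b) # ys) = f (xs @ a # ys) \<oplus>\<^bsub>B\<^esub> f (xs @ b # ys)) \<and>
     (\<forall>xs a ys. \<forall>r \<in> carrier K. xs @ a # ys \<in> tuples B n \<longrightarrow>
        f (xs @ (r \<odot>\<^bsub>B\<^esub> a) # ys) = r \<odot>\<^bsub>B\<^esub> f (xs @ a # ys))}"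

definition cochains ::
    "('k, 'r) ring_scheme \<Rightarrow> ('k, 'b, 'm) module_scheme \<Rightarrow> int \<Rightarrow> ('k, 'b list \<Rightarrow> 'b) module" where
  "cochains K B n = \<lparr>carrier = multilinear_maps K B n, mult = undefined, one = undefined,
     zero = (\<lambda>xs \<in> tuples B n. \<zero>\<^bsub>B\<^esub>),
     add = (\<lambda>f g. \<lambda>xs \<in> tuples B n. f xs \<oplus>\<^bsub>B\<^esub> g xs),
     smult = (\<lambda>r f. \<lambda>xs \<in> tuples B n. r \<odot>\<^bsub>B\<^esub> f xs)\<rparr>"

text \<open>The composition \<open>f \<circ> g\<close> for \<open>f\<close> of arity \<open>m\<close> and \<open>g\<close> of arity \<open>n\<close>.\<close>

definition gerst_circ :: "('k, 'b, 'm) module_scheme \<Rightarrow> int \<Rightarrow> int \<Rightarrow>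
    ('b list \<Rightarrow> 'b) \<Rightarrow> ('b list \<Rightarrow> 'b) \<Rightarrow> 'b list \<Rightarrow> 'b" where
  "gerst_circ B m n f g = (\<lambda>xs \<in> tuples B (m + n - 1).
     if m < 0 \<or> n < 0 then \<zero>\<^bsub>B\<^esub> else
       (\<Oplus>\<^bsub>B\<^esub> i \<in> {..<nat m}. signed B (int i * (n - 1))
          (f (take i xs @ g (take (nat n) (drop i xs)) # drop (i + nat n) xs))))"

text \<open>Indexed by the Lie degrees \<open>p = m - 1\<close> and \<open>q = n - 1\<close>.\<close>

definition gerst_bracket :: "('k, 'r) ring_scheme \<Rightarrow> ('k, 'b, 'm) module_scheme \<Rightarrow> int \<Rightarrow> int \<Rightarrow>
    ('b list \<Rightarrow> 'b) \<Rightarrow> ('b list \<Rightarrow> 'b) \<Rightarrow> 'b list \<Rightarrow> 'b" where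
  "gerst_bracket K B p q f g =
     gerst_circ B (p + 1) (q + 1) f g \<ominus>\<^bsub>cochains K B (p + q + 1)\<^esub>
     signed (cochains K B (p + q + 1)) (p * q) (gerst_circ B (q + 1) (p + 1) g f)"

definition mult_cochain :: "('k, 'b, 'm) module_scheme \<Rightarrow> 'b list \<Rightarrow> 'b" where
  "mult_cochain B = (\<lambda>xs \<in> tuples B 2. xs ! 0 \<otimes>\<^bsub>B\<^esub> xs ! 1)"

definition hoch_dif :: "('k, 'r) ring_scheme \<Rightarrow> ('k, 'b, 'm) module_scheme \<Rightarrow> int \<Rightarrow>
    ('b list \<Rightarrow> 'b) \<Rightarrow> 'b list \<Rightarrow> 'b" where
  "hoch_dif K B p f = \<ominus>\<^bsub>cochains K B (p + 2)\<^esub> gerst_bracket K B p 1 f (mult_cochain B)"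

definition hoch_dgla :: "('k, 'r) ring_scheme \<Rightarrow> ('k, 'b, 'm) module_scheme \<Rightarrow>
    ('k, 'b list \<Rightarrow> 'b) dgla" where
  "hoch_dgla K B = \<lparr>gr = (\<lambda>p. cochains K B (p + 1)), brk = gerst_bracket K B, dif = hoch_dif K B\<rparr>"

text \<open>\<open>\<phi> \<circ> f \<circ> (\<phi>\<^bsup>-1\<^esup>)\<^bsup>\<otimes>n\<^esup>\<close>\<close>

definition transport :: "('k, 'b, 'm) module_scheme \<Rightarrow> ('k, 'c, 'l) module_scheme \<Rightarrow> ('b \<Rightarrow> 'c) \<Rightarrow>
    int \<Rightarrow> ('b list \<Rightarrow> 'b) \<Rightarrow> 'c list \<Rightarrow> 'c" where
  "transport B B' \<phi> n f = (\<lambda>xs \<in> tuples B' n. \<phi> (f (map (inv_into (carrier B) \<phi>) xs)))"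

definition hochschild :: "('k, 'r) ring_scheme \<Rightarrow>
    (('k, 'b) module, 'b \<Rightarrow> 'b, ('k, 'b list \<Rightarrow> 'b) dgla, int \<Rightarrow> ('b list \<Rightarrow> 'b) \<Rightarrow> 'b list \<Rightarrow> 'b) func"
  where
  "hochschild K = \<lparr>src = core_groupoid (alg_cat K), tgt = dgla_cat K,
     om = hoch_dgla K,
     mm = (\<lambda>B B' \<phi> p. \<lambda>f \<in> carrier (cochains K B (p + 1)). transport B B' \<phi> (p + 1) f)\<rparr>"


section \<open>The coisotropic Hochschild complex\<close>

definition coiso_cochains_N :: "('k, 'r) ring_scheme \<Rightarrow> ('k, 't, 'n) coiso_alg \<Rightarrow> int \<Rightarrow>
    ('k, ('t list \<Rightarrow> 't) \<times> ('n list \<Rightarrow> 'n)) module" where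
  "coiso_cochains_N K A n =
    (let T = cochains K (atot A) n; N = cochains K (aN A) n in
     \<lparr>carrier = {(ftot, fN). ftot \<in> carrier T \<and> fN \<in> carrier N \<and>
        (\<forall>xs \<in> tuples (aN A) n. ftot (map (aiota A) xs) = aiota A (fN xs)) \<and>
        (\<forall>xs \<in> tuples (aN A) n. set xs \<inter> azero A \<noteq> {} \<longrightarrow> fN xs \<in> azero A)},
      mult = undefined, one = undefined,
      zero = (\<zero>\<^bsub>T\<^esub>, \<zero>\<^bsub>N\<^esub>),
      add = (\<lambda>f g. (fst f \<oplus>\<^bsub>T\<^esub> fst g, snd f \<oplus>\<^bsub>N\<^esub> snd g)),
      smult = (\<lambda>r f. (r \<odot>\<^bsub>T\<^esub> fst f, r \<odot>\<^bsub>N\<^esub> snd f))\<rparr>)"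

definition coiso_cochains_0 :: "('k, 'r) ring_scheme \<Rightarrow> ('k, 't, 'n) coiso_alg \<Rightarrow> int \<Rightarrow>
    (('t list \<Rightarrow> 't) \<times> ('n list \<Rightarrow> 'n)) set" where
  "coiso_cochains_0 K A n = {f \<in> carrier (coiso_cochains_N K A n).
     \<forall>xs \<in> tuples (aN A) n. snd f xs \<in> azero A}"

definition coiso_hoch_dgla :: "('k, 'r) ring_scheme \<Rightarrow> ('k, 't, 'n) coiso_alg \<Rightarrow>
    ('k, 't list \<Rightarrow> 't, ('t list \<Rightarrow> 't) \<times> ('n list \<Rightarrow> 'n)) coiso_dgla" where
  "coiso_hoch_dgla K A = \<lparr>
     dtot = hoch_dgla K (atot A),
     dN = \<lparr>gr = (\<lambda>p. coiso_cochains_N K A (p + 1)),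
           brk = (\<lambda>p q f g. (gerst_bracket K (atot A) p q (fst f) (fst g),
                             gerst_bracket K (aN A) p q (snd f) (snd g))),
           dif = (\<lambda>p f. (hoch_dif K (atot A) p (fst f), hoch_dif K (aN A) p (snd f)))\<rparr>,
     diota = (\<lambda>p. \<lambda>f \<in> carrier (coiso_cochains_N K A (p + 1)). fst f),
     dzero = (\<lambda>p. coiso_cochains_0 K A (p + 1))\<rparr>"

definition coiso_hochschild :: "('k, 'r) ring_scheme \<Rightarrow>
    (('k, 't, 'n) coiso_alg, ('t \<Rightarrow> 't) \<times> ('n \<Rightarrow> 'n),
     ('k, 't list \<Rightarrow> 't, ('t list \<Rightarrow> 't) \<times> ('n list \<Rightarrow> 'n)) coiso_dgla,
     (int \<Rightarrow> ('t list \<Rightarrow> 't) \<Rightarrow> 't list \<Rightarrow> 't) \<times>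
     (int \<Rightarrow> ('t list \<Rightarrow> 't) \<times> ('n list \<Rightarrow> 'n) \<Rightarrow> ('t list \<Rightarrow> 't) \<times> ('n list \<Rightarrow> 'n))) func" where
  "coiso_hochschild K = \<lparr>src = core_groupoid (coiso_alg_cat K), tgt = coiso_dgla_cat K,
     om = coiso_hoch_dgla K,
     mm = (\<lambda>A B \<phi>.
       (\<lambda>p. \<lambda>f \<in> carrier (cochains K (atot A) (p + 1)).
          transport (atot A) (atot B) (fst \<phi>) (p + 1) f,
        \<lambda>p. \<lambda>f \<in> carrier (coiso_cochains_N K A (p + 1)).
          (transport (atot A) (atot B) (fst \<phi>) (p + 1) (fst f),
           transport (aN A) (aN B) (snd \<phi>) (p + 1) (snd f))))\<rparr>"

end

theory Submission
  imports Defs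
begin

text \<open>A cochain of \<open>A\<^sub>N\<close> that takes values in \<open>A\<^sub>0\<close> as soon as one argument lies in \<open>A\<^sub>0\<close> descends to a
  cochain of \<open>A\<^sub>N / A\<^sub>0\<close>, and it descends to zero precisely if all its values lie in \<open>A\<^sub>0\<close>.  Hence
  \<open>C(A)\<^sub>N \<rightarrow> C(A\<^sub>r\<^sub>e\<^sub>d)\<close> has kernel \<open>C(A)\<^sub>0\<close> and induces the injection \<open>\<eta>\<close>.  Compatibility with
  brackets and differentials, for \<open>\<iota>\<close>, for the projection to the reduction and for isomorphisms
  alike, is the fact that the Gerstenhaber composition preserves pairs of cochains intertwined by a
  linear map.  Since \<open>\<eta>\<close> is injective, \<open>C(A)\<^sub>r\<^sub>e\<^sub>d\<close> inherits the DGLA axioms from \<open>C(A\<^sub>r\<^sub>e\<^sub>d)\<close>.  These in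
  turn come from the graded right pre-Lie identity of the composition and the associativity
  \<open>\<mu> \<circ> \<mu> = 0\<close>; here \<open>1/2\<close> is needed to conclude \<open>\<delta>\<^sup>2 = 0\<close> from the Jacobi identity.\<close>

subsection \<open>Graded pre-Lie algebras\<close>

text \<open>The formula \<open>\<phi> \<circ> f \<circ> \<phi>^-1\<close> needs an invertible
  \<open>\<phi>\<close>, since cochains are contravariant in their arguments and covariant in their
  value. For other maps the relation \<open>intertwines\<close> takes the place of an induced map.
  The ideal condition on \<open>C(A)_N\<close> becomes the same relation: a cochain of
  \<open>A_N\<close> satisfies it iff the projection intertwines it with some cochain of
  \<open>A_red\<close>. Membership in \<open>C(A)_N\<close> thus means relations along
  \<open>\<iota>\<close> and along the projection, and an operation preserves them because it can be
  applied to the cochain of \<open>A_red\<close> as well. Likewise \<open>C(A)_0\<close> enters as a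
  kernel, so that operations on cosets are well defined because a map is compatible with them. Two
  nuisances shape the details. Lie degrees are integers, so arities may be negative, where the
  cochain modules are zero. Modules are indexed by degree expressions, so equal degrees written
  differently must be identified explicitly.\<close>

context module
begin

lemma signed_closed [simp, intro]: "x \<in> carrier M \<Longrightarrow> signed M p x \<in> carrier M"
  by (simp add: signed_def)

lemma signed_add: "\<lbrakk>x \<in> carrier M; y \<in> carrier M\<rbrakk> \<Longrightarrow>
    signed M p (x \<oplus>\<^bsub>M\<^esub> y) = signed M p x \<oplus>\<^bsub>M\<^esub> signed M p y"
  by (simp add: signed_def minus_add)

lemma signed_minus: "x \<in> carrier M \<Longrightarrow> signed M p (\<ominus>\<^bsub>M\<^esub> x) = \<ominus>\<^bsub>M\<^esub> signed M p x"
  by (simp add: signed_def)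

lemma signed_zero [simp]: "signed M p \<zero>\<^bsub>M\<^esub> = \<zero>\<^bsub>M\<^esub>"
  by (simp add: signed_def)

lemma signed_signed: "x \<in> carrier M \<Longrightarrow> signed M p (signed M q x) = signed M (p + q) x"
  by (auto simp: signed_def)

lemma signed_finsum:
  assumes "f \<in> A \<rightarrow> carrier M"
  shows "signed M p (finsum M f A) = (\<Oplus>\<^bsub>M\<^esub>i\<in>A. signed M p (f i))"
  using assms
proof (induction A rule: infinite_finite_induct)
  case (insert x F)
  then show ?case by (simp add: signed_add Pi_def)
qed (simp_all)

end

lemma (in module) smult_signed:
  "\<lbrakk>r \<in> carrier R; x \<in> carrier M\<rbrakk> \<Longrightarrow> r \<odot>\<^bsub>M\<^esub> signed M p x = signed M p (r \<odot>\<^bsub>M\<^esub> x)"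
  by (simp add: signed_def smult_r_minus)

text \<open>Right pre-Lie: the associator is symmetric in its last two arguments up to the Koszul
  sign. Isolating this identity keeps the list combinatorics of the Gerstenhaber composition out of
  the proofs of the Lie axioms.\<close>

locale graded_pre_lie =
  fixes K :: "('k, 'r) ring_scheme" and M :: "int \<Rightarrow> ('k, 'x) module"
    and c :: "int \<Rightarrow> int \<Rightarrow> 'x \<Rightarrow> 'x \<Rightarrow> 'x"
  assumes module: "module K (M p)"
    and closed: "\<lbrakk>x \<in> carrier (M p); y \<in> carrier (M q)\<rbrakk> \<Longrightarrow> c p q x y \<in> carrier (M (p + q))"
    and add_left: "\<lbrakk>x \<in> carrier (M p); x' \<in> carrier (M p); y \<in> carrier (M q)\<rbrakk> \<Longrightarrow>
      c p q (x \<oplus>\<^bsub>M p\<^esub> x') y = c p q x y \<oplus>\<^bsub>M (p + q)\<^esub> c p q x' y"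
    and add_right: "\<lbrakk>x \<in> carrier (M p); y \<in> carrier (M q); y' \<in> carrier (M q)\<rbrakk> \<Longrightarrow>
      c p q x (y \<oplus>\<^bsub>M q\<^esub> y') = c p q x y \<oplus>\<^bsub>M (p + q)\<^esub> c p q x y'"
    and smult_left: "\<lbrakk>r \<in> carrier K; x \<in> carrier (M p); y \<in> carrier (M q)\<rbrakk> \<Longrightarrow>
      c p q (r \<odot>\<^bsub>M p\<^esub> x) y = r \<odot>\<^bsub>M (p + q)\<^esub> c p q x y"
    and smult_right: "\<lbrakk>r \<in> carrier K; x \<in> carrier (M p); y \<in> carrier (M q)\<rbrakk> \<Longrightarrow>
      c p q x (r \<odot>\<^bsub>M q\<^esub> y) = r \<odot>\<^bsub>M (p + q)\<^esub> c p q x y"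
    and pre_lie: "\<lbrakk>x \<in> carrier (M p); y \<in> carrier (M q); z \<in> carrier (M s)\<rbrakk> \<Longrightarrow>
      c (p + q) s (c p q x y) z \<ominus>\<^bsub>M (p + q + s)\<^esub> c p (q + s) x (c q s y z) =
      signed (M (p + q + s)) (q * s)
        (c (p + s) q (c p s x z) y \<ominus>\<^bsub>M (p + q + s)\<^esub> c p (q + s) x (c s q z y))"
begin

lemma abelian: "abelian_group (M p)"
  using module by (simp add: module_def)

definition br :: "int \<Rightarrow> int \<Rightarrow> 'x \<Rightarrow> 'x \<Rightarrow> 'x" where
  "br p q x y = c p q x y \<ominus>\<^bsub>M (p + q)\<^esub> signed (M (p + q)) (p * q) (c q p y x)"

lemma minus_left: "\<lbrakk>x \<in> carrier (M p); y \<in> carrier (M q)\<rbrakk> \<Longrightarrow>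
    c p q (\<ominus>\<^bsub>M p\<^esub> x) y = \<ominus>\<^bsub>M (p + q)\<^esub> c p q x y"
proof -
  interpret P: module K "M p" by (rule module)
  interpret PQ: module K "M (p + q)" by (rule module)
  assume *: "x \<in> carrier (M p)" "y \<in> carrier (M q)"
  then show ?thesis
    using smult_left[of "\<ominus>\<^bsub>K\<^esub> \<one>\<^bsub>K\<^esub>" x p y q] closed
    by (simp add: P.smult_l_minus PQ.smult_l_minus)
qed

lemma minus_right: "\<lbrakk>x \<in> carrier (M p); y \<in> carrier (M q)\<rbrakk> \<Longrightarrow>
    c p q x (\<ominus>\<^bsub>M q\<^esub> y) = \<ominus>\<^bsub>M (p + q)\<^esub> c p q x y"
proof -
  interpret Q: module K "M q" by (rule module)
  interpret PQ: module K "M (p + q)" by (rule module)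
  assume *: "x \<in> carrier (M p)" "y \<in> carrier (M q)"
  then show ?thesis
    using smult_right[of "\<ominus>\<^bsub>K\<^esub> \<one>\<^bsub>K\<^esub>" x p y q] closed
    by (simp add: Q.smult_l_minus PQ.smult_l_minus)
qed

lemma signed_left: "\<lbrakk>x \<in> carrier (M p); y \<in> carrier (M q)\<rbrakk> \<Longrightarrow>
    c p q (signed (M p) e x) y = signed (M (p + q)) e (c p q x y)"
  by (simp add: signed_def minus_left)

lemma signed_right: "\<lbrakk>x \<in> carrier (M p); y \<in> carrier (M q)\<rbrakk> \<Longrightarrow>
    c p q x (signed (M q) e y) = signed (M (p + q)) e (c p q x y)"
  by (simp add: signed_def minus_right)

lemma closed': "\<lbrakk>x \<in> carrier (M p); y \<in> carrier (M q)\<rbrakk> \<Longrightarrow> c q p y x \<in> carrier (M (p + q))"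
  using closed[of y q x p] by (simp add: add.commute)

lemma br_closed: "\<lbrakk>x \<in> carrier (M p); y \<in> carrier (M q)\<rbrakk> \<Longrightarrow> br p q x y \<in> carrier (M (p + q))"
  unfolding br_def
  by (intro abelian_group.minus_closed module.signed_closed[OF module] abelian closed closed')

lemma br_add_left:
  assumes "x \<in> carrier (M p)" "x' \<in> carrier (M p)" "y \<in> carrier (M q)"
  shows "br p q (x \<oplus>\<^bsub>M p\<^esub> x') y = br p q x y \<oplus>\<^bsub>M (p + q)\<^esub> br p q x' y"
proof -
  interpret PQ: module K "M (p + q)" by (rule module)
  show ?thesis
    using assms add_right[of y q x p x'] closed closed'
    by (simp add: br_def add_left PQ.signed_add PQ.minus_eq PQ.minus_add PQ.a_ac add.commute[of q p])
qed

lemma br_add_right: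
  assumes "x \<in> carrier (M p)" "y \<in> carrier (M q)" "y' \<in> carrier (M q)"
  shows "br p q x (y \<oplus>\<^bsub>M q\<^esub> y') = br p q x y \<oplus>\<^bsub>M (p + q)\<^esub> br p q x y'"
proof -
  interpret PQ: module K "M (p + q)" by (rule module)
  show ?thesis
    using assms add_left[of y q y' x p] closed closed'
    by (simp add: br_def add_right PQ.signed_add PQ.minus_eq PQ.minus_add PQ.a_ac add.commute[of q p])
qed

lemma br_smult_left:
  assumes "r \<in> carrier K" "x \<in> carrier (M p)" "y \<in> carrier (M q)"
  shows "br p q (r \<odot>\<^bsub>M p\<^esub> x) y = r \<odot>\<^bsub>M (p + q)\<^esub> br p q x y"
proof -
  interpret PQ: module K "M (p + q)" by (rule module)
  show ?thesis
    using assms smult_right[of r y q x p] closed closed'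
    by (simp add: br_def smult_left PQ.smult_signed PQ.minus_eq PQ.smult_r_minus
        PQ.smult_r_distr add.commute[of q p])
qed

lemma br_smult_right:
  assumes "r \<in> carrier K" "x \<in> carrier (M p)" "y \<in> carrier (M q)"
  shows "br p q x (r \<odot>\<^bsub>M q\<^esub> y) = r \<odot>\<^bsub>M (p + q)\<^esub> br p q x y"
proof -
  interpret PQ: module K "M (p + q)" by (rule module)
  show ?thesis
    using assms smult_left[of r y q x p] closed closed'
    by (simp add: br_def smult_right PQ.smult_signed PQ.minus_eq PQ.smult_r_minus
        PQ.smult_r_distr add.commute[of q p])
qed

lemma br_antisymmetry:
  assumes "x \<in> carrier (M p)" "y \<in> carrier (M q)"
  shows "br p q x y = \<ominus>\<^bsub>M (p + q)\<^esub> signed (M (p + q)) (p * q) (br q p y x)"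
proof -
  interpret PQ: module K "M (p + q)" by (rule module)
  show ?thesis
    using assms closed closed'
    by (simp add: br_def add.commute[of q p] mult.commute[of q p] PQ.signed_add PQ.signed_minus
        PQ.signed_signed PQ.minus_eq PQ.minus_add PQ.a_ac) (simp add: signed_def)
qed

text \<open>Twelve products occur. By the pre-Lie identity the six of the form \<open>(ab)c\<close>
  are the corresponding \<open>a(bc)\<close> plus, up to sign, one of three associators
  \<open>F\<close>, \<open>P\<close>, \<open>Q\<close>, one for each first factor. Substituting
  these leaves an identity between right-nested products and associators in an abelian
  group.\<close>

lemma br_jacobi:
  assumes x: "x \<in> carrier (M p)" and y: "y \<in> carrier (M q)" and z: "z \<in> carrier (M s)"
  shows "br p (q + s) x (br q s y z) =
    br (p + q) s (br p q x y) z \<oplus>\<^bsub>M (p + q + s)\<^esub>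
    signed (M (p + q + s)) (p * q) (br q (p + s) y (br p s x z))"
proof -
  let ?M = "M (p + q + s)"
  interpret T: module K ?M by (rule module)
  note ac = add.assoc add.commute add.left_commute
  define x_yz where "x_yz = c p (q + s) x (c q s y z)"
  define x_zy where "x_zy = c p (q + s) x (c s q z y)"
  define y_xz where "y_xz = c q (p + s) y (c p s x z)"
  define y_zx where "y_zx = c q (p + s) y (c s p z x)"
  define z_xy where "z_xy = c s (p + q) z (c p q x y)"
  define z_yx where "z_yx = c s (p + q) z (c q p y x)"
  define xy_z where "xy_z = c (p + q) s (c p q x y) z"
  define xz_y where "xz_y = c (p + s) q (c p s x z) y"
  define yx_z where "yx_z = c (p + q) s (c q p y x) z"
  define yz_x where "yz_x = c (q + s) p (c q s y z) x"
  define zx_y where "zx_y = c (p + s) q (c s p z x) y"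
  define zy_x where "zy_x = c (q + s) p (c s q z y) x"
  note defs = x_yz_def x_zy_def y_xz_def y_zx_def z_xy_def z_yx_def xy_z_def xz_y_def yx_z_def
    yz_x_def zx_y_def zy_x_def
  have cl: "u \<in> carrier (M a) \<Longrightarrow> v \<in> carrier (M b) \<Longrightarrow> d = a + b \<Longrightarrow> c a b u v \<in> carrier (M d)"
    for u v a b d using closed by simp
  have carr [simp]: "x_yz \<in> carrier ?M" "x_zy \<in> carrier ?M" "y_xz \<in> carrier ?M" "y_zx \<in> carrier ?M"
    "z_xy \<in> carrier ?M" "z_yx \<in> carrier ?M" "xy_z \<in> carrier ?M" "xz_y \<in> carrier ?M"
    "yx_z \<in> carrier ?M" "yz_x \<in> carrier ?M" "zx_y \<in> carrier ?M" "zy_x \<in> carrier ?M"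
    unfolding defs by (auto intro!: cl x y z)
  define F where "F = xy_z \<ominus>\<^bsub>?M\<^esub> x_yz"
  define P where "P = yx_z \<ominus>\<^bsub>?M\<^esub> y_xz"
  define Q where "Q = zx_y \<ominus>\<^bsub>?M\<^esub> z_xy"
  have [simp]: "F \<in> carrier ?M" "P \<in> carrier ?M" "Q \<in> carrier ?M"
    by (simp_all add: F_def P_def Q_def)
  have solve: "u = v \<oplus>\<^bsub>?M\<^esub> w" if "w = u \<ominus>\<^bsub>?M\<^esub> v" "u \<in> carrier ?M" "v \<in> carrier ?M" for u v w
    using that by (simp add: T.minus_eq T.a_lcomm T.r_neg)
  have e1: "xy_z = x_yz \<oplus>\<^bsub>?M\<^esub> F" "yx_z = y_xz \<oplus>\<^bsub>?M\<^esub> P" "zx_y = z_xy \<oplus>\<^bsub>?M\<^esub> Q"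
    by (rule solve; simp add: F_def P_def Q_def)+
  have flip: "signed ?M e u = w" if "u = signed ?M e w" "w \<in> carrier ?M" for u w e
    using that by (simp add: signed_def)
  have "signed ?M (q * s) F = xz_y \<ominus>\<^bsub>?M\<^esub> x_zy"
    by (rule flip) (use pre_lie[OF x y z] in \<open>simp_all add: F_def defs[symmetric]\<close>)
  then have e2: "xz_y = x_zy \<oplus>\<^bsub>?M\<^esub> signed ?M (q * s) F"
    by (intro solve) simp_all
  have "signed ?M (p * s) P = yz_x \<ominus>\<^bsub>?M\<^esub> y_zx"
    by (rule flip[OF _ T.minus_closed[OF carr(10) carr(4)]]) (use pre_lie[OF y x z] in \<open>simp add: P_def defs ac\<close>)
  then have e3: "yz_x = y_zx \<oplus>\<^bsub>?M\<^esub> signed ?M (p * s) P"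
    by (intro solve) simp_all
  have "signed ?M (p * q) Q = zy_x \<ominus>\<^bsub>?M\<^esub> z_yx"
    by (rule flip[OF _ T.minus_closed[OF carr(12) carr(6)]]) (use pre_lie[OF z x y] in \<open>simp add: Q_def defs ac\<close>)
  then have e4: "zy_x = z_yx \<oplus>\<^bsub>?M\<^esub> signed ?M (p * q) Q"
    by (intro solve) simp_all
  let ?s = "signed ?M"
  \<comment> \<open>The degrees \<open>d\<close> and \<open>p + q + s\<close> are tied to
    \<open>a\<close> and \<open>b\<close> by equations, so that one statement serves all regroupings
    of the degrees.\<close>
  have dl: "c a b (u \<ominus>\<^bsub>M d\<^esub> signed (M d) e v) w = c a b u w \<ominus>\<^bsub>?M\<^esub> ?s e (c a b v w)"
    if "u \<in> carrier (M a)" "v \<in> carrier (M a)" "w \<in> carrier (M b)" "d = a" "p + q + s = a + b"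
    for a b d e u v w
    using that abelian[of a] module.signed_closed[OF module[of a]] unfolding a_minus_def
    by (simp add: add_left minus_left signed_left abelian_group.a_inv_closed)
  have dr: "c b a w (u \<ominus>\<^bsub>M d\<^esub> signed (M d) e v) = c b a w u \<ominus>\<^bsub>?M\<^esub> ?s e (c b a w v)"
    if "u \<in> carrier (M a)" "v \<in> carrier (M a)" "w \<in> carrier (M b)" "d = a" "p + q + s = b + a"
    for a b d e u v w
    using that abelian[of a] module.signed_closed[OF module[of a]] unfolding a_minus_def
    by (simp add: add_right minus_right signed_right abelian_group.a_inv_closed)
  have xr: "c p (q + s) x (c q s y z \<ominus>\<^bsub>M (q + s)\<^esub> signed (M (q + s)) (q * s) (c s q z y)) =
      x_yz \<ominus>\<^bsub>?M\<^esub> ?s (q * s) x_zy"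
    by (subst dr) (auto intro!: cl x y z simp: defs ac)
  have xl: "c (q + s) p (c q s y z \<ominus>\<^bsub>M (q + s)\<^esub> signed (M (q + s)) (q * s) (c s q z y)) x =
      yz_x \<ominus>\<^bsub>?M\<^esub> ?s (q * s) zy_x"
    by (subst dl) (auto intro!: cl x y z simp: defs ac)
  have yr: "c q (p + s) y (c p s x z \<ominus>\<^bsub>M (p + s)\<^esub> signed (M (p + s)) (p * s) (c s p z x)) =
      y_xz \<ominus>\<^bsub>?M\<^esub> ?s (p * s) y_zx"
    by (subst dr) (auto intro!: cl x y z simp: defs ac)
  have yl: "c (p + s) q (c p s x z \<ominus>\<^bsub>M (p + s)\<^esub> signed (M (p + s)) (p * s) (c s p z x)) y =
      xz_y \<ominus>\<^bsub>?M\<^esub> ?s (p * s) zx_y"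
    by (subst dl) (auto intro!: cl x y z simp: defs ac)
  have zr: "c s (p + q) z (c p q x y \<ominus>\<^bsub>M (p + q)\<^esub> signed (M (p + q)) (p * q) (c q p y x)) =
      z_xy \<ominus>\<^bsub>?M\<^esub> ?s (p * q) z_yx"
    by (subst dr) (auto intro!: cl x y z simp: defs ac)
  have zl: "c (p + q) s (c p q x y \<ominus>\<^bsub>M (p + q)\<^esub> signed (M (p + q)) (p * q) (c q p y x)) z =
      xy_z \<ominus>\<^bsub>?M\<^esub> ?s (p * q) yx_z"
    by (subst dl) (auto intro!: cl x y z simp: defs ac)
  have x_br: "br p (q + s) x (br q s y z) = x_yz \<ominus>\<^bsub>?M\<^esub> ?s (q * s) x_zy \<ominus>\<^bsub>?M\<^esub>
      ?s (p * (q + s)) (yz_x \<ominus>\<^bsub>?M\<^esub> ?s (q * s) zy_x)"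
    unfolding br_def xr xl by (simp add: ac)
  have y_br: "br q (p + s) y (br p s x z) = y_xz \<ominus>\<^bsub>?M\<^esub> ?s (p * s) y_zx \<ominus>\<^bsub>?M\<^esub>
      ?s (q * (p + s)) (xz_y \<ominus>\<^bsub>?M\<^esub> ?s (p * s) zx_y)"
    unfolding br_def yr yl by (simp add: ac)
  have br_z: "br (p + q) s (br p q x y) z = xy_z \<ominus>\<^bsub>?M\<^esub> ?s (p * q) yx_z \<ominus>\<^bsub>?M\<^esub>
      ?s ((p + q) * s) (z_xy \<ominus>\<^bsub>?M\<^esub> ?s (p * q) z_yx)"
    unfolding br_def zr zl by (simp add: ac)
  \<comment> \<open>The summands \<open>F\<close>, \<open>y_xz\<close>, \<open>z_xy\<close> cancel on the right-hand side.  Their inverses get names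
    that follow them in the term order, so that AC-rewriting makes the cancelling pairs adjacent.\<close>
  define G where "G = \<ominus>\<^bsub>?M\<^esub> F"
  define y_yx where "y_yx = \<ominus>\<^bsub>?M\<^esub> y_xz"
  define z_xz where "z_xz = \<ominus>\<^bsub>?M\<^esub> z_xy"
  have [simp]: "G \<in> carrier ?M" "y_yx \<in> carrier ?M" "z_xz \<in> carrier ?M"
    by (simp_all add: G_def y_yx_def z_xz_def)
  have neg: "\<ominus>\<^bsub>?M\<^esub> F = G" "\<ominus>\<^bsub>?M\<^esub> G = F" "\<ominus>\<^bsub>?M\<^esub> y_xz = y_yx" "\<ominus>\<^bsub>?M\<^esub> y_yx = y_xz"
    "\<ominus>\<^bsub>?M\<^esub> z_xy = z_xz" "\<ominus>\<^bsub>?M\<^esub> z_xz = z_xy"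
    by (simp_all add: G_def y_yx_def z_xz_def)
  have cancel: "F \<oplus>\<^bsub>?M\<^esub> (G \<oplus>\<^bsub>?M\<^esub> u) = u" "y_xz \<oplus>\<^bsub>?M\<^esub> (y_yx \<oplus>\<^bsub>?M\<^esub> u) = u"
    "z_xy \<oplus>\<^bsub>?M\<^esub> (z_xz \<oplus>\<^bsub>?M\<^esub> u) = u" if "u \<in> carrier ?M" for u
    using that by (simp_all add: G_def y_yx_def z_xz_def T.r_neg2)
  \<comment> \<open>All signs depend on the parities of \<open>p\<close>, \<open>q\<close>,
    \<open>s\<close> alone, which leaves eight sign patterns.\<close>
  show ?thesis
    unfolding x_br y_br br_z e1 e2 e3 e4
    by (cases "even p"; cases "even q"; cases "even s")
      (simp_all add: signed_def T.minus_eq T.minus_add T.a_ac neg cancel)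
qed

end

lemma linear_mapsI:
  assumes "h \<in> carrier M \<rightarrow>\<^sub>E carrier N"
    and "\<And>x y. \<lbrakk>x \<in> carrier M; y \<in> carrier M\<rbrakk> \<Longrightarrow> h (x \<oplus>\<^bsub>M\<^esub> y) = h x \<oplus>\<^bsub>N\<^esub> h y"
    and "\<And>r x. \<lbrakk>r \<in> carrier K; x \<in> carrier M\<rbrakk> \<Longrightarrow> h (r \<odot>\<^bsub>M\<^esub> x) = r \<odot>\<^bsub>N\<^esub> h x"
  shows "h \<in> linear_maps K M N"
  using assms by (simp add: linear_maps_def)

text \<open>The image of 1/2 in \<open>K\<close> is a scalar that undoes doubling.\<close>

lemma contains_rationals_double_eq_zero:
  assumes "module K M" "contains_rationals K" "x \<in> carrier M" "x \<oplus>\<^bsub>M\<^esub> x = \<zero>\<^bsub>M\<^esub>"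
  shows "x = \<zero>\<^bsub>M\<^esub>"
proof -
  interpret module K M by fact
  obtain h :: "rat \<Rightarrow> 'a"
    where h: "h \<in> ring_hom \<lparr>carrier = UNIV, mult = (*), one = 1, zero = 0, add = (+)\<rparr> K"
    using assms(2) unfolding contains_rationals_def by auto
  have hc: "h r \<in> carrier K" for r
    using ring_hom_closed[OF h] by simp
  have "h (1/2) \<oplus>\<^bsub>K\<^esub> h (1/2) = \<one>\<^bsub>K\<^esub>"
    using ring_hom_add[OF h, of "1/2" "1/2"] ring_hom_one[OF h] by simp
  then have "x = (h (1/2) \<oplus>\<^bsub>K\<^esub> h (1/2)) \<odot>\<^bsub>M\<^esub> x"
    using assms(3) by simp
  also have "\<dots> = h (1/2) \<odot>\<^bsub>M\<^esub> (x \<oplus>\<^bsub>M\<^esub> x)"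
    using assms(3) hc by (simp add: smult_l_distr smult_r_distr)
  finally show ?thesis
    using assms(4) hc by simp
qed

section \<open>The differential given by a square-zero element of degree 1\<close>

context graded_pre_lie
begin

lemma br_minus_left: "\<lbrakk>x \<in> carrier (M p); y \<in> carrier (M q)\<rbrakk> \<Longrightarrow>
    br p q (\<ominus>\<^bsub>M p\<^esub> x) y = \<ominus>\<^bsub>M (p + q)\<^esub> br p q x y"
proof -
  interpret P: module K "M p" by (rule module)
  interpret PQ: module K "M (p + q)" by (rule module)
  assume *: "x \<in> carrier (M p)" "y \<in> carrier (M q)"
  then show ?thesis
    using br_smult_left[of "\<ominus>\<^bsub>K\<^esub> \<one>\<^bsub>K\<^esub>" x p y q] br_closed
    by (simp add: P.smult_l_minus PQ.smult_l_minus)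
qed

lemma br_minus_right: "\<lbrakk>x \<in> carrier (M p); y \<in> carrier (M q)\<rbrakk> \<Longrightarrow>
    br p q x (\<ominus>\<^bsub>M q\<^esub> y) = \<ominus>\<^bsub>M (p + q)\<^esub> br p q x y"
proof -
  interpret Q: module K "M q" by (rule module)
  interpret PQ: module K "M (p + q)" by (rule module)
  assume *: "x \<in> carrier (M p)" "y \<in> carrier (M q)"
  then show ?thesis
    using br_smult_right[of "\<ominus>\<^bsub>K\<^esub> \<one>\<^bsub>K\<^esub>" x p y q] br_closed
    by (simp add: Q.smult_l_minus PQ.smult_l_minus)
qed

lemma br_zero_right: "x \<in> carrier (M p) \<Longrightarrow> br p q x \<zero>\<^bsub>M q\<^esub> = \<zero>\<^bsub>M (p + q)\<^esub>"
proof -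
  interpret Q: module K "M q" by (rule module)
  interpret PQ: module K "M (p + q)" by (rule module)
  assume "x \<in> carrier (M p)"
  then show ?thesis
    using br_smult_right[of "\<zero>\<^bsub>K\<^esub>" x p "\<zero>\<^bsub>M q\<^esub>" q] br_closed by simp
qed

definition bdif :: "'x \<Rightarrow> int \<Rightarrow> 'x \<Rightarrow> 'x" where
  "bdif \<mu> p x = \<ominus>\<^bsub>M (p + 1)\<^esub> br p 1 x \<mu>"

lemma bdif_closed: "\<lbrakk>\<mu> \<in> carrier (M 1); x \<in> carrier (M p)\<rbrakk> \<Longrightarrow> bdif \<mu> p x \<in> carrier (M (p + 1))"
  unfolding bdif_def by (intro abelian_group.a_inv_closed abelian br_closed)

lemma bdif_linear:
  assumes "\<mu> \<in> carrier (M 1)"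
  shows "restrict (bdif \<mu> p) (carrier (M p)) \<in> linear_maps K (M p) (M (p + 1))"
proof (rule linear_mapsI)
  interpret P: module K "M p" by (rule module)
  interpret P1: module K "M (p + 1)" by (rule module)
  show "restrict (bdif \<mu> p) (carrier (M p)) \<in> carrier (M p) \<rightarrow>\<^sub>E carrier (M (p + 1))"
    using assms bdif_closed by auto
  fix x y assume "x \<in> carrier (M p)" "y \<in> carrier (M p)"
  then show "restrict (bdif \<mu> p) (carrier (M p)) (x \<oplus>\<^bsub>M p\<^esub> y) =
      restrict (bdif \<mu> p) (carrier (M p)) x \<oplus>\<^bsub>M (p + 1)\<^esub> restrict (bdif \<mu> p) (carrier (M p)) y"
    using assms by (simp add: bdif_def br_add_left br_closed P1.minus_add P1.a_comm)
next
  interpret P: module K "M p" by (rule module)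
  interpret P1: module K "M (p + 1)" by (rule module)
  fix r x assume "r \<in> carrier K" "x \<in> carrier (M p)"
  then show "restrict (bdif \<mu> p) (carrier (M p)) (r \<odot>\<^bsub>M p\<^esub> x) =
      r \<odot>\<^bsub>M (p + 1)\<^esub> restrict (bdif \<mu> p) (carrier (M p)) x"
    using assms by (simp add: bdif_def br_smult_left br_closed P1.smult_r_minus)
qed

text \<open>The Jacobi identity for \<open>x, \<mu>, \<mu>\<close> produces
  \<open>[[x, \<mu>], \<mu>]\<close> twice, as antisymmetry turns its second summand into the first.
  Since \<open>[\<mu>, \<mu>]\<close> is twice \<open>c 1 1 \<mu> \<mu>\<close> and hence zero, the
  double of \<open>[[x, \<mu>], \<mu>]\<close> vanishes.\<close>

lemma bdif_bdif:
  assumes mu: "\<mu> \<in> carrier (M 1)" "c 1 1 \<mu> \<mu> = \<zero>\<^bsub>M 2\<^esub>" and x: "x \<in> carrier (M p)"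
    and double: "\<And>z. \<lbrakk>z \<in> carrier (M (p + 2)); z \<oplus>\<^bsub>M (p + 2)\<^esub> z = \<zero>\<^bsub>M (p + 2)\<^esub>\<rbrakk> \<Longrightarrow>
      z = \<zero>\<^bsub>M (p + 2)\<^esub>"
  shows "bdif \<mu> (p + 1) (bdif \<mu> p x) = \<zero>\<^bsub>M (p + 2)\<^esub>"
proof -
  have idx: "p + 1 + 1 = p + 2" "1 + (p + 1) = p + 2" by simp_all
  interpret T: module K "M (p + 2)" by (rule module)
  interpret T2: module K "M 2" by (rule module)
  define w where "w = br p 1 x \<mu>"
  have w: "w \<in> carrier (M (p + 1))"
    using mu x by (simp add: w_def br_closed)
  define z where "z = br (p + 1) 1 w \<mu>"
  have z: "z \<in> carrier (M (p + 2))"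
    using br_closed[OF w mu(1)] by (simp only: z_def idx)
  have "br 1 1 \<mu> \<mu> = \<zero>\<^bsub>M 2\<^esub>"
    using mu(2) by (simp add: br_def T2.minus_eq T2.r_neg)
  then have "\<zero>\<^bsub>M (p + 2)\<^esub> = br p 2 x (br 1 1 \<mu> \<mu>)"
    using br_zero_right[OF x, of 2] by simp
  also have "\<dots> = z \<oplus>\<^bsub>M (p + 2)\<^esub> signed (M (p + 2)) p (br 1 (p + 1) \<mu> w)"
    using br_jacobi[OF x mu(1) mu(1)] unfolding z_def w_def by (simp only: idx one_add_one mult_1_right)
  also have "br 1 (p + 1) \<mu> w = \<ominus>\<^bsub>M (p + 2)\<^esub> signed (M (p + 2)) (p + 1) z"
    using br_antisymmetry[OF mu(1) w] by (simp only: z_def idx mult_1)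
  also have "signed (M (p + 2)) p \<dots> = z"
    using z by (simp add: signed_def)
  finally have "z = \<zero>\<^bsub>M (p + 2)\<^esub>"
    by (rule double[OF z, OF sym])
  moreover have "bdif \<mu> (p + 1) (bdif \<mu> p x) = \<ominus>\<^bsub>M (p + 2)\<^esub> (\<ominus>\<^bsub>M (p + 2)\<^esub> z)"
    using br_minus_left[OF w mu(1)] by (simp only: bdif_def z_def w_def idx)
  ultimately show ?thesis
    using z by simp
qed

text \<open>This is the Jacobi identity for \<open>x, y, \<mu>\<close>. Moving
  \<open>[x, \<mu>]\<close> to the left of \<open>y\<close> contributes the exponent
  \<open>q (p + 1)\<close>; added to \<open>p q\<close> it leaves \<open>q\<close>, the sign of a
  differential acting from the right.\<close>

lemma bdif_leibniz:
  assumes mu: "\<mu> \<in> carrier (M 1)" and x: "x \<in> carrier (M p)" and y: "y \<in> carrier (M q)"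
  shows "bdif \<mu> (p + q) (br p q x y) = br p (q + 1) x (bdif \<mu> q y) \<oplus>\<^bsub>M (p + q + 1)\<^esub>
    signed (M (p + q + 1)) q (br (p + 1) q (bdif \<mu> p x) y)"
proof -
  let ?M = "M (p + q + 1)"
  interpret T: module K ?M by (rule module)
  have dx: "br p 1 x \<mu> \<in> carrier (M (p + 1))" and dy: "br q 1 y \<mu> \<in> carrier (M (q + 1))"
    using br_closed mu x y by auto
  define u where "u = br (p + q) 1 (br p q x y) \<mu>"
  define v where "v = br p (q + 1) x (br q 1 y \<mu>)"
  define w where "w = br (p + 1) q (br p 1 x \<mu>) y"
  have c: "u \<in> carrier ?M" "v \<in> carrier ?M" "w \<in> carrier ?M"
    using br_closed[OF br_closed[OF x y] mu] br_closed[OF x dy] br_closed[OF dx y]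
    by (simp_all add: u_def v_def w_def ac_simps)
  have "v = u \<oplus>\<^bsub>?M\<^esub> signed ?M (p * q) (br q (p + 1) y (br p 1 x \<mu>))"
    using br_jacobi[OF x y mu] by (simp add: u_def v_def)
  also have "br q (p + 1) y (br p 1 x \<mu>) = \<ominus>\<^bsub>?M\<^esub> signed ?M (q * (p + 1)) w"
    using br_antisymmetry[OF y dx] by (simp add: w_def ac_simps)
  also have "signed ?M (p * q) \<dots> = \<ominus>\<^bsub>?M\<^esub> signed ?M q w"
    using c by (simp add: signed_def)
  finally have "u = v \<oplus>\<^bsub>?M\<^esub> signed ?M q w"
    using c by (simp add: T.a_assoc T.l_neg)
  moreover have "br p (q + 1) x (bdif \<mu> q y) = \<ominus>\<^bsub>?M\<^esub> v"
    using br_minus_right[OF x dy] by (simp add: bdif_def v_def ac_simps)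
  moreover have "br (p + 1) q (bdif \<mu> p x) y = \<ominus>\<^bsub>?M\<^esub> w"
    using br_minus_left[OF dx y] by (simp add: bdif_def w_def ac_simps)
  ultimately show ?thesis
    using c by (simp add: bdif_def u_def[symmetric] T.minus_add T.signed_minus T.a_comm)
qed

theorem dgla_br:
  assumes "\<mu> \<in> carrier (M 1)" "c 1 1 \<mu> \<mu> = \<zero>\<^bsub>M 2\<^esub>"
    and "\<And>p z. \<lbrakk>z \<in> carrier (M p); z \<oplus>\<^bsub>M p\<^esub> z = \<zero>\<^bsub>M p\<^esub>\<rbrakk> \<Longrightarrow> z = \<zero>\<^bsub>M p\<^esub>"
  shows "dgla K \<lparr>gr = M, brk = br, dif = bdif \<mu>\<rparr>"
  by (rule dgla.intro; unfold dgla.select_convs)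
    (fact module br_closed br_add_left br_add_right br_smult_left br_smult_right br_antisymmetry
      br_jacobi bdif_linear[OF assms(1)]
    | rule bdif_bdif[OF assms(1,2) _ assms(3)] bdif_leibniz[OF assms(1)], assumption+)+

end

subsection \<open>Multilinear maps\<close>

context module
begin

text \<open>In contrast to \<open>linear_maps\<close>, nothing is demanded outside the carrier: a
  multilinear map with all but one slot filled is a \<open>linear_op\<close> without restricting its
  domain.\<close>

definition linear_op :: "('c \<Rightarrow> 'c) \<Rightarrow> bool" where
  "linear_op L \<longleftrightarrow> (\<forall>a \<in> carrier M. L a \<in> carrier M) \<and>
     (\<forall>a \<in> carrier M. \<forall>b \<in> carrier M. L (a \<oplus>\<^bsub>M\<^esub> b) = L a \<oplus>\<^bsub>M\<^esub> L b) \<and>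
     (\<forall>r \<in> carrier R. \<forall>a \<in> carrier M. L (r \<odot>\<^bsub>M\<^esub> a) = r \<odot>\<^bsub>M\<^esub> L a)"

lemma linear_op_closed: "\<lbrakk>linear_op L; a \<in> carrier M\<rbrakk> \<Longrightarrow> L a \<in> carrier M"
  by (simp add: linear_op_def)

lemma linear_op_minus: "\<lbrakk>linear_op L; a \<in> carrier M\<rbrakk> \<Longrightarrow> L (\<ominus>\<^bsub>M\<^esub> a) = \<ominus>\<^bsub>M\<^esub> L a"
  unfolding linear_op_def
  by (metis R.add.inv_closed R.one_closed smult_l_minus smult_one)

lemma linear_op_zero: "linear_op L \<Longrightarrow> L \<zero>\<^bsub>M\<^esub> = \<zero>\<^bsub>M\<^esub>"
  unfolding linear_op_def
  by (metis M.zero_closed R.zero_closed smult_l_null)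

lemma linear_op_signed:
  "\<lbrakk>linear_op L; a \<in> carrier M\<rbrakk> \<Longrightarrow> L (signed M p a) = signed M p (L a)"
  by (simp add: signed_def linear_op_minus)

lemma linear_op_finsum:
  assumes "linear_op L" "finite A" "f \<in> A \<rightarrow> carrier M"
  shows "L (finsum M f A) = (\<Oplus>\<^bsub>M\<^esub>i\<in>A. L (f i))"
  using assms(2,3)
proof (induction A rule: finite_induct)
  case empty
  then show ?case using assms(1) by (simp add: linear_op_zero)
next
  case (insert x F)
  then show ?case using assms(1) by (simp add: linear_op_def Pi_def)
qed

lemma linear_op_comp: "\<lbrakk>linear_op L; linear_op L'\<rbrakk> \<Longrightarrow> linear_op (\<lambda>a. L (L' a))"
  by (simp add: linear_op_def)

lemma linear_op_null: "linear_op (\<lambda>a. \<zero>\<^bsub>M\<^esub>)"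
  by (simp add: linear_op_def)

lemma linear_op_add: "\<lbrakk>linear_op L; linear_op L'\<rbrakk> \<Longrightarrow> linear_op (\<lambda>a. L a \<oplus>\<^bsub>M\<^esub> L' a)"
  by (simp add: linear_op_def M.a_ac smult_r_distr)

lemma linear_op_uminus: "linear_op L \<Longrightarrow> linear_op (\<lambda>a. \<ominus>\<^bsub>M\<^esub> L a)"
  by (simp add: linear_op_def M.minus_add M.a_comm smult_r_minus)

lemma linear_op_sgn: "linear_op L \<Longrightarrow> linear_op (\<lambda>a. signed M p (L a))"
  by (cases "even p") (simp_all add: signed_def linear_op_uminus)

lemma linear_op_scale:
  assumes "r \<in> carrier R" "linear_op L"
  shows "linear_op (\<lambda>a. r \<odot>\<^bsub>M\<^esub> L a)"
  using assms smult_assoc1[symmetric] R.m_comm by (simp add: linear_op_def smult_r_distr)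

lemma linear_op_sum:
  assumes "finite A" "\<And>i. i \<in> A \<Longrightarrow> linear_op (L i)"
  shows "linear_op (\<lambda>a. \<Oplus>\<^bsub>M\<^esub>i\<in>A. L i a)"
  using assms
proof (induction A rule: finite_induct)
  case empty
  then show ?case by (simp add: linear_op_null)
next
  case (insert x F)
  have "linear_op (\<lambda>a. L x a \<oplus>\<^bsub>M\<^esub> (\<Oplus>\<^bsub>M\<^esub>i\<in>F. L i a))"
    by (rule linear_op_add) (use insert in auto)
  moreover have "(\<Oplus>\<^bsub>M\<^esub>i\<in>insert x F. L i a) = L x a \<oplus>\<^bsub>M\<^esub> (\<Oplus>\<^bsub>M\<^esub>i\<in>F. L i a)" if "a \<in> carrier M" for a
    using insert that by (subst M.finsum_insert) (auto simp: linear_op_closed)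
  ultimately show ?case
    by (simp add: linear_op_def)
qed

text \<open>Slotwise formulation: multilinearity of a composite reduces to closure of
  \<open>linear_op\<close> under composition, sums and signs.\<close>

lemma multilinear_mapsI:
  assumes "f \<in> tuples M n \<rightarrow>\<^sub>E carrier M"
    and lin: "\<And>xs ys. \<lbrakk>set xs \<subseteq> carrier M; set ys \<subseteq> carrier M; int (length xs + length ys) + 1 = n\<rbrakk> \<Longrightarrow>
      linear_op (\<lambda>a. f (xs @ a # ys))"
  shows "f \<in> multilinear_maps R M n"
proof -
  have "linear_op (\<lambda>a. f (xs @ a # ys)) \<and> a \<in> carrier M" if "xs @ a # ys \<in> tuples M n" for xs a ys
    using that lin[of xs ys] by (auto simp: tuples_def)
  then show ?thesis
    using assms(1) unfolding multilinear_maps_def linear_op_def by blast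
qed

lemma multilinear_linear_op:
  assumes "f \<in> multilinear_maps R M n"
    and "set xs \<subseteq> carrier M" "set ys \<subseteq> carrier M" "int (length xs + length ys) + 1 = n"
  shows "linear_op (\<lambda>a. f (xs @ a # ys))"
proof -
  have t: "a \<in> carrier M \<Longrightarrow> xs @ a # ys \<in> tuples M n" for a
    using assms by (auto simp: tuples_def)
  show ?thesis
    using assms(1) t unfolding multilinear_maps_def linear_op_def by blast
qed

lemma multilinear_closed:
  "\<lbrakk>f \<in> multilinear_maps R M n; xs \<in> tuples M n\<rbrakk> \<Longrightarrow> f xs \<in> carrier M"
  by (auto simp: multilinear_maps_def)

lemma multilinear_eqI:
  assumes "f \<in> multilinear_maps R M n" "g \<in> multilinear_maps R M n"
    and "\<And>xs. xs \<in> tuples M n \<Longrightarrow> f xs = g xs"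
  shows "f = g"
  using assms unfolding multilinear_maps_def
  by (intro extensionalityI[of f "tuples M n" g]) (auto simp: PiE_def)

lemma restrict_multilinear:
  assumes "f \<in> tuples M n \<rightarrow> carrier M"
    and "\<And>xs ys. \<lbrakk>set xs \<subseteq> carrier M; set ys \<subseteq> carrier M; int (length xs + length ys) + 1 = n\<rbrakk> \<Longrightarrow>
      linear_op (\<lambda>a. f (xs @ a # ys))"
  shows "restrict f (tuples M n) \<in> multilinear_maps R M n"
proof (rule multilinear_mapsI)
  fix xs ys assume *: "set xs \<subseteq> carrier M" "set ys \<subseteq> carrier M" "int (length xs + length ys) + 1 = n"
  have "restrict f (tuples M n) (xs @ a # ys) = f (xs @ a # ys)" if "a \<in> carrier M" for a
    using * that by (auto simp: tuples_def)
  then show "linear_op (\<lambda>a. restrict f (tuples M n) (xs @ a # ys))"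
    using assms(2)[OF *] by (simp add: linear_op_def)
qed (use assms(1) in auto)

lemma cochains_module: "module R (cochains R M n)"
proof (rule moduleI)
  have add: "(\<lambda>xs \<in> tuples M n. f xs \<oplus>\<^bsub>M\<^esub> g xs) \<in> multilinear_maps R M n"
    if "f \<in> multilinear_maps R M n" "g \<in> multilinear_maps R M n" for f g
    using that by (intro restrict_multilinear linear_op_add)
      (auto simp: multilinear_closed intro: multilinear_linear_op)
  have zero: "(\<lambda>xs \<in> tuples M n. \<zero>\<^bsub>M\<^esub>) \<in> multilinear_maps R M n"
    by (intro restrict_multilinear linear_op_null) auto
  have minus: "(\<lambda>xs \<in> tuples M n. \<ominus>\<^bsub>M\<^esub> f xs) \<in> multilinear_maps R M n"
    if "f \<in> multilinear_maps R M n" for f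
    using that by (intro restrict_multilinear linear_op_uminus)
      (auto simp: multilinear_closed intro: multilinear_linear_op)
  have smult: "(\<lambda>xs \<in> tuples M n. r \<odot>\<^bsub>M\<^esub> f xs) \<in> multilinear_maps R M n"
    if "f \<in> multilinear_maps R M n" "r \<in> carrier R" for r f
    using that by (intro restrict_multilinear linear_op_scale)
      (auto simp: multilinear_closed intro: multilinear_linear_op)
  show "cring R" by (rule R.is_cring)
  show "abelian_group (cochains R M n)"
  proof (rule abelian_groupI)
    fix x assume "x \<in> carrier (cochains R M n)"
    then have x: "x \<in> multilinear_maps R M n"
      by (simp add: cochains_def)
    let ?y = "\<lambda>xs \<in> tuples M n. \<ominus>\<^bsub>M\<^esub> x xs"
    have "(\<lambda>xs \<in> tuples M n. ?y xs \<oplus>\<^bsub>M\<^esub> x xs) = (\<lambda>xs \<in> tuples M n. \<zero>\<^bsub>M\<^esub>)"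
      using x by (intro restrict_ext) (simp add: multilinear_closed M.l_neg)
    then show "\<exists>y\<in>carrier (cochains R M n). y \<oplus>\<^bsub>cochains R M n\<^esub> x = \<zero>\<^bsub>cochains R M n\<^esub>"
      using minus[OF x] unfolding cochains_def partial_object.select_convs ring.select_convs
      by (rule bexI)
  next
    fix x assume "x \<in> carrier (cochains R M n)"
    then have x: "x \<in> multilinear_maps R M n"
      by (simp add: cochains_def)
    have "(\<lambda>xs \<in> tuples M n. (\<lambda>xs \<in> tuples M n. \<zero>\<^bsub>M\<^esub>) xs \<oplus>\<^bsub>M\<^esub> x xs) = x"
      by (rule multilinear_eqI[OF add[OF zero x] x]) (use x in \<open>simp add: multilinear_closed\<close>)
    then show "\<zero>\<^bsub>cochains R M n\<^esub> \<oplus>\<^bsub>cochains R M n\<^esub> x = x"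
      unfolding cochains_def ring.select_convs .
  qed (auto simp: cochains_def multilinear_closed M.a_ac intro!: add zero restrict_ext)
  fix x assume "x \<in> carrier (cochains R M n)"
  then have x: "x \<in> multilinear_maps R M n"
    by (simp add: cochains_def)
  have "(\<lambda>xs \<in> tuples M n. \<one>\<^bsub>R\<^esub> \<odot>\<^bsub>M\<^esub> x xs) = x"
    by (rule multilinear_eqI[OF smult[OF x] x]) (use x in \<open>simp_all add: multilinear_closed\<close>)
  then show "\<one>\<^bsub>R\<^esub> \<odot>\<^bsub>cochains R M n\<^esub> x = x"
    by (simp add: cochains_def)
qed (auto simp: cochains_def multilinear_closed smult_l_distr smult_r_distr
      smult_assoc1 restrict_multilinear linear_op_scale multilinear_linear_op intro!: restrict_ext)

lemma
  assumes "xs \<in> tuples M n"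
  shows cochains_zero_apply: "\<zero>\<^bsub>cochains R M n\<^esub> xs = \<zero>\<^bsub>M\<^esub>"
    and cochains_add_apply: "(f \<oplus>\<^bsub>cochains R M n\<^esub> g) xs = f xs \<oplus>\<^bsub>M\<^esub> g xs"
    and cochains_smult_apply: "(r \<odot>\<^bsub>cochains R M n\<^esub> f) xs = r \<odot>\<^bsub>M\<^esub> f xs"
  using assms by (simp_all add: cochains_def)

text \<open>Negation in a module record is determined by its addition, so the pointwise formula
  comes from the uniqueness of inverses.\<close>

lemma cochains_minus_apply:
  assumes "f \<in> carrier (cochains R M n)" "xs \<in> tuples M n"
  shows "(\<ominus>\<^bsub>cochains R M n\<^esub> f) xs = \<ominus>\<^bsub>M\<^esub> f xs"
proof -
  interpret C: module R "cochains R M n" by (rule cochains_module)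
  have "(\<ominus>\<^bsub>cochains R M n\<^esub> f) xs \<oplus>\<^bsub>M\<^esub> f xs = \<zero>\<^bsub>M\<^esub>"
    using C.l_neg[OF assms(1)] assms(2) by (metis cochains_add_apply cochains_zero_apply)
  moreover have "f xs \<in> carrier M" "(\<ominus>\<^bsub>cochains R M n\<^esub> f) xs \<in> carrier M"
    using assms C.a_inv_closed[OF assms(1)] by (auto simp: cochains_def intro: multilinear_closed)
  ultimately show ?thesis
    by (simp add: M.minus_equality)
qed

lemma cochains_signed_apply:
  "\<lbrakk>f \<in> carrier (cochains R M n); xs \<in> tuples M n\<rbrakk> \<Longrightarrow>
    signed (cochains R M n) p f xs = signed M p (f xs)"
  by (simp add: signed_def cochains_minus_apply)

lemma cochains_closed: "\<lbrakk>f \<in> carrier (cochains R M n); xs \<in> tuples M n\<rbrakk> \<Longrightarrow> f xs \<in> carrier M"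
  by (simp add: cochains_def multilinear_closed)

lemma cochains_diff_apply:
  assumes "f \<in> carrier (cochains R M n)" "g \<in> carrier (cochains R M n)" "xs \<in> tuples M n"
  shows "(f \<ominus>\<^bsub>cochains R M n\<^esub> g) xs = f xs \<ominus>\<^bsub>M\<^esub> g xs"
  using assms by (simp add: a_minus_def cochains_add_apply cochains_minus_apply)

lemma cochains_eqI:
  "\<lbrakk>f \<in> carrier (cochains R M n); g \<in> carrier (cochains R M n);
    \<And>xs. xs \<in> tuples M n \<Longrightarrow> f xs = g xs\<rbrakk> \<Longrightarrow> f = g"
  using multilinear_eqI by (simp add: cochains_def)

end

subsection \<open>The Gerstenhaber composition\<close>

text \<open>Applying \<open>f\<close> to \<open>insert_at i n g xs\<close> gives the unsigned
  summand number \<open>i\<close> of the composition of \<open>f\<close> and \<open>g\<close>. The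
  entries \<open>i, ..., i + n - 1\<close> form the block consumed by \<open>g\<close>.\<close>

definition insert_at :: "nat \<Rightarrow> nat \<Rightarrow> ('b list \<Rightarrow> 'b) \<Rightarrow> 'b list \<Rightarrow> 'b list" where
  "insert_at i n g xs = take i xs @ g (take n (drop i xs)) # drop (i + n) xs"

lemma insert_at_before: "length xs < i \<Longrightarrow>
    insert_at i n g (xs @ a # ys) =
    xs @ a # insert_at (i - length xs - 1) n g ys"
  by (auto simp: insert_at_def take_Cons' drop_Cons' algebra_simps Suc_diff_le)

lemma insert_at_inside: "\<lbrakk>i \<le> length xs; length xs < i + n\<rbrakk> \<Longrightarrow>
    insert_at i n g (xs @ a # ys) =
    take i xs @ g (drop i xs @ a # take (i + n - length xs - 1) ys) # drop (i + n - length xs - 1) ys"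
  by (auto simp: insert_at_def take_Cons' drop_Cons' algebra_simps)

lemma insert_at_after: "i + n \<le> length xs \<Longrightarrow>
    insert_at i n g (xs @ a # ys) = insert_at i n g xs @ a # ys"
  by (auto simp: insert_at_def)

text \<open>Cutting a list at the block boundaries turns arithmetic with \<open>take\<close> and
  \<open>drop\<close> into concatenation of pieces of known length.\<close>

lemma append_split4:
  assumes "a + b + c + d \<le> length xs"
  obtains p q r s t where "xs = p @ q @ r @ s @ t"
    "length p = a" "length q = b" "length r = c" "length s = d"
proof
  show "xs = take a xs @ take b (drop a xs) @ take c (drop b (drop a xs)) @
      take d (drop c (drop b (drop a xs))) @ drop d (drop c (drop b (drop a xs)))"
    by (simp only: append_take_drop_id)
qed (use assms in auto)

text \<open>The two blocks are disjoint. The block of \<open>h\<close> starts at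
  \<open>k + n - 1\<close> in \<open>xs\<close>, and at \<open>k\<close> once \<open>g\<close> has
  shrunk its \<open>n\<close> entries to one.\<close>

lemma insert_at_commute:
  assumes "i < k" "k + n + s \<le> length xs + 1"
  shows "insert_at i n g (insert_at (k + n - 1) s h xs) = insert_at k s h (insert_at i n g xs)"
proof -
  obtain p q r us vs where "xs = p @ q @ r @ us @ vs"
    "length p = i" "length q = n" "length r = k - i - 1" "length us = s"
    by (rule append_split4[of i n "k - i - 1" s xs]) (use assms in auto)
  then show ?thesis
    using assms by (auto simp: insert_at_def take_Cons' drop_Cons')
qed

text \<open>The value of \<open>h\<close> falls into the block of \<open>g\<close>. Together they
  consume \<open>n + s - 1\<close> entries, the arity of the composition of \<open>g\<close> and
  \<open>h\<close>.\<close>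

lemma insert_at_nested:
  assumes "i + n + s \<le> length xs + 1" "l < n"
  shows "insert_at i n g (insert_at (i + l) s h xs) =
    take i xs @ g (insert_at l s h (take (n + s - 1) (drop i xs))) # drop (i + (n + s - 1)) xs"
proof -
  obtain p q us r vs where "xs = p @ q @ us @ r @ vs"
    "length p = i" "length q = l" "length us = s" "length r = n - l - 1"
    by (rule append_split4[of i l s "n - l - 1" xs]) (use assms in auto)
  then show ?thesis
    using assms by (auto simp: insert_at_def take_Cons' drop_Cons')
qed

lemma insert_at_tuples:
  assumes "xs \<in> tuples B (int m + int n - 1)" "i < m"
    and "\<And>ys. ys \<in> tuples B (int n) \<Longrightarrow> g ys \<in> carrier B"
  shows "insert_at i n g xs \<in> tuples B (int m)"
proof -
  have "take n (drop i xs) \<in> tuples B (int n)"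
    using assms(1,2) by (auto simp: tuples_def dest!: in_set_takeD in_set_dropD)
  from assms(3)[OF this] show ?thesis
    using assms(1,2) by (auto simp: tuples_def insert_at_def dest!: in_set_takeD in_set_dropD)
qed

lemma gerst_circ_apply:
  "xs \<in> tuples B (int m + int n - 1) \<Longrightarrow> gerst_circ B (int m) (int n) f g xs =
    (\<Oplus>\<^bsub>B\<^esub> i \<in> {..<m}. signed B (int i * (int n - 1)) (f (insert_at i n g xs)))"
  by (simp add: gerst_circ_def insert_at_def)

lemma gerst_circ_neg:
  "m < 0 \<or> n < 0 \<Longrightarrow> gerst_circ B m n f g = \<zero>\<^bsub>cochains K B (m + n - 1)\<^esub>"
  by (auto simp: gerst_circ_def cochains_def)

context module
begin

lemma finsum_swap:
  assumes "finite A" "finite B" "\<And>i j. \<lbrakk>i \<in> A; j \<in> B\<rbrakk> \<Longrightarrow> f i j \<in> carrier M"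
  shows "(\<Oplus>\<^bsub>M\<^esub>i\<in>A. \<Oplus>\<^bsub>M\<^esub>j\<in>B. f i j) = (\<Oplus>\<^bsub>M\<^esub>j\<in>B. \<Oplus>\<^bsub>M\<^esub>i\<in>A. f i j)"
  using assms(1,3)
proof (induction A rule: finite_induct)
  case (insert x F)
  have "(\<Oplus>\<^bsub>M\<^esub>j\<in>B. \<Oplus>\<^bsub>M\<^esub>i\<in>insert x F. f i j) = (\<Oplus>\<^bsub>M\<^esub>j\<in>B. f x j \<oplus>\<^bsub>M\<^esub> (\<Oplus>\<^bsub>M\<^esub>i\<in>F. f i j))"
    using insert by (intro M.finsum_cong') (auto simp: Pi_def intro!: M.finsum_insert M.finsum_closed)
  also have "\<dots> = (\<Oplus>\<^bsub>M\<^esub>j\<in>B. f x j) \<oplus>\<^bsub>M\<^esub> (\<Oplus>\<^bsub>M\<^esub>j\<in>B. \<Oplus>\<^bsub>M\<^esub>i\<in>F. f i j)"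
    using insert by (intro M.finsum_addf) auto
  finally show ?case
    using insert by (subst M.finsum_insert) auto
qed simp

lemma finsum_triangle:
  fixes m :: nat
  assumes "\<And>i k. \<lbrakk>i < k; k < m\<rbrakk> \<Longrightarrow> f i k \<in> carrier M"
  shows "(\<Oplus>\<^bsub>M\<^esub>i\<in>{..<m}. \<Oplus>\<^bsub>M\<^esub>k\<in>{i<..<m}. f i k) = (\<Oplus>\<^bsub>M\<^esub>k\<in>{..<m}. \<Oplus>\<^bsub>M\<^esub>i\<in>{..<k}. f i k)"
  using assms
proof (induction m)
  case (Suc m)
  have e: "{i<..<Suc m} = insert m {i<..<m}" if "i < m" for i
    using that by auto
  have [simp]: "{m<..<Suc m} = {}"
    by auto
  have "(\<Oplus>\<^bsub>M\<^esub>i\<in>{..<Suc m}. \<Oplus>\<^bsub>M\<^esub>k\<in>{i<..<Suc m}. f i k) =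
      (\<Oplus>\<^bsub>M\<^esub>i\<in>{..<m}. \<Oplus>\<^bsub>M\<^esub>k\<in>{i<..<Suc m}. f i k)"
    using Suc.prems unfolding lessThan_Suc by (subst M.finsum_insert) (auto intro!: M.finsum_closed)
  also have "\<dots> = (\<Oplus>\<^bsub>M\<^esub>i\<in>{..<m}. f i m \<oplus>\<^bsub>M\<^esub> (\<Oplus>\<^bsub>M\<^esub>k\<in>{i<..<m}. f i k))"
    using Suc.prems
    by (intro M.finsum_cong') (auto simp: e intro!: M.finsum_insert M.finsum_closed M.a_closed)
  also have "\<dots> = (\<Oplus>\<^bsub>M\<^esub>i\<in>{..<m}. f i m) \<oplus>\<^bsub>M\<^esub> (\<Oplus>\<^bsub>M\<^esub>i\<in>{..<m}. \<Oplus>\<^bsub>M\<^esub>k\<in>{i<..<m}. f i k)"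
    using Suc.prems by (intro M.finsum_addf) auto
  also have "\<dots> = (\<Oplus>\<^bsub>M\<^esub>k\<in>{..<Suc m}. \<Oplus>\<^bsub>M\<^esub>i\<in>{..<k}. f i k)"
    using Suc.prems unfolding lessThan_Suc
    by (subst M.finsum_insert) (auto intro!: M.finsum_closed simp: Suc.IH)
  finally show ?case .
qed simp

text \<open>A slot outside the block of \<open>g\<close> is a slot of \<open>f\<close>. A slot
  inside it is a slot of \<open>g\<close>, followed by the slot of \<open>f\<close> that receives
  the value of \<open>g\<close>.\<close>

lemma insert_at_linear_op:
  assumes f: "f \<in> multilinear_maps R M (int m)" and g: "g \<in> multilinear_maps R M (int n)"
    and i: "i < m" and "set xs \<subseteq> carrier M" "set ys \<subseteq> carrier M"
    and len: "length xs + length ys + 2 = m + n"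
  shows "linear_op (\<lambda>a. f (insert_at i n g (xs @ a # ys)))"
proof -
  have sets: "set (take k xs) \<subseteq> carrier M" "set (drop k xs) \<subseteq> carrier M"
    "set (take k ys) \<subseteq> carrier M" "set (drop k ys) \<subseteq> carrier M" for k
    using assms(4,5) by (auto dest!: in_set_takeD in_set_dropD)
  have ins: "set (insert_at k n g zs) \<subseteq> carrier M" "length (insert_at k n g zs) = length zs + 1 - n"
    if "set zs \<subseteq> carrier M" "k + n \<le> length zs" for zs k
  proof -
    have "take n (drop k zs) \<in> tuples M (int n)"
      using that by (auto simp: tuples_def dest!: in_set_takeD in_set_dropD)
    then have "g (take n (drop k zs)) \<in> carrier M"
      using g by (rule multilinear_closed[rotated])
    then show "set (insert_at k n g zs) \<subseteq> carrier M"
      "length (insert_at k n g zs) = length zs + 1 - n"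
      using that by (auto simp: insert_at_def dest!: in_set_takeD in_set_dropD)
  qed
  consider "length xs < i" | "i \<le> length xs" "length xs < i + n" | "i + n \<le> length xs"
    by linarith
  then show ?thesis
  proof cases
    case 1
    have "linear_op (\<lambda>a. f (xs @ a # insert_at (i - length xs - 1) n g ys))"
      using assms 1 ins[of ys "i - length xs - 1"] by (intro multilinear_linear_op[OF f]) auto
    then show ?thesis
      by (simp only: insert_at_before[OF 1])
  next
    case 2
    let ?k = "i + n - length xs - 1"
    have "linear_op (\<lambda>a. f (take i xs @ a # drop ?k ys))"
      using 2 i len by (intro multilinear_linear_op[OF f sets(1) sets(4)]) auto
    moreover have "linear_op (\<lambda>a. g (drop i xs @ a # take ?k ys))"
      using 2 i len by (intro multilinear_linear_op[OF g sets(2) sets(3)]) auto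
    ultimately have "linear_op (\<lambda>a. f (take i xs @ g (drop i xs @ a # take ?k ys) # drop ?k ys))"
      by (rule linear_op_comp)
    then show ?thesis
      by (simp only: insert_at_inside[OF 2])
  next
    case 3
    have "linear_op (\<lambda>a. f (insert_at i n g xs @ a # ys))"
      using assms 3 ins[of xs i] by (intro multilinear_linear_op[OF f]) auto
    then show ?thesis
      by (simp only: insert_at_after[OF 3])
  qed
qed

text \<open>Splits off the degenerate arities, where the composition is zero by definition; the list
  combinatorics then runs over natural numbers.\<close>

lemma nat_arities:
  obtains "m < 0 \<or> n < (0::int)" | m' n' where "m = int m'" "n = int n'"
  by (metis linorder_not_less nat_0_le)

lemma gerst_circ_closed:
  assumes f: "f \<in> carrier (cochains R M m)" and g: "g \<in> carrier (cochains R M n)"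
  shows "gerst_circ M m n f g \<in> carrier (cochains R M (m + n - 1))"
proof (cases m n rule: nat_arities)
  case 1
  interpret C: module R "cochains R M (m + n - 1)" by (rule cochains_module)
  show ?thesis
    using 1 by (simp add: gerst_circ_neg[of m n M f g R])
next
  case (2 m' n')
  have f': "f \<in> multilinear_maps R M (int m')" and g': "g \<in> multilinear_maps R M (int n')"
    using f g 2 by (simp_all add: cochains_def)
  have cl: "f (insert_at i n' g xs) \<in> carrier M"
    if "xs \<in> tuples M (int m' + int n' - 1)" "i < m'" for xs i
    using multilinear_closed[OF f'] multilinear_closed[OF g'] that by (blast intro: insert_at_tuples)
  have "(\<lambda>xs \<in> tuples M (int m' + int n' - 1). \<Oplus>\<^bsub>M\<^esub>i\<in>{..<m'}.
      signed M (int i * (int n' - 1)) (f (insert_at i n' g xs))) \<in>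
      multilinear_maps R M (int m' + int n' - 1)"
    by (rule restrict_multilinear)
      (auto intro!: linear_op_sum linear_op_sgn insert_at_linear_op[OF f' g'] M.finsum_closed cl)
  also have "(\<lambda>xs \<in> tuples M (int m' + int n' - 1). \<Oplus>\<^bsub>M\<^esub>i\<in>{..<m'}.
      signed M (int i * (int n' - 1)) (f (insert_at i n' g xs))) = gerst_circ M m n f g"
    by (simp add: gerst_circ_def insert_at_def 2)
  finally show ?thesis
    by (simp add: cochains_def 2)
qed

lemma insert_at_cochain:
  assumes "g \<in> carrier (cochains R M (int n))" "xs \<in> tuples M (int m + int n - 1)" "i < m"
  shows "insert_at i n g xs \<in> tuples M (int m)"
  by (rule insert_at_tuples[OF assms(2,3)]) (rule cochains_closed[OF assms(1)])

lemma insert_at_value: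
  assumes "f \<in> carrier (cochains R M (int m))" "g \<in> carrier (cochains R M (int n))"
    "xs \<in> tuples M (int m + int n - 1)" "i < m"
  shows "f (insert_at i n g xs) \<in> carrier M"
  using assms by (blast intro: cochains_closed insert_at_cochain)

lemma cochain_linear_op:
  "\<lbrakk>f \<in> carrier (cochains R M n); set xs \<subseteq> carrier M; set ys \<subseteq> carrier M;
    int (length xs + length ys) + 1 = n\<rbrakk> \<Longrightarrow> linear_op (\<lambda>a. f (xs @ a # ys))"
  by (rule multilinear_linear_op) (simp_all add: cochains_def)

lemma insert_at_slot_linear_op:
  assumes "f \<in> carrier (cochains R M (int m))" "xs \<in> tuples M (int m + int n - 1)" "i < m"
  shows "linear_op (\<lambda>a. f (take i xs @ a # drop (i + n) xs))"
  by (rule cochain_linear_op[OF assms(1)])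
    (use assms(2,3) in \<open>auto simp: tuples_def dest!: in_set_takeD in_set_dropD\<close>)

lemma block_tuples:
  "\<lbrakk>xs \<in> tuples M (int m + int n - 1); i < m\<rbrakk> \<Longrightarrow> take n (drop i xs) \<in> tuples M (int n)"
  by (auto simp: tuples_def dest!: in_set_takeD in_set_dropD)

section \<open>Bilinearity of the composition\<close>

lemma gerst_circ_add_left:
  assumes f: "f \<in> carrier (cochains R M m)" "f' \<in> carrier (cochains R M m)"
    and g: "g \<in> carrier (cochains R M n)"
  shows "gerst_circ M m n (f \<oplus>\<^bsub>cochains R M m\<^esub> f') g =
    gerst_circ M m n f g \<oplus>\<^bsub>cochains R M (m + n - 1)\<^esub> gerst_circ M m n f' g"
proof -
  interpret C: module R "cochains R M m" by (rule cochains_module)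
  interpret T: module R "cochains R M (m + n - 1)" by (rule cochains_module)
  show ?thesis
  proof (cases m n rule: nat_arities)
    case 1
    then show ?thesis by (simp add: gerst_circ_neg[of m n M _ _ R])
  next
    case (2 m' n')
    show ?thesis
    proof (rule cochains_eqI)
      fix xs assume xs: "xs \<in> tuples M (m + n - 1)"
      note v = insert_at_value[OF f(1)[unfolded 2] g[unfolded 2] xs[unfolded 2]]
        insert_at_value[OF f(2)[unfolded 2] g[unfolded 2] xs[unfolded 2]]
        insert_at_cochain[OF g[unfolded 2] xs[unfolded 2]]
      show "gerst_circ M m n (f \<oplus>\<^bsub>cochains R M m\<^esub> f') g xs =
          (gerst_circ M m n f g \<oplus>\<^bsub>cochains R M (m + n - 1)\<^esub> gerst_circ M m n f' g) xs"
        using v unfolding 2 cochains_add_apply[OF xs[unfolded 2]] gerst_circ_apply[OF xs[unfolded 2]]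
        by (subst M.finsum_addf[symmetric])
          (auto simp: cochains_add_apply signed_add simp del: M.finsum_addf intro!: M.finsum_cong')
    qed (intro T.a_closed gerst_circ_closed C.a_closed f g)+
  qed
qed

lemma gerst_circ_smult_left:
  assumes f: "r \<in> carrier R" "f \<in> carrier (cochains R M m)" and g: "g \<in> carrier (cochains R M n)"
  shows "gerst_circ M m n (r \<odot>\<^bsub>cochains R M m\<^esub> f) g =
    r \<odot>\<^bsub>cochains R M (m + n - 1)\<^esub> gerst_circ M m n f g"
proof -
  interpret C: module R "cochains R M m" by (rule cochains_module)
  interpret T: module R "cochains R M (m + n - 1)" by (rule cochains_module)
  show ?thesis
  proof (cases m n rule: nat_arities)
    case 1
    then show ?thesis by (simp add: gerst_circ_neg[of m n M _ _ R] f)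
  next
    case (2 m' n')
    show ?thesis
    proof (rule cochains_eqI)
      fix xs assume xs: "xs \<in> tuples M (m + n - 1)"
      note v = insert_at_value[OF f(2)[unfolded 2] g[unfolded 2] xs[unfolded 2]]
        insert_at_cochain[OF g[unfolded 2] xs[unfolded 2]]
      show "gerst_circ M m n (r \<odot>\<^bsub>cochains R M m\<^esub> f) g xs =
          (r \<odot>\<^bsub>cochains R M (m + n - 1)\<^esub> gerst_circ M m n f g) xs"
        using v f unfolding 2 cochains_smult_apply[OF xs[unfolded 2]] gerst_circ_apply[OF xs[unfolded 2]]
        by (subst finsum_smult_ldistr)
          (auto simp: cochains_smult_apply smult_signed intro!: M.finsum_cong')
    qed (intro T.smult_closed gerst_circ_closed C.smult_closed f g)+
  qed
qed

text \<open>Unlike additivity in \<open>f\<close>, which is pointwise, this uses that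
  \<open>f\<close> is linear in the slot receiving the value of \<open>g\<close>.\<close>

lemma gerst_circ_add_right:
  assumes f: "f \<in> carrier (cochains R M m)"
    and g: "g \<in> carrier (cochains R M n)" "g' \<in> carrier (cochains R M n)"
  shows "gerst_circ M m n f (g \<oplus>\<^bsub>cochains R M n\<^esub> g') =
    gerst_circ M m n f g \<oplus>\<^bsub>cochains R M (m + n - 1)\<^esub> gerst_circ M m n f g'"
proof -
  interpret C: module R "cochains R M n" by (rule cochains_module)
  interpret T: module R "cochains R M (m + n - 1)" by (rule cochains_module)
  show ?thesis
  proof (cases m n rule: nat_arities)
    case 1
    then show ?thesis by (simp add: gerst_circ_neg[of m n M _ _ R])
  next
    case (2 m' n')
    show ?thesis
    proof (rule cochains_eqI)
      fix xs assume xs: "xs \<in> tuples M (m + n - 1)"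
      note v = insert_at_value[OF f[unfolded 2] g(1)[unfolded 2] xs[unfolded 2]]
        insert_at_value[OF f[unfolded 2] g(2)[unfolded 2] xs[unfolded 2]]
      have "f (insert_at i n' (g \<oplus>\<^bsub>cochains R M (int n')\<^esub> g') xs) =
          f (insert_at i n' g xs) \<oplus>\<^bsub>M\<^esub> f (insert_at i n' g' xs)" if "i < m'" for i
        using insert_at_slot_linear_op[OF f[unfolded 2] xs[unfolded 2] that] g[unfolded 2]
          block_tuples[OF xs[unfolded 2] that]
        by (simp add: insert_at_def cochains_add_apply linear_op_def cochains_closed)
      then show "gerst_circ M m n f (g \<oplus>\<^bsub>cochains R M n\<^esub> g') xs =
          (gerst_circ M m n f g \<oplus>\<^bsub>cochains R M (m + n - 1)\<^esub> gerst_circ M m n f g') xs"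
        using v unfolding 2 cochains_add_apply[OF xs[unfolded 2]] gerst_circ_apply[OF xs[unfolded 2]]
        by (subst M.finsum_addf[symmetric])
          (auto simp: signed_add simp del: M.finsum_addf intro!: M.finsum_cong')
    qed (intro T.a_closed gerst_circ_closed C.a_closed f g)+
  qed
qed

lemma gerst_circ_smult_right:
  assumes f: "r \<in> carrier R" "f \<in> carrier (cochains R M m)" and g: "g \<in> carrier (cochains R M n)"
  shows "gerst_circ M m n f (r \<odot>\<^bsub>cochains R M n\<^esub> g) =
    r \<odot>\<^bsub>cochains R M (m + n - 1)\<^esub> gerst_circ M m n f g"
proof -
  interpret C: module R "cochains R M n" by (rule cochains_module)
  interpret T: module R "cochains R M (m + n - 1)" by (rule cochains_module)
  show ?thesis
  proof (cases m n rule: nat_arities)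
    case 1
    then show ?thesis by (simp add: gerst_circ_neg[of m n M _ _ R] f)
  next
    case (2 m' n')
    show ?thesis
    proof (rule cochains_eqI)
      fix xs assume xs: "xs \<in> tuples M (m + n - 1)"
      note v = insert_at_value[OF f(2)[unfolded 2] g[unfolded 2] xs[unfolded 2]]
      have "f (insert_at i n' (r \<odot>\<^bsub>cochains R M (int n')\<^esub> g) xs) =
          r \<odot>\<^bsub>M\<^esub> f (insert_at i n' g xs)" if "i < m'" for i
        using insert_at_slot_linear_op[OF f(2)[unfolded 2] xs[unfolded 2] that] g[unfolded 2] f(1)
          block_tuples[OF xs[unfolded 2] that]
        by (simp add: insert_at_def cochains_smult_apply linear_op_def cochains_closed)
      then show "gerst_circ M m n f (r \<odot>\<^bsub>cochains R M n\<^esub> g) xs =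
          (r \<odot>\<^bsub>cochains R M (m + n - 1)\<^esub> gerst_circ M m n f g) xs"
        using v f unfolding 2 cochains_smult_apply[OF xs[unfolded 2]] gerst_circ_apply[OF xs[unfolded 2]]
        by (subst finsum_smult_ldistr)
          (auto simp: smult_signed intro!: M.finsum_cong')
    qed (intro T.smult_closed gerst_circ_closed C.smult_closed f g)+
  qed
qed

lemma gerst_circ_zero_left:
  assumes "g \<in> carrier (cochains R M n)"
  shows "gerst_circ M m n \<zero>\<^bsub>cochains R M m\<^esub> g = \<zero>\<^bsub>cochains R M (m + n - 1)\<^esub>"
proof -
  interpret C: module R "cochains R M m" by (rule cochains_module)
  interpret T: module R "cochains R M (m + n - 1)" by (rule cochains_module)
  show ?thesis
    using gerst_circ_smult_left[OF R.zero_closed C.zero_closed assms]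
      gerst_circ_closed[OF C.zero_closed assms] by simp
qed

lemma gerst_circ_zero_right:
  assumes "f \<in> carrier (cochains R M m)"
  shows "gerst_circ M m n f \<zero>\<^bsub>cochains R M n\<^esub> = \<zero>\<^bsub>cochains R M (m + n - 1)\<^esub>"
proof -
  interpret C: module R "cochains R M n" by (rule cochains_module)
  interpret T: module R "cochains R M (m + n - 1)" by (rule cochains_module)
  show ?thesis
    using gerst_circ_smult_right[OF R.zero_closed assms C.zero_closed]
      gerst_circ_closed[OF assms C.zero_closed] by simp
qed

text \<open>The part of \<open>(f \<circ> g) \<circ> h\<close> in which \<open>g\<close> and \<open>h\<close> fill distinct slots of \<open>f\<close>, with \<open>h\<close> to the
  left of \<open>g\<close>.\<close>

definition gerst_left_sum ::
    "nat \<Rightarrow> nat \<Rightarrow> nat \<Rightarrow> ('c list \<Rightarrow> 'c) \<Rightarrow> ('c list \<Rightarrow> 'c) \<Rightarrow> ('c list \<Rightarrow> 'c) \<Rightarrow> 'c list \<Rightarrow> 'c" where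
  "gerst_left_sum m n s f g h xs = (\<Oplus>\<^bsub>M\<^esub>i\<in>{..<m}. \<Oplus>\<^bsub>M\<^esub>j\<in>{..<i}.
     signed M (int j * (int s - 1) + int i * (int n - 1)) (f (insert_at i n g (insert_at j s h xs))))"

text \<open>In \<open>(f \<circ> g) \<circ> h\<close>, with \<open>g\<close> at position \<open>i\<close> of \<open>f\<close>, the position \<open>j\<close> of \<open>h\<close> lies left of \<open>g\<close>,
  inside \<open>g\<close> (which gives \<open>f \<circ> (g \<circ> h)\<close>), or right of \<open>g\<close>.\<close>

lemma gerst_circ_assoc:
  assumes f: "f \<in> carrier (cochains R M (int m))" and g: "g \<in> carrier (cochains R M (int n))"
    and h: "h \<in> carrier (cochains R M (int s))" and xs: "xs \<in> tuples M (int m + int n + int s - 2)"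
  shows "gerst_circ M (int m + int n - 1) (int s) (gerst_circ M (int m) (int n) f g) h xs =
    gerst_circ M (int m) (int n + int s - 1) f (gerst_circ M (int n) (int s) g h) xs \<oplus>\<^bsub>M\<^esub>
    (gerst_left_sum m n s f g h xs \<oplus>\<^bsub>M\<^esub>
     signed M ((int n - 1) * (int s - 1)) (gerst_left_sum m s n f h g xs))"
proof -
  have len: "length xs + 2 = m + n + s"
    using xs by (auto simp: tuples_def)
  \<comment> \<open>The summand with \<open>g\<close> at position \<open>i\<close> of
    \<open>f\<close> and \<open>h\<close> at position \<open>j\<close> of the arguments of the
    composite of \<open>f\<close> and \<open>g\<close>. Every double sum in the claim is a sum of
    these over a suitable range of \<open>j\<close>.\<close>
  define E where "E i j = signed M (int j * (int s - 1) + int i * (int n - 1))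
    (f (insert_at i n g (insert_at j s h xs)))" for i j
  have ins: "insert_at j s h xs \<in> tuples M (int m + int n - 1)" if "j + 1 < m + n" for j
  proof -
    have eq: "int (m + n - 1) + int s - 1 = int m + int n + int s - 2"
      using that by auto
    have "xs \<in> tuples M (int (m + n - 1) + int s - 1)"
      unfolding eq by (rule xs)
    then have "insert_at j s h xs \<in> tuples M (int (m + n - 1))"
      by (rule insert_at_cochain[OF h]) (use that in linarith)
    moreover have "int (m + n - 1) = int m + int n - 1"
      using that by linarith
    ultimately show ?thesis by simp
  qed
  have E [simp]: "E i j \<in> carrier M" if "i < m" "j + 1 < m + n" for i j
    unfolding E_def using insert_at_value[OF f g ins[OF that(2)] that(1)] by simp

  have circ_circ: "gerst_circ M (int m + int n - 1) (int s) (gerst_circ M (int m) (int n) f g) h xs =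
      (\<Oplus>\<^bsub>M\<^esub>i\<in>{..<m}. \<Oplus>\<^bsub>M\<^esub>j\<in>{..<m + n - 1}. E i j)"
  \<comment> \<open>If \<open>m + n = 0\<close>, the composite of \<open>f\<close> and
    \<open>g\<close> has arity -1, while \<open>m + n - 1\<close> is 0 over the naturals. The left
    side is then zero by definition and the right side is an empty sum, as
    \<open>m = 0\<close>.\<close>
  proof (cases "m + n = 0")
    case True
    then show ?thesis
      using xs by (simp add: gerst_circ_def tuples_def)
  next
    case False
    then have mn: "int m + int n - 1 = int (m + n - 1)"
      by linarith
    have eq: "int (m + n - 1) + int s - 1 = int m + int n + int s - 2"
      using False by linarith
    have xs': "xs \<in> tuples M (int (m + n - 1) + int s - 1)"
      unfolding eq by (rule xs)
    have "gerst_circ M (int m + int n - 1) (int s) (gerst_circ M (int m) (int n) f g) h xs =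
        (\<Oplus>\<^bsub>M\<^esub>j\<in>{..<m + n - 1}. signed M (int j * (int s - 1))
          (gerst_circ M (int m) (int n) f g (insert_at j s h xs)))"
      unfolding mn by (rule gerst_circ_apply[OF xs'])
    also have "\<dots> = (\<Oplus>\<^bsub>M\<^esub>j\<in>{..<m + n - 1}. \<Oplus>\<^bsub>M\<^esub>i\<in>{..<m}. E i j)"
    proof (rule M.finsum_cong')
      fix j assume "j \<in> {..<m + n - 1}"
      then have j: "j + 1 < m + n" by auto
      have v: "i < m \<Longrightarrow> f (insert_at i n g (insert_at j s h xs)) \<in> carrier M" for i
        by (rule insert_at_value[OF f g ins[OF j]])
      then show "signed M (int j * (int s - 1)) (gerst_circ M (int m) (int n) f g (insert_at j s h xs)) =
          (\<Oplus>\<^bsub>M\<^esub>i\<in>{..<m}. E i j)"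
        unfolding gerst_circ_apply[OF ins[OF j]]
        by (subst signed_finsum) (auto simp: signed_signed E_def intro!: M.finsum_cong')
    qed (auto intro!: M.finsum_closed)
    also have "\<dots> = (\<Oplus>\<^bsub>M\<^esub>i\<in>{..<m}. \<Oplus>\<^bsub>M\<^esub>j\<in>{..<m + n - 1}. E i j)"
      by (rule finsum_swap) auto
    finally show ?thesis .
  qed

  have circ_nested: "gerst_circ M (int m) (int n + int s - 1) f (gerst_circ M (int n) (int s) g h) xs =
      (\<Oplus>\<^bsub>M\<^esub>i\<in>{..<m}. \<Oplus>\<^bsub>M\<^esub>j\<in>{i..<i + n}. E i j)"
  \<comment> \<open>Here the composite of \<open>g\<close> and \<open>h\<close> has arity -1, so the
    left side is zero by definition; on the right all inner ranges are empty, as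
    \<open>n = 0\<close>.\<close>
  proof (cases "n + s = 0")
    case True
    then show ?thesis
      using xs by (simp add: gerst_circ_def)
  next
    case False
    then have ns: "int n + int s - 1 = int (n + s - 1)"
      by linarith
    have eq: "int m + int (n + s - 1) - 1 = int m + int n + int s - 2"
      using False by linarith
    have xs': "xs \<in> tuples M (int m + int (n + s - 1) - 1)"
      unfolding eq by (rule xs)
    have "gerst_circ M (int m) (int n + int s - 1) f (gerst_circ M (int n) (int s) g h) xs =
        (\<Oplus>\<^bsub>M\<^esub>i\<in>{..<m}. signed M (int i * (int (n + s - 1) - 1))
          (f (insert_at i (n + s - 1) (gerst_circ M (int n) (int s) g h) xs)))"
      unfolding ns by (rule gerst_circ_apply[OF xs'])
    also have "\<dots> = (\<Oplus>\<^bsub>M\<^esub>i\<in>{..<m}. \<Oplus>\<^bsub>M\<^esub>j\<in>{i..<i + n}. E i j)"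
    proof (rule M.finsum_cong')
      fix i assume "i \<in> {..<m}"
      then have i: "i < m" by simp
      define ys where "ys = take (n + s - 1) (drop i xs)"
      have ys: "ys \<in> tuples M (int n + int s - 1)"
        unfolding ys_def ns by (rule block_tuples[OF xs' i])
      \<comment> \<open>The slot \<open>i\<close> of \<open>f\<close> with all other slots filled:
        its linearity carries \<open>f\<close> through the sum and the signs in the composite of
        \<open>g\<close> and \<open>h\<close>.\<close>
      define L where "L = (\<lambda>a. f (take i xs @ a # drop (i + (n + s - 1)) xs))"
      have lin: "linear_op L"
        unfolding L_def by (rule insert_at_slot_linear_op[OF f xs' i])
      have v: "l < n \<Longrightarrow> g (insert_at l s h ys) \<in> carrier M" for l
        by (rule insert_at_value[OF g h ys])
      have nest: "L (g (insert_at l s h ys)) = f (insert_at i n g (insert_at (i + l) s h xs))" if "l < n" for l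
        using insert_at_nested[of i n s xs l g h] that i len by (simp add: ys_def L_def)
      have "f (insert_at i (n + s - 1) (gerst_circ M (int n) (int s) g h) xs) =
          (\<Oplus>\<^bsub>M\<^esub>l\<in>{..<n}. signed M (int l * (int s - 1))
            (L (g (insert_at l s h ys))))"
        unfolding insert_at_def[of i "n + s - 1"] ys_def[symmetric] L_def[symmetric, THEN fun_cong]
          gerst_circ_apply[OF ys]
        using v linear_op_closed[OF lin v]
        by (subst linear_op_finsum[OF lin])
          (auto simp: linear_op_signed[OF lin] intro!: M.finsum_cong')
      \<comment> \<open>The exponents agree:
        \<open>i (n + s - 2) + l (s - 1) = (i + l) (s - 1) + i (n - 1)\<close>, which is the one in
        \<open>E i (i + l)\<close>.\<close>
      then have "signed M (int i * (int (n + s - 1) - 1))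
          (f (insert_at i (n + s - 1) (gerst_circ M (int n) (int s) g h) xs)) =
          (\<Oplus>\<^bsub>M\<^esub>l\<in>{..<n}. E i (i + l))"
        using linear_op_closed[OF lin v] i
        by (simp only:, subst signed_finsum)
          (auto simp: signed_signed E_def nest ns[symmetric] algebra_simps intro!: M.finsum_cong')
      also have "\<dots> = (\<Oplus>\<^bsub>M\<^esub>j\<in>(+) i ` {..<n}. E i j)"
        using i by (subst M.finsum_reindex) auto
      also have "(+) i ` {..<n} = {i..<i + n}"
        by (simp add: lessThan_atLeast0 add.commute)
      finally show "signed M (int i * (int (n + s - 1) - 1))
          (f (insert_at i (n + s - 1) (gerst_circ M (int n) (int s) g h) xs)) =
          (\<Oplus>\<^bsub>M\<^esub>j\<in>{i..<i + n}. E i j)" .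
    qed (auto intro!: M.finsum_closed)
    finally show ?thesis .
  qed

  have left: "(\<Oplus>\<^bsub>M\<^esub>i\<in>{..<m}. \<Oplus>\<^bsub>M\<^esub>j\<in>{..<i}. E i j) = gerst_left_sum m n s f g h xs"
    by (simp add: gerst_left_sum_def E_def)

  \<comment> \<open>Reindexing by \<open>j = k + n - 1\<close> makes \<open>k > i\<close> the
    position of \<open>h\<close> in \<open>f\<close>. The disjoint blocks can be filled in the other
    order, and the exponent \<open>(k + n - 1) (s - 1) + i (n - 1)\<close> exceeds that of the
    exchanged sum by \<open>(n - 1) (s - 1)\<close>.\<close>
  have right: "(\<Oplus>\<^bsub>M\<^esub>i\<in>{..<m}. \<Oplus>\<^bsub>M\<^esub>j\<in>{i + n..<m + n - 1}. E i j) =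
      signed M ((int n - 1) * (int s - 1)) (gerst_left_sum m s n f h g xs)"
  proof -
    define E' where "E' k i = signed M (int i * (int n - 1) + int k * (int s - 1))
      (f (insert_at k s h (insert_at i n g xs)))" for k i
    have E': "E i (k + n - 1) = signed M ((int n - 1) * (int s - 1)) (E' k i)"
      "E' k i \<in> carrier M" if "i < k" "k < m" for i k
    proof -
      have comm: "insert_at i n g (insert_at (k + n - 1) s h xs) = insert_at k s h (insert_at i n g xs)"
        using that len by (intro insert_at_commute) auto
      have v: "f (insert_at k s h (insert_at i n g xs)) \<in> carrier M"
        unfolding comm[symmetric] using that by (intro insert_at_value[OF f g] ins) auto
      then show "E' k i \<in> carrier M" by (simp add: E'_def)
      show "E i (k + n - 1) = signed M ((int n - 1) * (int s - 1)) (E' k i)"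
        unfolding E_def E'_def comm
        using v that by (simp add: signed_signed of_nat_diff algebra_simps)
    qed
    have "(\<Oplus>\<^bsub>M\<^esub>i\<in>{..<m}. \<Oplus>\<^bsub>M\<^esub>j\<in>{i + n..<m + n - 1}. E i j) =
        (\<Oplus>\<^bsub>M\<^esub>i\<in>{..<m}. \<Oplus>\<^bsub>M\<^esub>k\<in>{i<..<m}. E i (k + n - 1))"
    proof (rule M.finsum_cong')
      fix i assume i: "i \<in> {..<m}"
      have "{i + n..<m + n - 1} = (\<lambda>k. k + n - 1) ` {i<..<m}"
      proof safe
        fix j assume "j \<in> {i + n..<m + n - 1}"
        then show "j \<in> (\<lambda>k. k + n - 1) ` {i<..<m}"
          by (intro image_eqI[of _ _ "j + 1 - n"]) auto
      qed auto
      then show "(\<Oplus>\<^bsub>M\<^esub>j\<in>{i + n..<m + n - 1}. E i j) = (\<Oplus>\<^bsub>M\<^esub>k\<in>{i<..<m}. E i (k + n - 1))"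
        using i by (simp only:, intro M.finsum_reindex) (auto intro!: inj_onI E)
    qed (auto intro!: M.finsum_closed)
    \<comment> \<open>Exchanging the order of summation makes the position of \<open>h\<close> the
      outer index, as in \<open>gerst_left_sum\<close> with \<open>g\<close> and \<open>h\<close>
      interchanged.\<close>
    also have "\<dots> = (\<Oplus>\<^bsub>M\<^esub>k\<in>{..<m}. \<Oplus>\<^bsub>M\<^esub>i\<in>{..<k}. E i (k + n - 1))"
      by (intro finsum_triangle) auto
    also have "\<dots> = (\<Oplus>\<^bsub>M\<^esub>k\<in>{..<m}. \<Oplus>\<^bsub>M\<^esub>i\<in>{..<k}. signed M ((int n - 1) * (int s - 1)) (E' k i))"
      by (intro M.finsum_cong' refl) (auto simp: E'[simplified] intro!: M.finsum_cong' M.finsum_closed)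
    also have "\<dots> = (\<Oplus>\<^bsub>M\<^esub>k\<in>{..<m}. signed M ((int n - 1) * (int s - 1)) (\<Oplus>\<^bsub>M\<^esub>i\<in>{..<k}. E' k i))"
      by (intro M.finsum_cong' refl signed_finsum[symmetric]) (auto simp: E' intro!: M.finsum_closed)
    also have "\<dots> = signed M ((int n - 1) * (int s - 1)) (\<Oplus>\<^bsub>M\<^esub>k\<in>{..<m}. \<Oplus>\<^bsub>M\<^esub>i\<in>{..<k}. E' k i)"
      by (intro signed_finsum[symmetric]) (auto simp: E' intro!: M.finsum_closed)
    finally show ?thesis
      by (simp add: gerst_left_sum_def E'_def)
  qed

  have split: "(\<Oplus>\<^bsub>M\<^esub>j\<in>{..<m + n - 1}. E i j) = (\<Oplus>\<^bsub>M\<^esub>j\<in>{i..<i + n}. E i j) \<oplus>\<^bsub>M\<^esub>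
      ((\<Oplus>\<^bsub>M\<^esub>j\<in>{..<i}. E i j) \<oplus>\<^bsub>M\<^esub> (\<Oplus>\<^bsub>M\<^esub>j\<in>{i + n..<m + n - 1}. E i j))" if "i < m" for i
  proof -
    have e: "{..<m + n - 1} = {i..<i + n} \<union> ({..<i} \<union> {i + n..<m + n - 1})"
      using that by auto
    have "(\<Oplus>\<^bsub>M\<^esub>j\<in>{..<i} \<union> {i + n..<m + n - 1}. E i j) =
        (\<Oplus>\<^bsub>M\<^esub>j\<in>{..<i}. E i j) \<oplus>\<^bsub>M\<^esub> (\<Oplus>\<^bsub>M\<^esub>j\<in>{i + n..<m + n - 1}. E i j)"
      using that by (intro M.finsum_Un_disjoint) auto
    moreover have "(\<Oplus>\<^bsub>M\<^esub>j\<in>{i..<i + n} \<union> ({..<i} \<union> {i + n..<m + n - 1}). E i j) =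
        (\<Oplus>\<^bsub>M\<^esub>j\<in>{i..<i + n}. E i j) \<oplus>\<^bsub>M\<^esub> (\<Oplus>\<^bsub>M\<^esub>j\<in>{..<i} \<union> {i + n..<m + n - 1}. E i j)"
      using that by (intro M.finsum_Un_disjoint) auto
    ultimately show ?thesis
      by (simp only: e)
  qed
  have "(\<Oplus>\<^bsub>M\<^esub>i\<in>{..<m}. \<Oplus>\<^bsub>M\<^esub>j\<in>{..<m + n - 1}. E i j) =
      (\<Oplus>\<^bsub>M\<^esub>i\<in>{..<m}. (\<Oplus>\<^bsub>M\<^esub>j\<in>{i..<i + n}. E i j) \<oplus>\<^bsub>M\<^esub>
        ((\<Oplus>\<^bsub>M\<^esub>j\<in>{..<i}. E i j) \<oplus>\<^bsub>M\<^esub> (\<Oplus>\<^bsub>M\<^esub>j\<in>{i + n..<m + n - 1}. E i j)))"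
    by (intro M.finsum_cong' refl) (auto simp: split[simplified] intro!: M.finsum_closed M.a_closed)
  also have "\<dots> = (\<Oplus>\<^bsub>M\<^esub>i\<in>{..<m}. \<Oplus>\<^bsub>M\<^esub>j\<in>{i..<i + n}. E i j) \<oplus>\<^bsub>M\<^esub>
      ((\<Oplus>\<^bsub>M\<^esub>i\<in>{..<m}. \<Oplus>\<^bsub>M\<^esub>j\<in>{..<i}. E i j) \<oplus>\<^bsub>M\<^esub>
       (\<Oplus>\<^bsub>M\<^esub>i\<in>{..<m}. \<Oplus>\<^bsub>M\<^esub>j\<in>{i + n..<m + n - 1}. E i j))"
  proof -
    have "(\<Oplus>\<^bsub>M\<^esub>i\<in>{..<m}. (\<Oplus>\<^bsub>M\<^esub>j\<in>{..<i}. E i j) \<oplus>\<^bsub>M\<^esub> (\<Oplus>\<^bsub>M\<^esub>j\<in>{i + n..<m + n - 1}. E i j)) =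
        (\<Oplus>\<^bsub>M\<^esub>i\<in>{..<m}. \<Oplus>\<^bsub>M\<^esub>j\<in>{..<i}. E i j) \<oplus>\<^bsub>M\<^esub>
        (\<Oplus>\<^bsub>M\<^esub>i\<in>{..<m}. \<Oplus>\<^bsub>M\<^esub>j\<in>{i + n..<m + n - 1}. E i j)"
      by (intro M.finsum_addf) (auto intro!: M.finsum_closed)
    then show ?thesis
      by (subst M.finsum_addf) (auto intro!: M.finsum_closed M.a_closed)
  qed
  finally show ?thesis
    unfolding circ_circ circ_nested left right .
qed

lemma gerst_left_sum_closed:
  assumes f: "f \<in> carrier (cochains R M (int m))" and g: "g \<in> carrier (cochains R M (int n))"
    and h: "h \<in> carrier (cochains R M (int s))" and xs: "xs \<in> tuples M (int m + int n + int s - 2)"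
  shows "gerst_left_sum m n s f g h xs \<in> carrier M"
proof -
  have "f (insert_at i n g (insert_at j s h xs)) \<in> carrier M" if "j < i" "i < m" for i j
  proof -
    have eq: "int (m + n - 1) + int s - 1 = int m + int n + int s - 2"
      using that by linarith
    have mn: "int (m + n - 1) = int m + int n - 1"
      using that by linarith
    have "xs \<in> tuples M (int (m + n - 1) + int s - 1)"
      unfolding eq by (rule xs)
    then have "insert_at j s h xs \<in> tuples M (int (m + n - 1))"
      by (rule insert_at_cochain[OF h]) (use that in linarith)
    then show ?thesis
      unfolding mn by (rule insert_at_value[OF f g _ that(2)])
  qed
  then show ?thesis
    unfolding gerst_left_sum_def by (auto intro!: M.finsum_closed)
qed

text \<open>The nested part cancels in the associator. What remains is \<open>U\<close> plus the
  signed \<open>V\<close>, the contributions in which \<open>g\<close> and \<open>h\<close> fill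
  distinct slots of \<open>f\<close>; interchanging \<open>g\<close> and \<open>h\<close>
  interchanges \<open>U\<close> and \<open>V\<close>.\<close>

lemma gerst_circ_pre_lie:
  assumes f: "f \<in> carrier (cochains R M m)" and g: "g \<in> carrier (cochains R M n)"
    and h: "h \<in> carrier (cochains R M s)"
  shows "gerst_circ M (m + n - 1) s (gerst_circ M m n f g) h \<ominus>\<^bsub>cochains R M (m + n + s - 2)\<^esub>
      gerst_circ M m (n + s - 1) f (gerst_circ M n s g h) =
    signed (cochains R M (m + n + s - 2)) ((n - 1) * (s - 1))
     (gerst_circ M (m + s - 1) n (gerst_circ M m s f h) g \<ominus>\<^bsub>cochains R M (m + n + s - 2)\<^esub>
      gerst_circ M m (n + s - 1) f (gerst_circ M s n h g))"
proof -
  let ?C = "cochains R M (m + n + s - 2)"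
  interpret T: module R ?C by (rule cochains_module)
  have idx: "m + n - 1 + s - 1 = m + n + s - 2" "m + (s + n - 1) - 1 = m + n + s - 2" "m + (n + s - 1) - 1 = m + n + s - 2"
    "m + s - 1 + n - 1 = m + n + s - 2" "s + n - 1 = n + s - 1"
    by simp_all
  have cl: "gerst_circ M (m + n - 1) s (gerst_circ M m n f g) h \<in> carrier ?C"
    "gerst_circ M m (n + s - 1) f (gerst_circ M n s g h) \<in> carrier ?C"
    "gerst_circ M (m + s - 1) n (gerst_circ M m s f h) g \<in> carrier ?C"
    "gerst_circ M m (n + s - 1) f (gerst_circ M s n h g) \<in> carrier ?C"
    using gerst_circ_closed[OF gerst_circ_closed[OF f g] h]
      gerst_circ_closed[OF f gerst_circ_closed[OF g h]]
      gerst_circ_closed[OF gerst_circ_closed[OF f h] g]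
      gerst_circ_closed[OF f gerst_circ_closed[OF h g]]
    by (simp_all only: idx)
  show ?thesis
  proof (cases "m < 0 \<or> n < 0 \<or> s < 0")
    case True
    \<comment> \<open>With a negative arity either the outer composition is zero by definition or
      its inner composite or an argument leads to zero by bilinearity. Stated for arbitrary
      \<open>n, s, g, h\<close> to cover both orders of \<open>g\<close> and
      \<open>h\<close>.\<close>
    have *: "gerst_circ M (m + n - 1) s (gerst_circ M m n f g) h = \<zero>\<^bsub>cochains R M (m + n - 1 + s - 1)\<^esub>"
      "gerst_circ M m (n + s - 1) f (gerst_circ M n s g h) = \<zero>\<^bsub>cochains R M (m + (n + s - 1) - 1)\<^esub>"
      if "m < 0 \<or> n < 0 \<or> s < 0" "g \<in> carrier (cochains R M n)" "h \<in> carrier (cochains R M s)"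
      for n s g h
      using that f gerst_circ_neg[of m n M f g R] gerst_circ_neg[of n s M g h R]
        gerst_circ_neg[of m "n + s - 1" M f _ R] gerst_circ_neg[of "m + n - 1" s M _ h R]
        gerst_circ_zero_left[of h s "m + n - 1"] gerst_circ_zero_right[of f m "n + s - 1"]
      by metis+
    from True have True': "m < 0 \<or> s < 0 \<or> n < 0"
      by auto
    have "gerst_circ M (m + n - 1) s (gerst_circ M m n f g) h = \<zero>\<^bsub>?C\<^esub>"
      "gerst_circ M m (n + s - 1) f (gerst_circ M n s g h) = \<zero>\<^bsub>?C\<^esub>"
      "gerst_circ M (m + s - 1) n (gerst_circ M m s f h) g = \<zero>\<^bsub>?C\<^esub>"
      "gerst_circ M m (n + s - 1) f (gerst_circ M s n h g) = \<zero>\<^bsub>?C\<^esub>"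
      using *[OF True g h] *[OF True' h g] by (simp_all only: idx)
    then show ?thesis
      by (simp add: T.minus_eq T.r_neg)
  next
    case False
    then obtain m' n' s' where nat: "m = int m'" "n = int n'" "s = int s'"
      by (metis linorder_not_less nonneg_int_cases)
    show ?thesis
    proof (rule cochains_eqI)
      fix xs assume xs: "xs \<in> tuples M (m + n + s - 2)"
      define U where "U = gerst_left_sum m' n' s' f g h xs"
      define V where "V = gerst_left_sum m' s' n' f h g xs"
      have xs': "xs \<in> tuples M (m + s + n - 2)"
        using xs by (simp add: ac_simps)
      have UV: "U \<in> carrier M" "V \<in> carrier M"
        using gerst_left_sum_closed[OF f[unfolded nat] g[unfolded nat] h[unfolded nat] xs[unfolded nat]]
          gerst_left_sum_closed[OF f[unfolded nat] h[unfolded nat] g[unfolded nat] xs'[unfolded nat]]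
        by (simp_all only: U_def V_def)
      have a: "gerst_circ M (m + n - 1) s (gerst_circ M m n f g) h xs =
          gerst_circ M m (n + s - 1) f (gerst_circ M n s g h) xs \<oplus>\<^bsub>M\<^esub>
          (U \<oplus>\<^bsub>M\<^esub> signed M ((n - 1) * (s - 1)) V)"
        using gerst_circ_assoc[OF f[unfolded nat] g[unfolded nat] h[unfolded nat] xs[unfolded nat]]
        by (simp only: nat U_def V_def)
      have b: "gerst_circ M (m + s - 1) n (gerst_circ M m s f h) g xs =
          gerst_circ M m (n + s - 1) f (gerst_circ M s n h g) xs \<oplus>\<^bsub>M\<^esub>
          (V \<oplus>\<^bsub>M\<^esub> signed M ((n - 1) * (s - 1)) U)"
        using gerst_circ_assoc[OF f[unfolded nat] h[unfolded nat] g[unfolded nat] xs'[unfolded nat]]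
        by (simp only: nat U_def V_def add.commute[of "int s'" "int n'"]
            mult.commute[of "int s' - 1" "int n' - 1"])
      note v = cochains_closed[OF cl(1) xs] cochains_closed[OF cl(2) xs]
        cochains_closed[OF cl(3) xs] cochains_closed[OF cl(4) xs]
      have diff: "(x \<oplus>\<^bsub>M\<^esub> y) \<ominus>\<^bsub>M\<^esub> x = y" if "x \<in> carrier M" "y \<in> carrier M" for x y
        using that by (simp add: M.minus_eq M.a_comm[of x y] M.a_assoc M.r_neg)
      show "(gerst_circ M (m + n - 1) s (gerst_circ M m n f g) h \<ominus>\<^bsub>?C\<^esub>
            gerst_circ M m (n + s - 1) f (gerst_circ M n s g h)) xs =
          signed ?C ((n - 1) * (s - 1))
           (gerst_circ M (m + s - 1) n (gerst_circ M m s f h) g \<ominus>\<^bsub>?C\<^esub>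
            gerst_circ M m (n + s - 1) f (gerst_circ M s n h g)) xs"
        unfolding cochains_signed_apply[OF T.minus_closed[OF cl(3) cl(4)] xs]
          cochains_diff_apply[OF cl(1) cl(2) xs] cochains_diff_apply[OF cl(3) cl(4) xs] a b
        using UV v by (simp add: diff) (simp add: signed_def M.minus_add M.a_ac)
    qed (intro T.minus_closed T.signed_closed cl)+
  qed
qed

text \<open>The shift by one makes the composition, which has arity \<open>m + n - 1\<close>,
  additive in the degrees.\<close>

theorem gerst_circ_graded_pre_lie:
  "graded_pre_lie R (\<lambda>p. cochains R M (p + 1)) (\<lambda>p q. gerst_circ M (p + 1) (q + 1))"
proof (rule graded_pre_lie.intro, goal_cases)
  case (7 x p y q z s)
  have idx: "p + 1 + (q + 1) - 1 = p + q + 1" "p + 1 + (q + 1) + (s + 1) - 2 = p + q + s + 1"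
    "q + 1 + (s + 1) - 1 = q + s + 1" "p + 1 + (s + 1) - 1 = p + s + 1" "q + 1 - 1 = q" "s + 1 - 1 = s"
    by simp_all
  show ?case
    using gerst_circ_pre_lie[OF 7] by (simp only: idx)
qed (use gerst_circ_closed gerst_circ_add_left gerst_circ_add_right gerst_circ_smult_left
    gerst_circ_smult_right in \<open>fastforce simp: cochains_module algebra_simps\<close>)+

end

subsection \<open>The Hochschild complex of an associative algebra\<close>

lemma tuples_2: "xs \<in> tuples B 2 \<longleftrightarrow> (\<exists>a \<in> carrier B. \<exists>b \<in> carrier B. xs = [a, b])"
  by (auto simp: tuples_def numeral_2_eq_2 length_Suc_conv)

context assoc_algebra
begin

lemma mult_linear_op:
  assumes "a \<in> carrier A"
  shows "linear_op (\<lambda>b. a \<otimes>\<^bsub>A\<^esub> b)" "linear_op (\<lambda>b. b \<otimes>\<^bsub>A\<^esub> a)"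
  using assms by (simp_all add: linear_op_def A.r_distr A.l_distr smult_mult_left smult_mult_right)

lemma mult_cochain_closed: "mult_cochain A \<in> carrier (cochains K A 2)"
proof -
  have "mult_cochain A \<in> multilinear_maps K A 2"
    unfolding mult_cochain_def
  proof (rule restrict_multilinear)
    show "(\<lambda>xs. xs ! 0 \<otimes>\<^bsub>A\<^esub> xs ! 1) \<in> tuples A 2 \<rightarrow> carrier A"
      by (auto simp: tuples_2)
    fix xs ys assume *: "set xs \<subseteq> carrier A" "set ys \<subseteq> carrier A" "int (length xs + length ys) + 1 = 2"
    then consider b where "xs = []" "ys = [b]" | b where "xs = [b]" "ys = []"
      by (cases xs; cases ys) auto
    then show "linear_op (\<lambda>a. (xs @ a # ys) ! 0 \<otimes>\<^bsub>A\<^esub> (xs @ a # ys) ! 1)"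
      using * by cases (simp_all add: mult_linear_op)
  qed
  then show ?thesis by (simp add: cochains_def)
qed

text \<open>The two summands are \<open>(a b) c\<close> and \<open>- a (b c)\<close>, so this is
  associativity.\<close>

lemma mult_cochain_circ: "gerst_circ A 2 2 (mult_cochain A) (mult_cochain A) = \<zero>\<^bsub>cochains K A 3\<^esub>"
proof (rule cochains_eqI)
  interpret C: module K "cochains K A 3" by (rule cochains_module)
  show "\<zero>\<^bsub>cochains K A 3\<^esub> \<in> carrier (cochains K A 3)" by simp
  show "gerst_circ A 2 2 (mult_cochain A) (mult_cochain A) \<in> carrier (cochains K A 3)"
    using gerst_circ_closed[OF mult_cochain_closed mult_cochain_closed] by simp
  fix xs assume xs: "xs \<in> tuples A 3"
  then obtain a b c where abc: "xs = [a, b, c]" "a \<in> carrier A" "b \<in> carrier A" "c \<in> carrier A"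
    by (cases xs rule: list.exhaust; cases "tl xs" rule: list.exhaust; cases "tl (tl xs)" rule: list.exhaust)
      (auto simp: tuples_def)
  have "gerst_circ A (int 2) (int 2) (mult_cochain A) (mult_cochain A) xs =
      (\<Oplus>\<^bsub>A\<^esub> i \<in> {..<2}. signed A (int i * (int 2 - 1))
        (mult_cochain A (insert_at i 2 (mult_cochain A) xs)))"
    by (rule gerst_circ_apply) (use xs in simp)
  also have "{..<2::nat} = insert 1 {0}"
    by auto
  also have "(\<Oplus>\<^bsub>A\<^esub> i \<in> insert 1 {0}. signed A (int i * (int 2 - 1))
        (mult_cochain A (insert_at i 2 (mult_cochain A) xs))) = \<zero>\<^bsub>A\<^esub>"
    using abc by (subst M.finsum_insert)
      (auto simp: signed_def insert_at_def mult_cochain_def tuples_def A.m_assoc M.l_neg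
        numeral_2_eq_2 Pi_def)
  finally show "gerst_circ A 2 2 (mult_cochain A) (mult_cochain A) xs = \<zero>\<^bsub>cochains K A 3\<^esub> xs"
    using xs by (simp add: cochains_zero_apply)
qed

lemma hoch_dgla:
  assumes "contains_rationals K"
  shows "dgla K (hoch_dgla K A)"
proof -
  interpret P: graded_pre_lie K "\<lambda>p. cochains K A (p + 1)" "\<lambda>p q. gerst_circ A (p + 1) (q + 1)"
    by (rule gerst_circ_graded_pre_lie)
  have "dgla K \<lparr>gr = \<lambda>p. cochains K A (p + 1), brk = P.br, dif = P.bdif (mult_cochain A)\<rparr>"
  proof (rule P.dgla_br)
    fix p z assume "z \<in> carrier (cochains K A (p + 1))"
      "z \<oplus>\<^bsub>cochains K A (p + 1)\<^esub> z = \<zero>\<^bsub>cochains K A (p + 1)\<^esub>"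
    then show "z = \<zero>\<^bsub>cochains K A (p + 1)\<^esub>"
      using contains_rationals_double_eq_zero[OF cochains_module assms] by blast
  qed (simp_all add: mult_cochain_closed mult_cochain_circ)
  moreover have "P.br = gerst_bracket K A"
    by (intro ext) (simp add: P.br_def gerst_bracket_def)
  moreover have "P.bdif (mult_cochain A) = hoch_dif K A"
    by (intro ext)
      (simp only: P.bdif_def P.br_def gerst_bracket_def hoch_dif_def add.assoc one_add_one)
  ultimately show ?thesis
    by (simp add: hoch_dgla_def)
qed

lemma gerst_bracket_closed:
  assumes "f \<in> carrier (cochains K A (p + 1))" "g \<in> carrier (cochains K A (q + 1))"
  shows "gerst_bracket K A p q f g \<in> carrier (cochains K A (p + q + 1))"
proof -
  have idx: "p + 1 + (q + 1) - 1 = p + q + 1" "q + 1 + (p + 1) - 1 = p + q + 1"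
    by simp_all
  interpret C: module K "cochains K A (p + q + 1)" by (rule cochains_module)
  show ?thesis
    using gerst_circ_closed[OF assms] gerst_circ_closed[OF assms(2,1)]
    unfolding idx gerst_bracket_def by (intro C.minus_closed C.signed_closed)
qed

lemma hoch_dif_closed:
  assumes "f \<in> carrier (cochains K A (p + 1))"
  shows "hoch_dif K A p f \<in> carrier (cochains K A (p + 2))"
proof -
  interpret C: module K "cochains K A (p + 2)" by (rule cochains_module)
  show ?thesis
    using gerst_bracket_closed[OF assms, of "mult_cochain A" 1] mult_cochain_closed
    unfolding hoch_dif_def add.assoc one_add_one by (intro C.a_inv_closed)
qed

end

subsection \<open>Cochains intertwined by a linear map\<close>

definition intertwines ::
  "('k, 'b, 'm) module_scheme \<Rightarrow> ('b \<Rightarrow> 'c) \<Rightarrow> int \<Rightarrow> ('b list \<Rightarrow> 'b) \<Rightarrow> ('c list \<Rightarrow> 'c) \<Rightarrow> bool" where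
  "intertwines B \<phi> n f f' \<longleftrightarrow> (\<forall>xs \<in> tuples B n. f' (map \<phi> xs) = \<phi> (f xs))"

locale linear_map = M: module K M + N: module K N
  for K (structure) and M (structure) and N (structure) +
  fixes \<phi> assumes linear: "\<phi> \<in> linear_maps K M N"
begin

lemma map_closed [simp]: "x \<in> carrier M \<Longrightarrow> \<phi> x \<in> carrier N"
  using linear by (auto simp: linear_maps_def)

lemma map_add: "\<lbrakk>x \<in> carrier M; y \<in> carrier M\<rbrakk> \<Longrightarrow> \<phi> (x \<oplus>\<^bsub>M\<^esub> y) = \<phi> x \<oplus>\<^bsub>N\<^esub> \<phi> y"
  using linear by (auto simp: linear_maps_def)

lemma map_smult: "\<lbrakk>r \<in> carrier K; x \<in> carrier M\<rbrakk> \<Longrightarrow> \<phi> (r \<odot>\<^bsub>M\<^esub> x) = r \<odot>\<^bsub>N\<^esub> \<phi> x"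
  using linear by (auto simp: linear_maps_def)

lemma map_zero [simp]: "\<phi> \<zero>\<^bsub>M\<^esub> = \<zero>\<^bsub>N\<^esub>"
  using map_smult[of "\<zero>\<^bsub>K\<^esub>" "\<zero>\<^bsub>M\<^esub>"] by simp

lemma map_minus: "x \<in> carrier M \<Longrightarrow> \<phi> (\<ominus>\<^bsub>M\<^esub> x) = \<ominus>\<^bsub>N\<^esub> \<phi> x"
  using map_smult[of "\<ominus>\<^bsub>K\<^esub> \<one>\<^bsub>K\<^esub>" x] by (simp add: M.smult_l_minus N.smult_l_minus)

lemma map_diff: "\<lbrakk>x \<in> carrier M; y \<in> carrier M\<rbrakk> \<Longrightarrow> \<phi> (x \<ominus>\<^bsub>M\<^esub> y) = \<phi> x \<ominus>\<^bsub>N\<^esub> \<phi> y"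
  by (simp add: a_minus_def map_add map_minus)

lemma map_signed: "x \<in> carrier M \<Longrightarrow> \<phi> (signed M p x) = signed N p (\<phi> x)"
  by (simp add: signed_def map_minus)

lemma map_finsum:
  "\<lbrakk>finite A; f \<in> A \<rightarrow> carrier M\<rbrakk> \<Longrightarrow> \<phi> (finsum M f A) = (\<Oplus>\<^bsub>N\<^esub>i\<in>A. \<phi> (f i))"
proof (induction A rule: finite_induct)
  case (insert x F)
  then show ?case by (simp add: Pi_def map_add)
qed simp

lemma map_tuples: "xs \<in> tuples M n \<Longrightarrow> map \<phi> xs \<in> tuples N n"
  by (auto simp: tuples_def)

lemma intertwines_zero: "intertwines M \<phi> n \<zero>\<^bsub>cochains K M n\<^esub> \<zero>\<^bsub>cochains K N n\<^esub>"
  by (simp add: intertwines_def map_tuples M.cochains_zero_apply N.cochains_zero_apply)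

lemma intertwines_add:
  assumes "f \<in> carrier (cochains K M n)" "g \<in> carrier (cochains K M n)"
    and "intertwines M \<phi> n f f'" "intertwines M \<phi> n g g'"
  shows "intertwines M \<phi> n (f \<oplus>\<^bsub>cochains K M n\<^esub> g) (f' \<oplus>\<^bsub>cochains K N n\<^esub> g')"
  using assms unfolding intertwines_def
  by (simp add: map_tuples M.cochains_add_apply N.cochains_add_apply map_add M.cochains_closed)

lemma intertwines_smult:
  assumes "r \<in> carrier K" "f \<in> carrier (cochains K M n)" "intertwines M \<phi> n f f'"
  shows "intertwines M \<phi> n (r \<odot>\<^bsub>cochains K M n\<^esub> f) (r \<odot>\<^bsub>cochains K N n\<^esub> f')"
  using assms unfolding intertwines_def
  by (simp add: map_tuples M.cochains_smult_apply N.cochains_smult_apply map_smult M.cochains_closed)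

lemma intertwines_uminus:
  assumes "f \<in> carrier (cochains K M n)" "f' \<in> carrier (cochains K N n)" "intertwines M \<phi> n f f'"
  shows "intertwines M \<phi> n (\<ominus>\<^bsub>cochains K M n\<^esub> f) (\<ominus>\<^bsub>cochains K N n\<^esub> f')"
  using assms unfolding intertwines_def
  by (simp add: map_tuples M.cochains_minus_apply N.cochains_minus_apply map_minus M.cochains_closed)

lemma intertwines_signed:
  assumes "f \<in> carrier (cochains K M n)" "f' \<in> carrier (cochains K N n)" "intertwines M \<phi> n f f'"
  shows "intertwines M \<phi> n (signed (cochains K M n) p f) (signed (cochains K N n) p f')"
  using assms by (simp add: signed_def intertwines_uminus)

lemma intertwines_diff:
  assumes "f \<in> carrier (cochains K M n)" "f' \<in> carrier (cochains K N n)" "intertwines M \<phi> n f f'"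
    and "g \<in> carrier (cochains K M n)" "g' \<in> carrier (cochains K N n)" "intertwines M \<phi> n g g'"
  shows "intertwines M \<phi> n (f \<ominus>\<^bsub>cochains K M n\<^esub> g) (f' \<ominus>\<^bsub>cochains K N n\<^esub> g')"
  using assms unfolding intertwines_def
  by (simp add: map_tuples M.cochains_diff_apply N.cochains_diff_apply map_diff M.cochains_closed)

text \<open>Applying \<open>\<phi>\<close> entrywise commutes with \<open>insert_at\<close> when
  \<open>g\<close> and \<open>g'\<close> are intertwined, and \<open>\<phi>\<close> passes through
  sums and signs by linearity.\<close>

lemma intertwines_gerst_circ:
  assumes f: "f \<in> carrier (cochains K M m)" "f' \<in> carrier (cochains K N m)" "intertwines M \<phi> m f f'"
    and g: "g \<in> carrier (cochains K M n)" "g' \<in> carrier (cochains K N n)" "intertwines M \<phi> n g g'"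
  shows "intertwines M \<phi> (m + n - 1) (gerst_circ M m n f g) (gerst_circ N m n f' g')"
proof (cases m n rule: M.nat_arities)
  case 1
  then show ?thesis
    using intertwines_zero by (simp add: gerst_circ_neg[of m n M _ _ K] gerst_circ_neg[of m n N _ _ K])
next
  case (2 m' n')
  show ?thesis
    unfolding intertwines_def
  proof
    fix xs assume "xs \<in> tuples M (m + n - 1)"
    then have xs: "xs \<in> tuples M (int m' + int n' - 1)"
      by (simp add: 2)
    have ins: "f' (insert_at i n' g' (map \<phi> xs)) = \<phi> (f (insert_at i n' g xs))" if "i < m'" for i
    proof -
      have "insert_at i n' g' (map \<phi> xs) = map \<phi> (insert_at i n' g xs)"
        using g(3) M.block_tuples[OF xs that] 2
        by (simp add: insert_at_def intertwines_def take_map drop_map)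
      then show ?thesis
        using f(3) M.insert_at_cochain[OF g(1)[unfolded 2] xs that] 2 by (simp add: intertwines_def)
    qed
    note v = M.insert_at_value[OF f(1)[unfolded 2] g(1)[unfolded 2] xs]
    show "gerst_circ N m n f' g' (map \<phi> xs) = \<phi> (gerst_circ M m n f g xs)"
      unfolding 2 gerst_circ_apply[OF xs] gerst_circ_apply[OF map_tuples[OF xs]]
      by (subst map_finsum) (auto simp: v ins map_signed intro!: N.finsum_cong')
  qed
qed

lemma intertwines_gerst_bracket:
  assumes f: "f \<in> carrier (cochains K M (p + 1))" "f' \<in> carrier (cochains K N (p + 1))"
      "intertwines M \<phi> (p + 1) f f'"
    and g: "g \<in> carrier (cochains K M (q + 1))" "g' \<in> carrier (cochains K N (q + 1))"
      "intertwines M \<phi> (q + 1) g g'"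
  shows "intertwines M \<phi> (p + q + 1) (gerst_bracket K M p q f g) (gerst_bracket K N p q f' g')"
proof -
  have idx: "p + 1 + (q + 1) - 1 = p + q + 1" "q + 1 + (p + 1) - 1 = p + q + 1"
    by simp_all
  interpret CM: module K "cochains K M (p + q + 1)" by (rule M.cochains_module)
  interpret CN: module K "cochains K N (p + q + 1)" by (rule N.cochains_module)
  show ?thesis
    unfolding gerst_bracket_def
    using M.gerst_circ_closed[OF f(1) g(1)] M.gerst_circ_closed[OF g(1) f(1)]
      N.gerst_circ_closed[OF f(2) g(2)] N.gerst_circ_closed[OF g(2) f(2)]
      intertwines_gerst_circ[OF f g] intertwines_gerst_circ[OF g f]
    unfolding idx
    by (intro intertwines_diff intertwines_signed CM.signed_closed CN.signed_closed)
qed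

end

locale assoc_hom = linear_map K M N \<phi> + M: assoc_algebra K M + N: assoc_algebra K N
  for K (structure) and M (structure) and N (structure) and \<phi> +
  assumes hom: "\<phi> \<in> algebra_homs K M N"
begin

text \<open>Here the multiplicativity of \<open>\<phi>\<close> enters. Linearity suffices for
  brackets; the differential also involves the multiplication cochains.\<close>

lemma intertwines_mult_cochain: "intertwines M \<phi> 2 (mult_cochain M) (mult_cochain N)"
  unfolding intertwines_def
proof
  fix xs assume xs: "xs \<in> tuples M 2"
  then show "mult_cochain N (map \<phi> xs) = \<phi> (mult_cochain M xs)"
    using map_tuples[OF xs] hom
    by (auto simp: mult_cochain_def tuples_2 algebra_homs_def ring_hom_def)
qed

lemma intertwines_hoch_dif:
  assumes "f \<in> carrier (cochains K M (p + 1))" "f' \<in> carrier (cochains K N (p + 1))"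
      "intertwines M \<phi> (p + 1) f f'"
  shows "intertwines M \<phi> (p + 2) (hoch_dif K M p f) (hoch_dif K N p f')"
  using M.gerst_bracket_closed[OF assms(1), of "mult_cochain M" 1] M.mult_cochain_closed
    N.gerst_bracket_closed[OF assms(2), of "mult_cochain N" 1] N.mult_cochain_closed
    intertwines_gerst_bracket[OF assms, of "mult_cochain M" 1 "mult_cochain N"] intertwines_mult_cochain
  unfolding hoch_dif_def add.assoc one_add_one by (intro intertwines_uminus)

end

lemma assoc_homI:
  "\<lbrakk>assoc_algebra K A; assoc_algebra K B; \<phi> \<in> algebra_homs K A B\<rbrakk> \<Longrightarrow> assoc_hom K A B \<phi>"
  by (simp add: assoc_hom_def linear_map_def linear_map_axioms_def assoc_hom_axioms_def
      assoc_algebra_def algebra_homs_def)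

subsection \<open>Quotients of modules, algebras and DGLAs\<close>

locale quotient_module = module K M + submodule I K M
  for K (structure) and M (structure) and I

sublocale quotient_module \<subseteq> Q: abelian_subgroup I M
  by (intro abelian_subgroupI3 additive_subgroup.intro subgroup_axioms M.abelian_group_axioms)

context quotient_module
begin

lemma rcosets_cases:
  assumes "X \<in> a_rcosets\<^bsub>M\<^esub> I"
  obtains x where "x \<in> carrier M" "X = I +>\<^bsub>M\<^esub> x"
  using assms by (auto simp: A_RCOSETS_def')

lemma rcos_mem: "x \<in> carrier M \<Longrightarrow> I +>\<^bsub>M\<^esub> x \<in> a_rcosets\<^bsub>M\<^esub> I"
  by (auto simp: A_RCOSETS_def')

lemma rcos_eq_iff:
  assumes "x \<in> carrier M" "y \<in> carrier M"
  shows "I +>\<^bsub>M\<^esub> x = I +>\<^bsub>M\<^esub> y \<longleftrightarrow> x \<ominus>\<^bsub>M\<^esub> y \<in> I"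
  using assms Q.a_rcos_module[of y x] unfolding M.minus_eq
  by (metis Q.a_repr_independence' Q.a_rcos_self)

text \<open>Quotient operations are unions over all representatives of a coset; such a union
  collapses to a single member once its members coincide.\<close>

lemma UN_rcos_eq:
  assumes "x \<in> carrier M" "\<And>y. \<lbrakk>y \<in> carrier M; I +>\<^bsub>M\<^esub> y = I +>\<^bsub>M\<^esub> x\<rbrakk> \<Longrightarrow> f y = f x"
  shows "(\<Union>y \<in> I +>\<^bsub>M\<^esub> x. f y) = f x"
proof -
  have "f y = f x" if "y \<in> I +>\<^bsub>M\<^esub> x" for y
  proof -
    have "y \<in> carrier M"
      using that assms(1) M.a_r_coset_subset_G Q.a_subset by blast
    then show ?thesis
      using assms that Q.a_repr_independence' by metis
  qed
  then show ?thesis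
    using Q.a_rcos_self[OF assms(1)] by blast
qed

lemma rcos_add: "\<lbrakk>x \<in> carrier M; y \<in> carrier M\<rbrakk> \<Longrightarrow>
    (I +>\<^bsub>M\<^esub> x) <+>\<^bsub>M\<^esub> (I +>\<^bsub>M\<^esub> y) = I +>\<^bsub>M\<^esub> (x \<oplus>\<^bsub>M\<^esub> y)"
  by (rule Q.a_rcos_sum)

lemma rcos_smult:
  assumes "r \<in> carrier K" "x \<in> carrier M"
  shows "(\<Union>y \<in> I +>\<^bsub>M\<^esub> x. I +>\<^bsub>M\<^esub> (r \<odot>\<^bsub>M\<^esub> y)) = I +>\<^bsub>M\<^esub> (r \<odot>\<^bsub>M\<^esub> x)"
proof (rule UN_rcos_eq[OF assms(2)])
  fix y assume "y \<in> carrier M" "I +>\<^bsub>M\<^esub> y = I +>\<^bsub>M\<^esub> x"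
  then show "I +>\<^bsub>M\<^esub> (r \<odot>\<^bsub>M\<^esub> y) = I +>\<^bsub>M\<^esub> (r \<odot>\<^bsub>M\<^esub> x)"
    using assms smult_closed[of r "y \<ominus>\<^bsub>M\<^esub> x"]
    by (simp add: rcos_eq_iff M.minus_eq smult_r_distr smult_r_minus)
qed

lemma rcos_zero: "I = I +>\<^bsub>M\<^esub> \<zero>\<^bsub>M\<^esub>"
  by (simp add: Q.a_subset)

lemma quot_module_simps:
  "carrier (quot_module M I) = a_rcosets\<^bsub>M\<^esub> I"
  "\<zero>\<^bsub>quot_module M I\<^esub> = I"
  "\<lbrakk>x \<in> carrier M; y \<in> carrier M\<rbrakk> \<Longrightarrow>
    (I +>\<^bsub>M\<^esub> x) \<oplus>\<^bsub>quot_module M I\<^esub> (I +>\<^bsub>M\<^esub> y) = I +>\<^bsub>M\<^esub> (x \<oplus>\<^bsub>M\<^esub> y)"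
  "\<lbrakk>r \<in> carrier K; x \<in> carrier M\<rbrakk> \<Longrightarrow>
    r \<odot>\<^bsub>quot_module M I\<^esub> (I +>\<^bsub>M\<^esub> x) = I +>\<^bsub>M\<^esub> (r \<odot>\<^bsub>M\<^esub> x)"
  by (simp_all add: quot_module_def rcos_add rcos_smult)

lemma quot_module: "module K (quot_module M I)"
proof (rule moduleI)
  show "abelian_group (quot_module M I)"
  proof (rule abelian_groupI)
    show "\<zero>\<^bsub>quot_module M I\<^esub> \<in> carrier (quot_module M I)"
      using rcos_mem[OF M.zero_closed] rcos_zero by (simp add: quot_module_simps)
    fix X assume "X \<in> carrier (quot_module M I)"
    then obtain x where x: "x \<in> carrier M" "X = I +>\<^bsub>M\<^esub> x"
      unfolding quot_module_simps by (rule rcosets_cases)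
    show "\<zero>\<^bsub>quot_module M I\<^esub> \<oplus>\<^bsub>quot_module M I\<^esub> X = X"
      unfolding x(2) quot_module_simps(2) using x(1) quot_module_simps(3)[OF M.zero_closed x(1)] rcos_zero
      by simp
    have "(I +>\<^bsub>M\<^esub> (\<ominus>\<^bsub>M\<^esub> x)) \<oplus>\<^bsub>quot_module M I\<^esub> X = \<zero>\<^bsub>quot_module M I\<^esub>"
      using x rcos_zero by (simp add: quot_module_simps M.l_neg)
    then show "\<exists>Y\<in>carrier (quot_module M I). Y \<oplus>\<^bsub>quot_module M I\<^esub> X = \<zero>\<^bsub>quot_module M I\<^esub>"
      using rcos_mem[of "\<ominus>\<^bsub>M\<^esub> x"] x(1) by (auto simp: quot_module_simps(1))
  qed (auto simp: quot_module_simps rcos_mem M.a_ac elim!: rcosets_cases)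
qed (auto simp: quot_module_simps rcos_mem smult_l_distr smult_r_distr smult_assoc1
    R.is_cring elim!: rcosets_cases)

lemma quot_map_rcos:
  assumes N: "quotient_module K N J" and h: "h \<in> linear_maps K M N" and "h ` I \<subseteq> J"
    and x: "x \<in> carrier M"
  shows "quot_map M I N J h (I +>\<^bsub>M\<^esub> x) = J +>\<^bsub>N\<^esub> h x"
proof -
  interpret N: quotient_module K N J by fact
  interpret h: linear_map K M N h
    by (intro linear_map.intro linear_map_axioms.intro module_axioms N.module_axioms h)
  have "(\<Union>y \<in> I +>\<^bsub>M\<^esub> x. J +>\<^bsub>N\<^esub> h y) = J +>\<^bsub>N\<^esub> h x"
  proof (rule UN_rcos_eq[OF x])
    fix y assume "y \<in> carrier M" "I +>\<^bsub>M\<^esub> y = I +>\<^bsub>M\<^esub> x"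
    then show "J +>\<^bsub>N\<^esub> h y = J +>\<^bsub>N\<^esub> h x"
      using assms(3) x by (auto simp: rcos_eq_iff N.rcos_eq_iff h.map_diff[symmetric])
  qed
  then show ?thesis
    using rcos_mem[OF x] by (simp add: quot_map_def)
qed

lemma quot_map_linear:
  assumes N: "quotient_module K N J" and h: "h \<in> linear_maps K M N" and "h ` I \<subseteq> J"
  shows "quot_map M I N J h \<in> linear_maps K (quot_module M I) (quot_module N J)"
proof -
  interpret N: quotient_module K N J by fact
  interpret h: linear_map K M N h
    by (intro linear_map.intro linear_map_axioms.intro module_axioms N.module_axioms h)
  note q = quot_map_rcos[OF assms]
  show ?thesis
  proof (rule linear_mapsI)
    have "quot_map M I N J h \<in> extensional (carrier (quot_module M I))"
      by (simp add: quot_map_def quot_module_simps)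
    moreover have "quot_map M I N J h X \<in> carrier (quot_module N J)"
      if "X \<in> carrier (quot_module M I)" for X
      using that unfolding quot_module_simps N.quot_module_simps
      by (auto simp: q N.rcos_mem elim!: rcosets_cases)
    ultimately show "quot_map M I N J h \<in> carrier (quot_module M I) \<rightarrow>\<^sub>E carrier (quot_module N J)"
      by (auto simp: PiE_def)
  qed (auto simp: quot_module_simps N.quot_module_simps q h.map_add h.map_smult elim!: rcosets_cases)
qed

end

lemma quot_algebra_simps:
  "carrier (quot_algebra A I) = a_rcosets\<^bsub>A\<^esub> I"
  "\<zero>\<^bsub>quot_algebra A I\<^esub> = I"
  "\<one>\<^bsub>quot_algebra A I\<^esub> = I +>\<^bsub>A\<^esub> \<one>\<^bsub>A\<^esub>"
  "X \<oplus>\<^bsub>quot_algebra A I\<^esub> Y = X \<oplus>\<^bsub>quot_module A I\<^esub> Y"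
  "X \<otimes>\<^bsub>quot_algebra A I\<^esub> Y = rcoset_mult A I X Y"
  "r \<odot>\<^bsub>quot_algebra A I\<^esub> X = r \<odot>\<^bsub>quot_module A I\<^esub> X"
  by (simp_all add: quot_algebra_def quot_module_def ring.defs module.defs FactRing_def)

lemma linear_maps_quot_algebra:
  "linear_maps K (quot_algebra A I) N = linear_maps K (quot_module A I) N"
  "linear_maps K M (quot_algebra A I) = linear_maps K M (quot_module A I)"
  by (simp_all add: linear_maps_def quot_algebra_simps) (simp_all add: quot_module_def)

context assoc_algebra
begin

text \<open>Scalars act through the unit, \<open>r x = (r 1) x\<close>, so a ring ideal is stable
  under them.\<close>

lemma quotient_module_ideal:
  assumes "ideal I A"
  shows "quotient_module K A I"
proof -
  interpret I: ideal I A by fact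
  have "r \<odot>\<^bsub>A\<^esub> x \<in> I" if "r \<in> carrier K" "x \<in> I" for r x
    using I.I_l_closed[of x "r \<odot>\<^bsub>A\<^esub> \<one>\<^bsub>A\<^esub>"] that I.a_Hcarr by (simp add: smult_mult_left)
  then show ?thesis
    by (intro quotient_module.intro submodule.intro submodule_axioms.intro module_axioms I.a_subgroup)
qed

lemma quot_algebra:
  assumes "ideal I A"
  shows "assoc_algebra K (quot_algebra A I)"
proof -
  interpret I: ideal I A by fact
  interpret Q: quotient_module K A I by (rule quotient_module_ideal[OF assms])
  interpret QM: module K "quot_module A I" by (rule Q.quot_module)
  have add_monoid: "add_monoid (quot_algebra A I) = add_monoid (quot_module A I)"
    by (simp add: quot_algebra_def quot_module_def ring.defs module.defs FactRing_def)
  have ab: "abelian_group (quot_algebra A I)"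
    using QM.abelian_group_axioms
    unfolding abelian_group_def abelian_group_axioms_def abelian_monoid_def add_monoid .
  have mult: "(I +>\<^bsub>A\<^esub> x) \<otimes>\<^bsub>quot_algebra A I\<^esub> (I +>\<^bsub>A\<^esub> y) = I +>\<^bsub>A\<^esub> (x \<otimes>\<^bsub>A\<^esub> y)"
    if "x \<in> carrier A" "y \<in> carrier A" for x y
    using that by (simp add: quot_algebra_simps I.rcoset_mult_add)
  note simps = quot_algebra_simps(1,3,4,6) mult Q.quot_module_simps
  have ring: "ring (quot_algebra A I)"
  proof (rule ringI[OF ab])
    show "monoid (quot_algebra A I)"
      by (rule monoidI) (auto simp: simps Q.rcos_mem A.m_assoc elim!: Q.rcosets_cases)
  qed (auto simp: simps A.l_distr A.r_distr elim!: Q.rcosets_cases)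
  have mod: "module K (quot_algebra A I)"
    by (rule moduleI[OF _ ab]) (auto simp: simps Q.rcos_mem smult_l_distr smult_r_distr smult_assoc1
        R.is_cring elim!: Q.rcosets_cases)
  show ?thesis
    by (intro assoc_algebra.intro assoc_algebra_axioms.intro mod ring)
      (auto simp: simps smult_mult_left smult_mult_right elim!: Q.rcosets_cases)
qed

lemma quot_algebra_proj:
  assumes "ideal I A"
  shows "(\<lambda>x \<in> carrier A. I +>\<^bsub>A\<^esub> x) \<in> algebra_homs K A (quot_algebra A I)"
proof -
  interpret I: ideal I A by fact
  interpret Q: quotient_module K A I by (rule quotient_module_ideal[OF assms])
  show ?thesis
    unfolding algebra_homs_def
    by (auto simp: ring_hom_def quot_algebra_simps Q.quot_module_simps Q.rcos_mem I.rcoset_mult_add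
        intro!: linear_mapsI)
qed

lemma quot_map_algebra_homs:
  assumes "ideal I A" "assoc_algebra K B" "ideal J B" "h \<in> algebra_homs K A B" "h ` I \<subseteq> J"
  shows "quot_map A I B J h \<in> algebra_homs K (quot_algebra A I) (quot_algebra B J)"
proof -
  interpret B: assoc_algebra K B by fact
  interpret I: ideal I A by fact
  interpret J: ideal J B by fact
  interpret Q: quotient_module K A I by (rule quotient_module_ideal[OF assms(1)])
  interpret QB: quotient_module K B J by (rule B.quotient_module_ideal[OF assms(3)])
  have h: "h \<in> linear_maps K A B" "h \<in> ring_hom A B"
    using assms(4) by (simp_all add: algebra_homs_def)
  note q = Q.quot_map_rcos[OF QB.quotient_module_axioms h(1) assms(5)]
  have lin: "quot_map A I B J h \<in> linear_maps K (quot_algebra A I) (quot_algebra B J)"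
    unfolding linear_maps_quot_algebra
    by (rule Q.quot_map_linear[OF QB.quotient_module_axioms h(1) assms(5)])
  moreover have "quot_map A I B J h \<in> ring_hom (quot_algebra A I) (quot_algebra B J)"
    using lin h(2) by (intro ring_hom_memI)
      (auto simp: linear_maps_def quot_algebra_simps(1,3,5) q I.rcoset_mult_add J.rcoset_mult_add
        QB.rcos_mem ring_hom_closed ring_hom_mult ring_hom_one elim!: Q.rcosets_cases)
  ultimately show ?thesis
    by (simp add: algebra_homs_def)
qed

end

section \<open>Transfer of DGLA structures along injections and to quotients by kernels\<close>

lemma linear_mapI:
  "\<lbrakk>module K M; module K N; h \<in> linear_maps K M N\<rbrakk> \<Longrightarrow> linear_map K M N h"
  by (intro linear_map.intro linear_map_axioms.intro)

lemma dgla_homsD: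
  assumes "h \<in> dgla_homs K G H"
  shows "h p \<in> linear_maps K (gr G p) (gr H p)"
    and "\<lbrakk>x \<in> carrier (gr G p); y \<in> carrier (gr G q)\<rbrakk> \<Longrightarrow>
      h (p + q) (brk G p q x y) = brk H p q (h p x) (h q y)"
    and "x \<in> carrier (gr G p) \<Longrightarrow> h (p + 1) (dif G p x) = dif H p (h p x)"
  using assms by (simp_all add: dgla_homs_def)

text \<open>The axioms of a DGLA are equations, so they can be checked after an injective homomorphism.\<close>

lemma dgla_of_inj:
  fixes G :: "('k, 'x) dgla" and H :: "('k, 'y) dgla"
  assumes H: "dgla K H" and h: "h \<in> dgla_homs K G H" and inj: "\<And>p. inj_on (h p) (carrier (gr G p))"
    and mod: "\<And>p. module K (gr G p)"
    and brk: "\<And>p q x y. \<lbrakk>x \<in> carrier (gr G p); y \<in> carrier (gr G q)\<rbrakk> \<Longrightarrow>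
      brk G p q x y \<in> carrier (gr G (p + q))"
    and dif: "\<And>p x. x \<in> carrier (gr G p) \<Longrightarrow> dif G p x \<in> carrier (gr G (p + 1))"
  shows "dgla K G"
proof -
  interpret H: dgla K H by fact
  have lin: "linear_map K (gr G p) (gr H p) (h p)" for p
    by (rule linear_mapI[OF mod H.gr_module dgla_homsD(1)[OF h]])
  have ab: "abelian_group (gr G p)" for p
    using mod by (simp add: module_def)
  note cl = abelian_group.a_inv_closed[OF ab] module.smult_closed[OF mod]
    abelian_monoid.a_closed[OF abelian_group.axioms(1)[OF ab]] module.signed_closed[OF mod]
    abelian_monoid.zero_closed[OF abelian_group.axioms(1)[OF ab]]
  note hom = linear_map.map_add[OF lin] linear_map.map_smult[OF lin] linear_map.map_minus[OF lin]
    linear_map.map_signed[OF lin] linear_map.map_zero[OF lin] linear_map.map_closed[OF lin]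
    dgla_homsD(2,3)[OF h]
  have eqI: "u = v" if "h p u = h p v" "u \<in> carrier (gr G p)" "v \<in> carrier (gr G p)" for p u v
    using inj_onD[OF inj that] .
  \<comment> \<open>Leaving the degree \<open>d\<close> free, subject to an equation, lets these
    rules apply to the regrouped degrees in the Jacobi and Leibniz identities.\<close>
  have hb: "h d (brk G p q x y) = brk H p q (h p x) (h q y)"
    if "d = p + q" "x \<in> carrier (gr G p)" "y \<in> carrier (gr G q)" for d p q x y
    using that dgla_homsD(2)[OF h] by simp
  have hd: "h d (dif G p x) = dif H p (h p x)" if "d = p + 1" "x \<in> carrier (gr G p)" for d p x
    using that dgla_homsD(3)[OF h] by simp
  have bc: "brk G p q x y \<in> carrier (gr G d)"
    if "d = p + q" "x \<in> carrier (gr G p)" "y \<in> carrier (gr G q)" for d p q x y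
    using that brk by simp
  have dc: "dif G p x \<in> carrier (gr G d)" if "d = p + 1" "x \<in> carrier (gr G p)" for d p x
    using that dif by simp
  note hom' = hom(1-6) hb hd bc dc cl
  show ?thesis
  proof (rule dgla.intro, goal_cases)
    case (2 x p y q) then show ?case by (rule brk)
  next
    case (3 x p x' y q)
    then show ?case by (intro eqI[of "p + q"]) (simp_all add: hom' H.brk_add_left)
  next
    case (4 x p y q y')
    then show ?case by (intro eqI[of "p + q"]) (simp_all add: hom' H.brk_add_right)
  next
    case (5 r x p y q)
    then show ?case by (intro eqI[of "p + q"]) (simp_all add: hom' H.brk_smult_left)
  next
    case (6 r x p y q)
    then show ?case by (intro eqI[of "p + q"]) (simp_all add: hom' H.brk_smult_right)
  next
    case (7 x p y q)
    show ?case
    proof (rule eqI[of "p + q"])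
      show "h (p + q) (brk G p q x y) =
          h (p + q) (\<ominus>\<^bsub>gr G (p + q)\<^esub> signed (gr G (p + q)) (p * q) (brk G q p y x))"
        using 7 by (simp add: hom' H.antisymmetry[of "h p x" p "h q y" q])
    qed (use 7 in \<open>simp_all add: hom'\<close>)
  next
    case (8 x p y q z s)
    show ?case
    proof (rule eqI[of "p + q + s"])
      show "h (p + q + s) (brk G p (q + s) x (brk G q s y z)) = h (p + q + s)
          (brk G (p + q) s (brk G p q x y) z \<oplus>\<^bsub>gr G (p + q + s)\<^esub>
           signed (gr G (p + q + s)) (p * q) (brk G q (p + s) y (brk G p s x z)))"
        using 8 by (simp add: hom' H.jacobi[of "h p x" p "h q y" q "h s z" s])
    qed (use 8 in \<open>simp_all add: hom'\<close>)
  next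
    case (9 p)
    interpret Hp: module K "gr H p" by (rule H.gr_module)
    note d = linear_mapI[OF H.gr_module H.gr_module H.dif_linear[of p]]
    show ?case
    proof (rule linear_mapsI)
      show "restrict (dif G p) (carrier (gr G p)) \<in> carrier (gr G p) \<rightarrow>\<^sub>E carrier (gr G (p + 1))"
        using dif by auto
      fix x y assume xy: "x \<in> carrier (gr G p)" "y \<in> carrier (gr G p)"
      then have "dif G p (x \<oplus>\<^bsub>gr G p\<^esub> y) = dif G p x \<oplus>\<^bsub>gr G (p + 1)\<^esub> dif G p y"
        using linear_map.map_add[OF d, of "h p x" "h p y"]
        by (intro eqI[of "p + 1"]) (simp_all add: hom')
      then show "restrict (dif G p) (carrier (gr G p)) (x \<oplus>\<^bsub>gr G p\<^esub> y) =
          restrict (dif G p) (carrier (gr G p)) x \<oplus>\<^bsub>gr G (p + 1)\<^esub>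
          restrict (dif G p) (carrier (gr G p)) y"
        using xy cl by simp
      fix r x assume rx: "r \<in> carrier K" "x \<in> carrier (gr G p)"
      then have "dif G p (r \<odot>\<^bsub>gr G p\<^esub> x) = r \<odot>\<^bsub>gr G (p + 1)\<^esub> dif G p x"
        using linear_map.map_smult[OF d, of r "h p x"]
        by (intro eqI[of "p + 1"]) (simp_all add: hom')
      then show "restrict (dif G p) (carrier (gr G p)) (r \<odot>\<^bsub>gr G p\<^esub> x) =
          r \<odot>\<^bsub>gr G (p + 1)\<^esub> restrict (dif G p) (carrier (gr G p)) x"
        using rx cl by simp
    qed
  next
    case (10 x p)
    then show ?case by (intro eqI[of "p + 2"]) (simp_all add: hom' H.dif_dif)
  next
    case (11 x p y q)
    show ?case
    proof (rule eqI[of "p + q + 1"])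
      show "h (p + q + 1) (dif G (p + q) (brk G p q x y)) = h (p + q + 1)
          (brk G p (q + 1) x (dif G q y) \<oplus>\<^bsub>gr G (p + q + 1)\<^esub>
           signed (gr G (p + q + 1)) q (brk G (p + 1) q (dif G p x) y))"
        using 11 by (simp add: hom' H.leibniz[of "h p x" p "h q y" q])
    qed (use 11 in \<open>simp_all add: hom'\<close>)
  qed (rule mod)
qed

text \<open>The choice of the representative is irrelevant whenever \<open>h\<close> is constant on the cosets.\<close>

definition induced :: "('k, 'a, 'm) module_scheme \<Rightarrow> 'a set \<Rightarrow> ('a \<Rightarrow> 'b) \<Rightarrow> 'a set \<Rightarrow> 'b" where
  "induced M I h = (\<lambda>X \<in> a_rcosets\<^bsub>M\<^esub> I. h (SOME x. x \<in> X))"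

locale kernel_quotient = linear_map K M N \<phi> + quotient_module K M I
  for K (structure) and M (structure) and N (structure) and \<phi> and I +
  assumes kernel: "I = {x \<in> carrier M. \<phi> x = \<zero>\<^bsub>N\<^esub>}"
begin

lemma rcos_eq_iff_map_eq:
  assumes "x \<in> carrier M" "y \<in> carrier M"
  shows "I +>\<^bsub>M\<^esub> x = I +>\<^bsub>M\<^esub> y \<longleftrightarrow> \<phi> x = \<phi> y"
proof -
  have "I +>\<^bsub>M\<^esub> x = I +>\<^bsub>M\<^esub> y \<longleftrightarrow> x \<ominus>\<^bsub>M\<^esub> y \<in> I"
    by (rule rcos_eq_iff[OF assms])
  also have "\<dots> \<longleftrightarrow> \<phi> x \<ominus>\<^bsub>N\<^esub> \<phi> y = \<zero>\<^bsub>N\<^esub>"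
    unfolding kernel using assms by (simp add: map_diff)
  also have "\<dots> \<longleftrightarrow> \<phi> x = \<zero>\<^bsub>N\<^esub> \<oplus>\<^bsub>N\<^esub> \<phi> y"
    unfolding N.minus_eq using assms by (intro N.add.inv_solve_right') simp_all
  finally show ?thesis
    using assms by simp
qed

lemma induced_rcos:
  assumes "x \<in> carrier M"
  shows "induced M I \<phi> (I +>\<^bsub>M\<^esub> x) = \<phi> x"
proof -
  have "(SOME y. y \<in> I +>\<^bsub>M\<^esub> x) \<in> I +>\<^bsub>M\<^esub> x"
    using Q.a_rcos_self[OF assms] by (rule someI)
  then have "(SOME y. y \<in> I +>\<^bsub>M\<^esub> x) \<in> carrier M" "I +>\<^bsub>M\<^esub> (SOME y. y \<in> I +>\<^bsub>M\<^esub> x) = I +>\<^bsub>M\<^esub> x"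
    using Q.a_repr_independence'[OF _ assms] M.a_r_coset_subset_G[OF Q.a_subset assms] by auto
  then show ?thesis
    using rcos_eq_iff_map_eq assms rcos_mem by (simp add: induced_def)
qed

lemma induced_linear: "induced M I \<phi> \<in> linear_maps K (quot_module M I) N"
proof (rule linear_mapsI)
  have "induced M I \<phi> X \<in> carrier N" if "X \<in> a_rcosets\<^bsub>M\<^esub> I" for X
    using that by (elim rcosets_cases) (simp add: induced_rcos)
  then show "induced M I \<phi> \<in> carrier (quot_module M I) \<rightarrow>\<^sub>E carrier N"
    by (auto simp: quot_module_simps) (simp add: induced_def)
qed (auto simp: quot_module_simps induced_rcos map_add map_smult elim!: rcosets_cases)

lemma inj_induced: "inj_on (induced M I \<phi>) (carrier (quot_module M I))"
  by (rule inj_onI, unfold quot_module_simps, elim rcosets_cases)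
    (simp add: induced_rcos rcos_eq_iff_map_eq)

end

lemma kernel_quotientI:
  assumes "module K M" "module K N" "h \<in> linear_maps K M N" "I = {x \<in> carrier M. h x = \<zero>\<^bsub>N\<^esub>}"
  shows "kernel_quotient K M N h I"
proof -
  interpret linear_map K M N h by (rule linear_mapI[OF assms(1-3)])
  have "submodule I K M"
    unfolding assms(4) by (rule M.submoduleI) (auto simp: map_add map_minus map_smult)
  then show ?thesis
    using assms(4)
    by (intro kernel_quotient.intro kernel_quotient_axioms.intro quotient_module.intro
        linear_map_axioms M.module_axioms)
qed

text \<open>The setting of the first isomorphism theorem. Two elements lie in the same coset iff
  \<open>h\<close> maps them to the same element, so compatibility of \<open>h\<close> with bracket
  and differential makes these well defined on cosets; the axioms then come from
  \<open>H\<close>.\<close>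

locale kernel_dgla =
  fixes K :: "('k, 'r) ring_scheme" and G :: "('k, 'x) dgla" and H :: "('k, 'y) dgla" and h
    and I :: "int \<Rightarrow> 'x set"
  assumes H: "dgla K H" and h: "h \<in> dgla_homs K G H"
    and gr_module: "\<And>p. module K (gr G p)"
    and brk_closed: "\<And>p q x y. \<lbrakk>x \<in> carrier (gr G p); y \<in> carrier (gr G q)\<rbrakk> \<Longrightarrow>
      brk G p q x y \<in> carrier (gr G (p + q))"
    and dif_closed: "\<And>p x. x \<in> carrier (gr G p) \<Longrightarrow> dif G p x \<in> carrier (gr G (p + 1))"
    and kernel: "\<And>p. I p = {x \<in> carrier (gr G p). h p x = \<zero>\<^bsub>gr H p\<^esub>}"
begin

sublocale kq: kernel_quotient K "gr G p" "gr H p" "h p" "I p" for p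
  by (rule kernel_quotientI[OF gr_module dgla.gr_module[OF H] dgla_homsD(1)[OF h] kernel])

definition ind :: "int \<Rightarrow> 'x set \<Rightarrow> 'y" where
  "ind p = induced (gr G p) (I p) (h p)"

lemma quot_brk:
  assumes "x \<in> carrier (gr G p)" "y \<in> carrier (gr G q)"
  shows "brk (quot_dgla G I) p q (I p +>\<^bsub>gr G p\<^esub> x) (I q +>\<^bsub>gr G q\<^esub> y) =
    I (p + q) +>\<^bsub>gr G (p + q)\<^esub> brk G p q x y"
proof -
  have *: "I (p + q) +>\<^bsub>gr G (p + q)\<^esub> brk G p q x' y' = I (p + q) +>\<^bsub>gr G (p + q)\<^esub> brk G p q x y"
    if "x' \<in> carrier (gr G p)" "y' \<in> carrier (gr G q)"
      "I p +>\<^bsub>gr G p\<^esub> x' = I p +>\<^bsub>gr G p\<^esub> x" "I q +>\<^bsub>gr G q\<^esub> y' = I q +>\<^bsub>gr G q\<^esub> y" for x' y'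
    using that assms by (simp add: kq.rcos_eq_iff_map_eq brk_closed dgla_homsD(2)[OF h])
  have "(\<Union>y' \<in> I q +>\<^bsub>gr G q\<^esub> y. I (p + q) +>\<^bsub>gr G (p + q)\<^esub> brk G p q x' y') =
      I (p + q) +>\<^bsub>gr G (p + q)\<^esub> brk G p q x' y" if "x' \<in> carrier (gr G p)" for x'
    using that assms by (intro kq.UN_rcos_eq) (simp_all add: kq.rcos_eq_iff_map_eq brk_closed dgla_homsD(2)[OF h])
  moreover have "I p +>\<^bsub>gr G p\<^esub> x \<subseteq> carrier (gr G p)"
    using assms(1) by (intro kq.M.a_r_coset_subset_G kq.Q.a_subset)
  ultimately have "brk (quot_dgla G I) p q (I p +>\<^bsub>gr G p\<^esub> x) (I q +>\<^bsub>gr G q\<^esub> y) =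
      (\<Union>x' \<in> I p +>\<^bsub>gr G p\<^esub> x. I (p + q) +>\<^bsub>gr G (p + q)\<^esub> brk G p q x' y)"
    by (simp add: quot_dgla_def subset_iff)
  also have "\<dots> = I (p + q) +>\<^bsub>gr G (p + q)\<^esub> brk G p q x y"
    by (rule kq.UN_rcos_eq[OF assms(1)], rule *) (simp_all add: assms)
  finally show ?thesis .
qed

lemma quot_dif:
  assumes "x \<in> carrier (gr G p)"
  shows "dif (quot_dgla G I) p (I p +>\<^bsub>gr G p\<^esub> x) = I (p + 1) +>\<^bsub>gr G (p + 1)\<^esub> dif G p x"
proof -
  have "(\<Union>y \<in> I p +>\<^bsub>gr G p\<^esub> x. I (p + 1) +>\<^bsub>gr G (p + 1)\<^esub> dif G p y) =
      I (p + 1) +>\<^bsub>gr G (p + 1)\<^esub> dif G p x"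
    using assms
    by (intro kq.UN_rcos_eq) (simp_all add: kq.rcos_eq_iff_map_eq dif_closed dgla_homsD(3)[OF h])
  then show ?thesis
    by (simp add: quot_dgla_def)
qed

lemma quot_carrier: "carrier (gr (quot_dgla G I) p) = a_rcosets\<^bsub>gr G p\<^esub> (I p)"
  by (simp add: quot_dgla_def quot_module_def)

lemma ind_rcos: "x \<in> carrier (gr G p) \<Longrightarrow> ind p (I p +>\<^bsub>gr G p\<^esub> x) = h p x"
  by (simp add: ind_def kq.induced_rcos)

lemma ind_hom: "ind \<in> dgla_homs K (quot_dgla G I) H"
  unfolding dgla_homs_def
proof (safe, goal_cases)
  case (1 p)
  then show ?case by (simp add: quot_dgla_def ind_def kq.induced_linear)
next
  case (2 p q X Y)
  then show ?case
    unfolding quot_carrier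
    by (auto simp: quot_brk ind_rcos brk_closed dgla_homsD(2)[OF h] elim!: kq.rcosets_cases)
next
  case (3 p X)
  then show ?case
    unfolding quot_carrier
    by (auto simp: quot_dif ind_rcos dif_closed dgla_homsD(3)[OF h] elim!: kq.rcosets_cases)
qed

lemma inj_ind: "inj_on (ind p) (carrier (gr (quot_dgla G I) p))"
  using kq.inj_induced by (simp add: quot_dgla_def ind_def)

lemma dgla_quot: "dgla K (quot_dgla G I)"
proof (rule dgla_of_inj[OF H ind_hom inj_ind])
  show "module K (gr (quot_dgla G I) p)" for p
    by (simp add: quot_dgla_def kq.quot_module)
qed (auto simp: quot_carrier quot_brk quot_dif brk_closed dif_closed kq.rcos_mem elim!: kq.rcosets_cases)

end

section \<open>Transport of cochains along surjections\<close>

context linear_map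
begin

text \<open>For the projection onto \<open>A_red\<close> this is the ideal condition in the
  definition of \<open>C(A)_N\<close>; for an injective \<open>\<phi>\<close> it holds for every
  cochain. Reductions and isomorphisms are thus instances of one transport.\<close>

definition respects_kernel :: "int \<Rightarrow> ('c list \<Rightarrow> 'c) \<Rightarrow> bool" where
  "respects_kernel n f \<longleftrightarrow>
     (\<forall>xs \<in> tuples M n. (\<exists>x \<in> set xs. \<phi> x = \<zero>\<^bsub>N\<^esub>) \<longrightarrow> \<phi> (f xs) = \<zero>\<^bsub>N\<^esub>)"

text \<open>Replace the entries of \<open>xs\<close> by those of \<open>ys\<close> one at a time.\<close>

lemma respects_kernel_cong:
  assumes f: "f \<in> carrier (cochains K M n)" and k: "respects_kernel n f"
    and "list_all2 (\<lambda>x y. \<phi> x = \<phi> y) xs ys"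
    and "set ws \<subseteq> carrier M" "set xs \<subseteq> carrier M" "set ys \<subseteq> carrier M" "int (length ws + length xs) = n"
  shows "\<phi> (f (ws @ xs)) = \<phi> (f (ws @ ys))"
  using assms(3-)
proof (induction arbitrary: ws rule: list_all2_induct)
  case (Cons x xs y ys)
  have lin: "M.linear_op (\<lambda>a. f (ws @ a # xs))"
    using Cons.prems by (intro M.cochain_linear_op[OF f]) auto
  have xy: "x \<in> carrier M" "y \<in> carrier M"
    using Cons.prems by auto
  \<comment> \<open>One replacement: \<open>x\<close> is \<open>(x - y) + y\<close>, and the summand
    with \<open>x - y\<close>, an element of the kernel, is sent to zero.\<close>
  have "ws @ (x \<ominus>\<^bsub>M\<^esub> y) # xs \<in> tuples M n" "\<phi> (x \<ominus>\<^bsub>M\<^esub> y) = \<zero>\<^bsub>N\<^esub>"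
    using Cons.prems Cons.hyps xy by (auto simp: tuples_def map_diff N.minus_eq N.r_neg)
  then have "\<phi> (f (ws @ (x \<ominus>\<^bsub>M\<^esub> y) # xs)) = \<zero>\<^bsub>N\<^esub>"
    using k by (fastforce simp: respects_kernel_def)
  moreover have "x = (x \<ominus>\<^bsub>M\<^esub> y) \<oplus>\<^bsub>M\<^esub> y"
    using xy by (simp add: M.minus_eq M.a_assoc M.l_neg)
  then have "f (ws @ x # xs) = f (ws @ (x \<ominus>\<^bsub>M\<^esub> y) # xs) \<oplus>\<^bsub>M\<^esub> f (ws @ y # xs)"
    using lin xy unfolding M.linear_op_def by (metis M.minus_closed)
  ultimately have "\<phi> (f (ws @ x # xs)) = \<phi> (f (ws @ y # xs))"
    using xy M.linear_op_closed[OF lin] by (simp add: map_add)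
  also have "\<dots> = \<phi> (f ((ws @ [y]) @ ys))"
    using Cons.IH[of "ws @ [y]"] Cons.prems by simp
  finally show ?case by simp
qed simp

lemma tuples_lift:
  assumes "\<phi> ` carrier M = carrier N" "ys \<in> tuples N n"
  obtains xs where "xs \<in> tuples M n" "map \<phi> xs = ys"
proof
  show "map (inv_into (carrier M) \<phi>) ys \<in> tuples M n" "map \<phi> (map (inv_into (carrier M) \<phi>) ys) = ys"
    using assms by (auto simp: tuples_def f_inv_into_f inv_into_into subset_iff intro!: map_idI)
qed

lemma intertwines_unique:
  assumes "\<phi> ` carrier M = carrier N" "intertwines M \<phi> n f f'" "intertwines M \<phi> n f f''"
    and "f' \<in> extensional (tuples N n)" "f'' \<in> extensional (tuples N n)"
  shows "f' = f''"
proof (rule extensionalityI[OF assms(4,5)])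
  fix ys assume ys: "ys \<in> tuples N n"
  obtain xs where "xs \<in> tuples M n" "map \<phi> xs = ys"
    using tuples_lift[OF assms(1) ys] .
  then show "f' ys = f'' ys"
    using assms(2,3) unfolding intertwines_def by metis
qed

text \<open>Multilinearity descends along a surjection: all arguments of \<open>f'\<close> lift to
  \<open>M\<close>, and on lifts \<open>f'\<close> is \<open>\<phi>\<close> after the multilinear
  \<open>f\<close>.\<close>

lemma intertwines_cochain:
  assumes f: "f \<in> carrier (cochains K M n)" and surj: "\<phi> ` carrier M = carrier N"
    and i: "intertwines M \<phi> n f f'" and ext: "f' \<in> extensional (tuples N n)"
  shows "f' \<in> carrier (cochains K N n)"
proof -
  have lift: "\<exists>xs. set xs \<subseteq> carrier M \<and> map \<phi> xs = ys" if "set ys \<subseteq> carrier N" for ys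
    using that surj
    by (intro exI[of _ "map (inv_into (carrier M) \<phi>) ys"])
      (auto simp: f_inv_into_f inv_into_into subset_iff intro!: map_idI)
  have "f' \<in> multilinear_maps K N n"
  proof (rule N.multilinear_mapsI)
    have "f' ys \<in> carrier N" if ys: "ys \<in> tuples N n" for ys
    proof -
      obtain xs where "set xs \<subseteq> carrier M" "map \<phi> xs = ys"
        using lift[of ys] ys by (auto simp: tuples_def)
      moreover from this ys have "xs \<in> tuples M n"
        by (auto simp: tuples_def)
      ultimately show ?thesis
        using i M.cochains_closed[OF f] by (auto simp: intertwines_def)
    qed
    then show "f' \<in> tuples N n \<rightarrow>\<^sub>E carrier N"
      using ext by (auto simp: PiE_def)
    fix us vs assume *: "set us \<subseteq> carrier N" "set vs \<subseteq> carrier N" "int (length us + length vs) + 1 = n"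
    obtain xs ys where xy: "set xs \<subseteq> carrier M" "map \<phi> xs = us" "set ys \<subseteq> carrier M" "map \<phi> ys = vs"
      using lift[OF *(1)] lift[OF *(2)] by auto
    have len: "length us = length xs" "length vs = length ys"
      using xy by auto
    have lin: "M.linear_op (\<lambda>a. f (xs @ a # ys))"
      using xy * len by (intro M.cochain_linear_op[OF f]) auto
    have val: "f' (us @ \<phi> a # vs) = \<phi> (f (xs @ a # ys))" if "a \<in> carrier M" for a
    proof -
      have "xs @ a # ys \<in> tuples M n"
        using that xy * len by (auto simp: tuples_def)
      then show ?thesis
        using i xy by (fastforce simp: intertwines_def)
    qed
    show "N.linear_op (\<lambda>a. f' (us @ a # vs))"
      unfolding N.linear_op_def surj[symmetric]
      using lin by (auto simp: val M.linear_op_def map_add[symmetric] map_smult[symmetric])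
  qed
  then show ?thesis by (simp add: cochains_def)
qed

lemma transport_extensional: "transport M N \<phi> n f \<in> extensional (tuples N n)"
  by (simp add: transport_def)

text \<open>The preimages of \<open>map \<phi> xs\<close> picked by \<open>inv_into\<close> need not
  be \<open>xs\<close> itself, but they have the same images, and then \<open>\<phi>\<close> takes
  the same value on the results of \<open>f\<close>.\<close>

lemma transport_intertwines:
  assumes f: "f \<in> carrier (cochains K M n)" and k: "respects_kernel n f"
    and surj: "\<phi> ` carrier M = carrier N"
  shows "intertwines M \<phi> n f (transport M N \<phi> n f)"
  unfolding intertwines_def
proof
  fix xs assume xs: "xs \<in> tuples M n"
  let ?ys = "map (inv_into (carrier M) \<phi>) (map \<phi> xs)"
  have "\<phi> (f ([] @ ?ys)) = \<phi> (f ([] @ xs))"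
    using xs surj
    by (intro respects_kernel_cong[OF f k])
      (auto simp: tuples_def list_all2_conv_all_nth f_inv_into_f inv_into_into subset_iff)
  then show "transport M N \<phi> n f (map \<phi> xs) = \<phi> (f xs)"
    using map_tuples[OF xs] by (simp add: transport_def)
qed

text \<open>A multilinear \<open>f'\<close> vanishes as soon as one argument is zero. For surjective
  \<open>\<phi>\<close> this is the converse of the descent of cochains that respect the
  kernel.\<close>

lemma intertwines_respects_kernel:
  assumes "f' \<in> carrier (cochains K N n)" "intertwines M \<phi> n f f'"
  shows "respects_kernel n f"
  unfolding respects_kernel_def
proof (intro ballI impI)
  fix xs assume xs: "xs \<in> tuples M n" "\<exists>x \<in> set xs. \<phi> x = \<zero>\<^bsub>N\<^esub>"
  then obtain us x vs where *: "xs = us @ x # vs" "\<phi> x = \<zero>\<^bsub>N\<^esub>"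
    by (meson split_list)
  have "N.linear_op (\<lambda>a. f' (map \<phi> us @ a # map \<phi> vs))"
    using xs(1) by (intro N.cochain_linear_op[OF assms(1)]) (auto simp: tuples_def *)
  then have "f' (map \<phi> xs) = \<zero>\<^bsub>N\<^esub>"
    using N.linear_op_zero * by fastforce
  then show "\<phi> (f xs) = \<zero>\<^bsub>N\<^esub>"
    using assms(2) xs(1) by (simp add: intertwines_def)
qed

lemma transport_closed:
  assumes "f \<in> carrier (cochains K M n)" "respects_kernel n f" "\<phi> ` carrier M = carrier N"
  shows "transport M N \<phi> n f \<in> carrier (cochains K N n)"
  by (rule intertwines_cochain[OF assms(1,3) transport_intertwines[OF assms] transport_extensional])

lemma cochains_extensional: "f \<in> carrier (cochains K N n) \<Longrightarrow> f \<in> extensional (tuples N n)"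
  by (auto simp: cochains_def multilinear_maps_def PiE_def)

text \<open>Along a surjection an intertwined cochain is unique. Equations between transports thus
  reduce to exhibiting an intertwined cochain, with no computation involving
  \<open>inv_into\<close>.\<close>

lemma transport_eqI:
  assumes "f \<in> carrier (cochains K M n)" "f' \<in> carrier (cochains K N n)" "intertwines M \<phi> n f f'"
    and surj: "\<phi> ` carrier M = carrier N"
  shows "transport M N \<phi> n f = f'"
  by (rule intertwines_unique[OF surj transport_intertwines[OF assms(1) intertwines_respects_kernel[OF assms(2,3)] surj]
      assms(3) transport_extensional cochains_extensional[OF assms(2)]])

lemma inj_respects_kernel:
  assumes f: "f \<in> carrier (cochains K M n)" and inj: "inj_on \<phi> (carrier M)"
  shows "respects_kernel n f"
  unfolding respects_kernel_def
proof (intro ballI impI)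
  fix xs assume xs: "xs \<in> tuples M n" "\<exists>x \<in> set xs. \<phi> x = \<zero>\<^bsub>N\<^esub>"
  then obtain us x vs where *: "xs = us @ x # vs" "\<phi> x = \<zero>\<^bsub>N\<^esub>"
    by (meson split_list)
  then have "x = \<zero>\<^bsub>M\<^esub>"
    using inj_onD[OF inj, of x "\<zero>\<^bsub>M\<^esub>"] xs(1) by (simp add: tuples_def)
  moreover have "M.linear_op (\<lambda>a. f (us @ a # vs))"
    using xs(1) by (intro M.cochain_linear_op[OF f]) (auto simp: tuples_def *)
  ultimately show "\<phi> (f xs) = \<zero>\<^bsub>N\<^esub>"
    using M.linear_op_zero[of "\<lambda>a. f (us @ a # vs)"] * by simp
qed

end

lemma hoch_dgla_simps:
  "gr (hoch_dgla K B) p = cochains K B (p + 1)"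
  "brk (hoch_dgla K B) = gerst_bracket K B"
  "dif (hoch_dgla K B) = hoch_dif K B"
  by (simp_all add: hoch_dgla_def)

context assoc_hom
begin

text \<open>Used for \<open>s = id\<close> on the Hochschild complex of \<open>M\<close> and for the projection from the
  coisotropic Hochschild complex.\<close>

lemma transport_dgla_homs:
  assumes surj: "\<phi> ` carrier M = carrier N"
    and closed: "\<And>p x. x \<in> carrier (gr G p) \<Longrightarrow> s x \<in> carrier (cochains K M (p + 1))"
    and kernel: "\<And>p x. x \<in> carrier (gr G p) \<Longrightarrow> respects_kernel (p + 1) (s x)"
    and G: "\<And>p. module K (gr G p)"
      "\<And>p q x y. \<lbrakk>x \<in> carrier (gr G p); y \<in> carrier (gr G q)\<rbrakk> \<Longrightarrow> brk G p q x y \<in> carrier (gr G (p + q))"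
      "\<And>p x. x \<in> carrier (gr G p) \<Longrightarrow> dif G p x \<in> carrier (gr G (p + 1))"
    and s: "\<And>p x y. \<lbrakk>x \<in> carrier (gr G p); y \<in> carrier (gr G p)\<rbrakk> \<Longrightarrow>
        s (x \<oplus>\<^bsub>gr G p\<^esub> y) = s x \<oplus>\<^bsub>cochains K M (p + 1)\<^esub> s y"
      "\<And>p r x. \<lbrakk>r \<in> carrier K; x \<in> carrier (gr G p)\<rbrakk> \<Longrightarrow>
        s (r \<odot>\<^bsub>gr G p\<^esub> x) = r \<odot>\<^bsub>cochains K M (p + 1)\<^esub> s x"
      "\<And>p q x y. \<lbrakk>x \<in> carrier (gr G p); y \<in> carrier (gr G q)\<rbrakk> \<Longrightarrow>
        s (brk G p q x y) = gerst_bracket K M p q (s x) (s y)"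
      "\<And>p x. x \<in> carrier (gr G p) \<Longrightarrow> s (dif G p x) = hoch_dif K M p (s x)"
  shows "(\<lambda>p. \<lambda>x \<in> carrier (gr G p). transport M N \<phi> (p + 1) (s x)) \<in> dgla_homs K G (hoch_dgla K N)"
proof -
  note t = transport_closed[OF closed kernel surj] transport_intertwines[OF closed kernel surj]
  show ?thesis
    unfolding dgla_homs_def hoch_dgla_simps
  proof (safe, goal_cases)
    case (1 p)
    interpret C: module K "cochains K N (p + 1)" by (rule N.cochains_module)
    interpret CM: module K "cochains K M (p + 1)" by (rule M.cochains_module)
    interpret G: module K "gr G p" by (rule G)
    show ?case
      by (rule linear_mapsI)
        (auto simp: t s closed intro!: transport_eqI intertwines_add intertwines_smult surj)
  next
    case (2 p q x y)
    then have "transport M N \<phi> (p + q + 1) (s (brk G p q x y)) =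
        gerst_bracket K N p q (transport M N \<phi> (p + 1) (s x)) (transport M N \<phi> (q + 1) (s y))"
      unfolding s(3)[OF 2]
      by (intro transport_eqI intertwines_gerst_bracket M.gerst_bracket_closed N.gerst_bracket_closed
          closed t surj)
    then show ?case
      using 2 G(2) by simp
  next
    case (3 p x)
    have idx: "p + 1 + 1 = p + 2" by simp
    have "transport M N \<phi> (p + 2) (s (dif G p x)) = hoch_dif K N p (transport M N \<phi> (p + 1) (s x))"
      unfolding s(4)[OF 3]
      by (intro transport_eqI intertwines_hoch_dif M.hoch_dif_closed N.hoch_dif_closed closed t surj 3)
    then show ?case
      using 3 G(3) by (simp add: idx)
  qed
qed

lemma transport_iso_dgla_homs:
  assumes "bij_betw \<phi> (carrier M) (carrier N)"
  shows "(\<lambda>p. \<lambda>f \<in> carrier (cochains K M (p + 1)). transport M N \<phi> (p + 1) f) \<in>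
    dgla_homs K (hoch_dgla K M) (hoch_dgla K N)"
  using transport_dgla_homs[of "hoch_dgla K M" "\<lambda>x. x"] assms
    M.gerst_bracket_closed M.hoch_dif_closed M.cochains_module inj_respects_kernel
  by (simp add: hoch_dgla_simps bij_betw_def add.commute)

end

subsection \<open>The coisotropic Hochschild complex\<close>

locale coiso =
  fixes K :: "('k, 'r) ring_scheme" and A :: "('k, 't, 'n) coiso_alg"
  assumes coiso: "coiso_algebra K A"

sublocale coiso \<subseteq> T: assoc_algebra K "atot A"
  using coiso by (simp add: coiso_algebra_def)

sublocale coiso \<subseteq> N: assoc_algebra K "aN A"
  using coiso by (simp add: coiso_algebra_def)

sublocale coiso \<subseteq> J: ideal "azero A" "aN A"
  using coiso by (simp add: coiso_algebra_def)

context coiso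
begin

definition red :: "('k, 'n set) module" where
  "red = quot_algebra (aN A) (azero A)"

definition proj :: "'n \<Rightarrow> 'n set" where
  "proj = (\<lambda>x \<in> carrier (aN A). azero A +>\<^bsub>aN A\<^esub> x)"

lemma red_assoc_algebra: "assoc_algebra K red"
  unfolding red_def by (rule N.quot_algebra[OF J.ideal_axioms])

end

sublocale coiso \<subseteq> iota: assoc_hom K "aN A" "atot A" "aiota A"
  using coiso by (auto simp: coiso_algebra_def intro: assoc_homI)

sublocale coiso \<subseteq> pi: assoc_hom K "aN A" red proj
  unfolding proj_def
  by (intro assoc_homI N.assoc_algebra_axioms red_assoc_algebra,
      unfold red_def, rule N.quot_algebra_proj[OF J.ideal_axioms])

sublocale coiso \<subseteq> NJ: quotient_module K "aN A" "azero A"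
  by (rule N.quotient_module_ideal[OF J.ideal_axioms])

context coiso
begin

lemma proj_surj: "proj ` carrier (aN A) = carrier red"
  by (auto simp: proj_def red_def quot_algebra_simps NJ.rcos_mem elim!: NJ.rcosets_cases)

lemma red_cases:
  assumes "X \<in> carrier red"
  obtains x where "x \<in> carrier (aN A)" "X = proj x"
proof -
  have "X \<in> proj ` carrier (aN A)"
    using assms by (simp only: proj_surj)
  then show thesis
    using that by (rule imageE)
qed

lemma proj_eq_zero_iff: "x \<in> carrier (aN A) \<Longrightarrow> proj x = \<zero>\<^bsub>red\<^esub> \<longleftrightarrow> x \<in> azero A"
  using NJ.rcos_eq_iff[of x "\<zero>\<^bsub>aN A\<^esub>"] NJ.rcos_zero
  by (simp add: proj_def red_def quot_algebra_simps N.M.minus_eq)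

lemma respects_kernel_iff:
  assumes "f \<in> carrier (cochains K (aN A) n)"
  shows "pi.respects_kernel n f \<longleftrightarrow>
    (\<forall>xs \<in> tuples (aN A) n. set xs \<inter> azero A \<noteq> {} \<longrightarrow> f xs \<in> azero A)"
proof -
  have "(\<exists>x \<in> set xs. proj x = \<zero>\<^bsub>red\<^esub>) \<longleftrightarrow> set xs \<inter> azero A \<noteq> {}"
    "proj (f xs) = \<zero>\<^bsub>red\<^esub> \<longleftrightarrow> f xs \<in> azero A" if "xs \<in> tuples (aN A) n" for xs
    using that N.cochains_closed[OF assms that] by (auto simp: tuples_def proj_eq_zero_iff subset_iff)
  then show ?thesis
    by (simp add: pi.respects_kernel_def)
qed

text \<open>Both conditions on a pair are phrased through maps out of \<open>A_N\<close>: the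
  compatibility along \<open>\<iota>\<close>, the ideal condition along the projection.\<close>

lemma coiso_cochains_iff:
  "f \<in> carrier (coiso_cochains_N K A n) \<longleftrightarrow>
    fst f \<in> carrier (cochains K (atot A) n) \<and> snd f \<in> carrier (cochains K (aN A) n) \<and>
    intertwines (aN A) (aiota A) n (snd f) (fst f) \<and> pi.respects_kernel n (snd f)"
  by (cases f)
    (simp add: coiso_cochains_N_def Let_def intertwines_def respects_kernel_iff cong: conj_cong)

lemma coiso_cochains_simps:
  "\<zero>\<^bsub>coiso_cochains_N K A n\<^esub> = (\<zero>\<^bsub>cochains K (atot A) n\<^esub>, \<zero>\<^bsub>cochains K (aN A) n\<^esub>)"
  "f \<oplus>\<^bsub>coiso_cochains_N K A n\<^esub> g =
    (fst f \<oplus>\<^bsub>cochains K (atot A) n\<^esub> fst g, snd f \<oplus>\<^bsub>cochains K (aN A) n\<^esub> snd g)"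
  "r \<odot>\<^bsub>coiso_cochains_N K A n\<^esub> f =
    (r \<odot>\<^bsub>cochains K (atot A) n\<^esub> fst f, r \<odot>\<^bsub>cochains K (aN A) n\<^esub> snd f)"
  by (simp_all add: coiso_cochains_N_def Let_def)

text \<open>The formula defining \<^const>\<open>transport\<close> also makes sense for surjections: on a cochain that
  respects the kernel, the choice of preimages does not matter.\<close>

definition bar :: "int \<Rightarrow> ('n list \<Rightarrow> 'n) \<Rightarrow> 'n set list \<Rightarrow> 'n set" where
  "bar n f = transport (aN A) red proj n f"

lemma coiso_cochainsD:
  assumes "f \<in> carrier (coiso_cochains_N K A n)"
  shows "fst f \<in> carrier (cochains K (atot A) n)" "snd f \<in> carrier (cochains K (aN A) n)"
    "intertwines (aN A) (aiota A) n (snd f) (fst f)" "pi.respects_kernel n (snd f)"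
    "bar n (snd f) \<in> carrier (cochains K red n)" "intertwines (aN A) proj n (snd f) (bar n (snd f))"
  using assms pi.transport_closed[OF _ _ proj_surj] pi.transport_intertwines[OF _ _ proj_surj]
  by (auto simp: coiso_cochains_iff bar_def)

text \<open>A witness \<open>h\<close> over \<open>A_red\<close> replaces the ideal condition.
  Closure of \<open>C(A)_N\<close> under an operation then follows by applying the operation to the
  witnesses too, without inspecting which arguments lie in \<open>azero A\<close>.\<close>

lemma coiso_cochainsI:
  assumes "f \<in> carrier (cochains K (atot A) n)" "g \<in> carrier (cochains K (aN A) n)"
    and "intertwines (aN A) (aiota A) n g f"
    and "h \<in> carrier (cochains K red n)" "intertwines (aN A) proj n g h"
  shows "(f, g) \<in> carrier (coiso_cochains_N K A n)"
  using assms pi.intertwines_respects_kernel by (auto simp: coiso_cochains_iff)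

lemma coiso_cochains_module: "module K (coiso_cochains_N K A n)"
proof -
  interpret CT: module K "cochains K (atot A) n" by (rule T.cochains_module)
  interpret CN: module K "cochains K (aN A) n" by (rule N.cochains_module)
  interpret CQ: module K "cochains K red n" by (rule pi.N.cochains_module)
  \<comment> \<open>In each of the four closure facts the witness comes from performing the
    operation over \<open>A_red\<close>, on the reductions \<open>bar\<close> where there are
    arguments.\<close>
  have add: "(fst f \<oplus>\<^bsub>cochains K (atot A) n\<^esub> fst g, snd f \<oplus>\<^bsub>cochains K (aN A) n\<^esub> snd g)
      \<in> carrier (coiso_cochains_N K A n)"
    if "f \<in> carrier (coiso_cochains_N K A n)" "g \<in> carrier (coiso_cochains_N K A n)" for f g
    using that[THEN coiso_cochainsD(1)] that[THEN coiso_cochainsD(2)] that[THEN coiso_cochainsD(3)]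
      that[THEN coiso_cochainsD(5)] that[THEN coiso_cochainsD(6)]
    by (intro coiso_cochainsI[OF _ _ _ CQ.a_closed] CT.a_closed CN.a_closed iota.intertwines_add
        pi.intertwines_add)
  have smult: "(r \<odot>\<^bsub>cochains K (atot A) n\<^esub> fst f, r \<odot>\<^bsub>cochains K (aN A) n\<^esub> snd f)
      \<in> carrier (coiso_cochains_N K A n)"
    if "r \<in> carrier K" "f \<in> carrier (coiso_cochains_N K A n)" for r f
    using that coiso_cochainsD[OF that(2)]
    by (intro coiso_cochainsI[OF _ _ _ CQ.smult_closed pi.intertwines_smult] CT.smult_closed
        CN.smult_closed iota.intertwines_smult)
  have zero: "(\<zero>\<^bsub>cochains K (atot A) n\<^esub>, \<zero>\<^bsub>cochains K (aN A) n\<^esub>) \<in> carrier (coiso_cochains_N K A n)"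
    by (intro coiso_cochainsI[OF _ _ _ CQ.zero_closed] CT.zero_closed CN.zero_closed
        iota.intertwines_zero pi.intertwines_zero)
  have uminus: "(\<ominus>\<^bsub>cochains K (atot A) n\<^esub> fst f, \<ominus>\<^bsub>cochains K (aN A) n\<^esub> snd f)
      \<in> carrier (coiso_cochains_N K A n)"
    if "f \<in> carrier (coiso_cochains_N K A n)" for f
    using that coiso_cochainsD[OF that]
    by (intro coiso_cochainsI[OF _ _ _ CQ.a_inv_closed] CT.a_inv_closed CN.a_inv_closed
        iota.intertwines_uminus pi.intertwines_uminus)
  note D = coiso_cochainsD(1,2)
  show ?thesis
  proof (rule moduleI)
    show "abelian_group (coiso_cochains_N K A n)"
    proof (rule abelian_groupI)
      fix f assume f: "f \<in> carrier (coiso_cochains_N K A n)"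
      show "\<exists>g \<in> carrier (coiso_cochains_N K A n).
          g \<oplus>\<^bsub>coiso_cochains_N K A n\<^esub> f = \<zero>\<^bsub>coiso_cochains_N K A n\<^esub>"
        using uminus[OF f] D[OF f]
        by (intro bexI[OF _ uminus[OF f]]) (simp add: coiso_cochains_simps CT.l_neg CN.l_neg)
    qed (auto simp: coiso_cochains_simps D CT.a_ac CN.a_ac intro: add zero)
  qed (auto simp: coiso_cochains_simps D module.axioms(1)[OF T.cochains_module] CT.smult_l_distr CN.smult_l_distr CT.smult_r_distr
      CN.smult_r_distr CT.smult_assoc1 CN.smult_assoc1 intro: smult)
qed

definition dgN :: "('k, ('t list \<Rightarrow> 't) \<times> ('n list \<Rightarrow> 'n)) dgla" where
  "dgN = dN (coiso_hoch_dgla K A)"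

lemma dgN_simps:
  "gr dgN p = coiso_cochains_N K A (p + 1)"
  "brk dgN p q f g = (gerst_bracket K (atot A) p q (fst f) (fst g),
     gerst_bracket K (aN A) p q (snd f) (snd g))"
  "dif dgN p f = (hoch_dif K (atot A) p (fst f), hoch_dif K (aN A) p (snd f))"
  by (simp_all add: dgN_def coiso_hoch_dgla_def)

lemma dgN_brk_closed:
  assumes "f \<in> carrier (gr dgN p)" "g \<in> carrier (gr dgN q)"
  shows "brk dgN p q f g \<in> carrier (gr dgN (p + q))"
proof -
  note f = coiso_cochainsD[OF assms(1)[unfolded dgN_simps]]
  note g = coiso_cochainsD[OF assms(2)[unfolded dgN_simps]]
  show ?thesis
    unfolding dgN_simps
    by (intro coiso_cochainsI[OF _ _ _ pi.N.gerst_bracket_closed[OF f(5) g(5)]] T.gerst_bracket_closed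
        N.gerst_bracket_closed iota.intertwines_gerst_bracket pi.intertwines_gerst_bracket f g)
qed

lemma dgN_dif_closed:
  assumes "f \<in> carrier (gr dgN p)"
  shows "dif dgN p f \<in> carrier (gr dgN (p + 1))"
proof -
  note f = coiso_cochainsD[OF assms(1)[unfolded dgN_simps]]
  show ?thesis
    unfolding dgN_simps add.assoc one_add_one
    by (intro coiso_cochainsI[OF _ _ _ pi.N.hoch_dif_closed[OF f(5)]] T.hoch_dif_closed
        N.hoch_dif_closed iota.intertwines_hoch_dif pi.intertwines_hoch_dif f)
qed

definition barmap :: "int \<Rightarrow> ('t list \<Rightarrow> 't) \<times> ('n list \<Rightarrow> 'n) \<Rightarrow> 'n set list \<Rightarrow> 'n set" where
  "barmap p = (\<lambda>f \<in> carrier (gr dgN p). bar (p + 1) (snd f))"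

lemma barmap_hom: "barmap \<in> dgla_homs K dgN (hoch_dgla K red)"
  unfolding barmap_def bar_def
  by (rule pi.transport_dgla_homs[OF proj_surj _ _ _ dgN_brk_closed dgN_dif_closed])
    (simp_all add: dgN_simps coiso_cochains_simps coiso_cochainsD coiso_cochains_module)

text \<open>The reduction of \<open>f\<close> is determined by \<open>proj\<close> composed with
  \<open>f\<close>, since \<open>proj\<close> is surjective, and \<open>proj\<close> kills exactly
  \<open>azero A\<close>. This description makes \<open>C(A)_0\<close> divisible out and the induced
  map injective.\<close>

lemma coiso_cochains_0_kernel:
  "coiso_cochains_0 K A (p + 1) = {f \<in> carrier (gr dgN p). barmap p f = \<zero>\<^bsub>gr (hoch_dgla K red) p\<^esub>}"
proof -
  interpret CQ: module K "cochains K red (p + 1)" by (rule pi.N.cochains_module)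
  have "bar (p + 1) (snd f) = \<zero>\<^bsub>cochains K red (p + 1)\<^esub> \<longleftrightarrow>
      (\<forall>xs \<in> tuples (aN A) (p + 1). snd f xs \<in> azero A)"
    if f: "f \<in> carrier (coiso_cochains_N K A (p + 1))" for f
  proof
    note D = coiso_cochainsD[OF f]
    { assume z: "bar (p + 1) (snd f) = \<zero>\<^bsub>cochains K red (p + 1)\<^esub>"
      show "\<forall>xs \<in> tuples (aN A) (p + 1). snd f xs \<in> azero A"
      proof
        fix xs assume xs: "xs \<in> tuples (aN A) (p + 1)"
        have "proj (snd f xs) = \<zero>\<^bsub>red\<^esub>"
          using D(6) xs pi.N.cochains_zero_apply[OF pi.map_tuples[OF xs]]
          by (simp add: intertwines_def z)
        then show "snd f xs \<in> azero A"
          using N.cochains_closed[OF D(2) xs] by (simp add: proj_eq_zero_iff)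
      qed }
    assume z: "\<forall>xs \<in> tuples (aN A) (p + 1). snd f xs \<in> azero A"
    show "bar (p + 1) (snd f) = \<zero>\<^bsub>cochains K red (p + 1)\<^esub>"
      unfolding bar_def
    proof (rule pi.transport_eqI[OF D(2) CQ.zero_closed _ proj_surj])
      show "intertwines (aN A) proj (p + 1) (snd f) \<zero>\<^bsub>cochains K red (p + 1)\<^esub>"
        unfolding intertwines_def
      proof
        fix xs assume xs: "xs \<in> tuples (aN A) (p + 1)"
        then have "proj (snd f xs) = \<zero>\<^bsub>red\<^esub>"
          using z N.cochains_closed[OF D(2) xs] by (simp add: proj_eq_zero_iff)
        then show "\<zero>\<^bsub>cochains K red (p + 1)\<^esub> (map proj xs) = proj (snd f xs)"
          using pi.N.cochains_zero_apply[OF pi.map_tuples[OF xs]] by simp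
      qed
    qed
  qed
  then show ?thesis
    by (auto simp: coiso_cochains_0_def barmap_def dgN_simps hoch_dgla_simps)
qed

end

lemma coisoI: "coiso_algebra K A \<Longrightarrow> coiso K A"
  by (simp add: coiso_def)

locale coiso_rat = coiso K A for K :: "('k, 'r) ring_scheme" and A :: "('k, 't, 'n) coiso_alg" +
  assumes rat: "contains_rationals K"

text \<open>The rationals provide the DGLA axioms of \<open>C(A_red)\<close>, from which those of
  the quotient are derived.\<close>

sublocale coiso_rat \<subseteq> kd: kernel_dgla K dgN "hoch_dgla K red" barmap "\<lambda>p. coiso_cochains_0 K A (p + 1)"
  by (intro kernel_dgla.intro pi.N.hoch_dgla rat barmap_hom dgN_brk_closed dgN_dif_closed
      coiso_cochains_0_kernel) (simp add: dgN_simps coiso_cochains_module)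

subsection \<open>Functors\<close>

lemma is_functorD:
  assumes "is_functor F" "A \<in> Ob (src F)"
  shows "om F A \<in> Ob (tgt F)"
    and "mm F A A (Idt (src F) A) = Idt (tgt F) (om F A)"
    and "\<lbrakk>B \<in> Ob (src F); f \<in> Mor (src F) A B\<rbrakk> \<Longrightarrow> mm F A B f \<in> Mor (tgt F) (om F A) (om F B)"
    and "\<lbrakk>B \<in> Ob (src F); D \<in> Ob (src F); f \<in> Mor (src F) A B; g \<in> Mor (src F) B D\<rbrakk> \<Longrightarrow>
      mm F A D (Cmp (src F) A g f) = Cmp (tgt F) (om F A) (mm F B D g) (mm F A B f)"
  using assms unfolding is_functor_def by blast+

text \<open>Linearity, brackets, differentials, identities and compositions are all compared after the
  injective maps \<open>\<eta> A\<close>.\<close>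

lemma dgla_nat_trans_of_inj:
  fixes F :: "('o, 'm, ('k, 'x) dgla, int \<Rightarrow> 'x \<Rightarrow> 'x) func"
    and G :: "('o, 'm, ('k, 'y) dgla, int \<Rightarrow> 'y \<Rightarrow> 'y) func"
  assumes G: "is_functor G" "tgt G = dgla_cat K" and F: "src F = src G" "tgt F = dgla_cat K"
    and idt: "\<And>A. A \<in> Ob (src G) \<Longrightarrow> Idt (src G) A \<in> Mor (src G) A A"
    and cmp: "\<And>A B D f g. \<lbrakk>A \<in> Ob (src G); B \<in> Ob (src G); D \<in> Ob (src G);
      f \<in> Mor (src G) A B; g \<in> Mor (src G) B D\<rbrakk> \<Longrightarrow> Cmp (src G) A g f \<in> Mor (src G) A D"
    and dgla: "\<And>A. A \<in> Ob (src G) \<Longrightarrow> dgla K (om F A)"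
    and hom: "\<And>A. A \<in> Ob (src G) \<Longrightarrow> \<eta> A \<in> dgla_homs K (om F A) (om G A)"
    and inj: "\<And>A p. A \<in> Ob (src G) \<Longrightarrow> inj_on (\<eta> A p) (carrier (gr (om F A) p))"
    and mm: "\<And>A B f p. \<lbrakk>A \<in> Ob (src G); B \<in> Ob (src G); f \<in> Mor (src G) A B\<rbrakk> \<Longrightarrow>
      mm F A B f p \<in> carrier (gr (om F A) p) \<rightarrow>\<^sub>E carrier (gr (om F B) p)"
    and nat: "\<And>A B f p x. \<lbrakk>A \<in> Ob (src G); B \<in> Ob (src G); f \<in> Mor (src G) A B;
      x \<in> carrier (gr (om F A) p)\<rbrakk> \<Longrightarrow> \<eta> B p (mm F A B f p x) = mm G A B f p (\<eta> A p x)"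
  shows "dgla_nat_trans K F G \<eta>"
proof -
  have Gdgla: "dgla K (om G A)" if "A \<in> Ob (src G)" for A
    using is_functorD(1)[OF G(1) that] by (simp add: G(2) dgla_cat_def)
  have \<eta>lin: "linear_map K (gr (om F A) p) (gr (om G A) p) (\<eta> A p)" if "A \<in> Ob (src G)" for A p
    by (intro linear_mapI dgla.gr_module dgla Gdgla dgla_homsD(1)[OF hom] that)
  have Ghom: "mm G A B f \<in> dgla_homs K (om G A) (om G B)"
    if "A \<in> Ob (src G)" "B \<in> Ob (src G)" "f \<in> Mor (src G) A B" for A B f
    using is_functorD(3)[OF G(1) that] by (simp add: G(2) dgla_cat_def)
  have mmc: "mm F A B f p x \<in> carrier (gr (om F B) p)"
    if "A \<in> Ob (src G)" "B \<in> Ob (src G)" "f \<in> Mor (src G) A B" "x \<in> carrier (gr (om F A) p)" for A B f p x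
    using mm[OF that(1-3)] that(4) by (blast dest: PiE_mem)
  have \<eta>c: "\<eta> A p x \<in> carrier (gr (om G A) p)" if "A \<in> Ob (src G)" "x \<in> carrier (gr (om F A) p)" for A p x
    using linear_map.map_closed[OF \<eta>lin[OF that(1)] that(2)] .
  have Fhom: "mm F A B f \<in> dgla_homs K (om F A) (om F B)"
    if A: "A \<in> Ob (src G)" and B: "B \<in> Ob (src G)" and f: "f \<in> Mor (src G) A B" for A B f
  proof -
    interpret FA: dgla K "om F A" by (rule dgla[OF A])
    interpret FB: dgla K "om F B" by (rule dgla[OF B])
    note g = Ghom[OF A B f]
    note c = mmc[OF A B f]
    have glin: "linear_map K (gr (om G A) p) (gr (om G B) p) (mm G A B f p)" for p
      by (intro linear_mapI dgla.gr_module Gdgla dgla_homsD(1)[OF g] A B)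
    have difA: "dif (om F A) p x \<in> carrier (gr (om F A) (p + 1))" if "x \<in> carrier (gr (om F A) p)" for p x
      using FA.dif_linear[of p] that by (auto simp: linear_maps_def dest: PiE_mem)
    have difB: "dif (om F B) p x \<in> carrier (gr (om F B) (p + 1))" if "x \<in> carrier (gr (om F B) p)" for p x
      using FB.dif_linear[of p] that by (auto simp: linear_maps_def dest: PiE_mem)
    have eq: "u = v" if "\<eta> B p u = \<eta> B p v" "u \<in> carrier (gr (om F B) p)" "v \<in> carrier (gr (om F B) p)"
      for p u v using inj_onD[OF inj[OF B] that] .
    show ?thesis
      unfolding dgla_homs_def
    proof (safe, goal_cases)
      case (1 p)
      interpret MA: module K "gr (om F A) p" by (rule FA.gr_module)
      interpret MB: module K "gr (om F B) p" by (rule FB.gr_module)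
      show ?case
      proof (rule linear_mapsI[OF mm[OF A B f]])
        fix x y assume xy: "x \<in> carrier (gr (om F A) p)" "y \<in> carrier (gr (om F A) p)"
        show "mm F A B f p (x \<oplus>\<^bsub>gr (om F A) p\<^esub> y) = mm F A B f p x \<oplus>\<^bsub>gr (om F B) p\<^esub> mm F A B f p y"
          using xy c by (intro eq[of p]) (simp_all add: nat[OF A B f] linear_map.map_add[OF \<eta>lin] A B
              linear_map.map_add[OF glin] \<eta>c)
      next
        fix r x assume rx: "r \<in> carrier K" "x \<in> carrier (gr (om F A) p)"
        show "mm F A B f p (r \<odot>\<^bsub>gr (om F A) p\<^esub> x) = r \<odot>\<^bsub>gr (om F B) p\<^esub> mm F A B f p x"
          using rx c by (intro eq[of p]) (simp_all add: nat[OF A B f] linear_map.map_smult[OF \<eta>lin] A B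
              linear_map.map_smult[OF glin] \<eta>c)
      qed
    next
      case (2 p q x y)
      then show ?case
        using c by (intro eq[of "p + q"]) (simp_all add: nat[OF A B f] FA.brk_closed FB.brk_closed
            dgla_homsD(2)[OF hom] dgla_homsD(2)[OF g] \<eta>c A B)
    next
      case (3 p x)
      then show ?case
        using c by (intro eq[of "p + 1"]) (simp_all add: nat[OF A B f] difA difB
            dgla_homsD(3)[OF hom] dgla_homsD(3)[OF g] \<eta>c A B)
    qed
  qed
  have hom_eqI: "u = v" if "u \<in> carrier (gr (om F A) p) \<rightarrow>\<^sub>E carrier (gr (om F B) p)"
    "v \<in> carrier (gr (om F A) p) \<rightarrow>\<^sub>E carrier (gr (om F B) p)" "B \<in> Ob (src G)"
    "\<And>x. x \<in> carrier (gr (om F A) p) \<Longrightarrow> \<eta> B p (u x) = \<eta> B p (v x)" for u v A B p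
    using that(1,2,4) inj_onD[OF inj[OF that(3)]] by (intro PiE_ext[OF that(1,2)]) blast
  have "is_functor F"
    unfolding is_functor_def F
  proof (intro conjI ballI)
    fix A assume A: "A \<in> Ob (src G)"
    show "om F A \<in> Ob (dgla_cat K)"
      using dgla[OF A] by (simp add: dgla_cat_def)
    have "mm G A A (Idt (src G) A) p (\<eta> A p x) = \<eta> A p x" if "x \<in> carrier (gr (om F A) p)" for p x
      using is_functorD(2)[OF G(1) A] \<eta>c[OF A that] by (simp add: G(2) dgla_cat_def)
    then have "mm F A A (Idt (src G) A) p = (\<lambda>x \<in> carrier (gr (om F A) p). x)" for p
      by (intro hom_eqI[of _ A p A] mm A idt) (simp_all add: nat A idt)
    then show "mm F A A (Idt (src G) A) = Idt (dgla_cat K) (om F A)"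
      by (intro ext) (simp add: dgla_cat_def)
  next
    fix A B f assume "A \<in> Ob (src G)" "B \<in> Ob (src G)" "f \<in> Mor (src G) A B"
    then show "mm F A B f \<in> Mor (dgla_cat K) (om F A) (om F B)"
      using Fhom by (simp add: dgla_cat_def)
  next
    fix A B D f g
    assume *: "A \<in> Ob (src G)" "B \<in> Ob (src G)" "D \<in> Ob (src G)" "f \<in> Mor (src G) A B" "g \<in> Mor (src G) B D"
    have "mm F A D (Cmp (src G) A g f) p = compose (carrier (gr (om F A) p)) (mm F B D g p) (mm F A B f p)" for p
    proof (rule hom_eqI[of _ A p D])
      show "compose (carrier (gr (om F A) p)) (mm F B D g p) (mm F A B f p)
          \<in> carrier (gr (om F A) p) \<rightarrow>\<^sub>E carrier (gr (om F D) p)"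
        using mmc * by (auto simp: compose_def)
      fix x assume x: "x \<in> carrier (gr (om F A) p)"
      have "\<eta> D p (mm F A D (Cmp (src G) A g f) p x) = mm G A D (Cmp (src G) A g f) p (\<eta> A p x)"
        using * x by (intro nat cmp)
      also have "\<dots> = mm G B D g p (mm G A B f p (\<eta> A p x))"
        using is_functorD(4)[OF G(1) *] \<eta>c[OF *(1) x]
        by (simp add: G(2) dgla_cat_def dgla_comp_def compose_def)
      also have "\<dots> = \<eta> D p (compose (carrier (gr (om F A) p)) (mm F B D g p) (mm F A B f p) x)"
        using * x by (simp add: compose_def nat mmc)
      finally show "\<eta> D p (mm F A D (Cmp (src G) A g f) p x) =
          \<eta> D p (compose (carrier (gr (om F A) p)) (mm F B D g p) (mm F A B f p) x)" .
    qed (use * mm cmp in auto)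
    then show "mm F A D (Cmp (src G) A g f) = Cmp (dgla_cat K) (om F A) (mm F B D g) (mm F A B f)"
      by (intro ext) (simp add: dgla_cat_def dgla_comp_def)
  qed
  moreover have "dgla_comp (om F A) (\<eta> B) (mm F A B f) = dgla_comp (om F A) (mm G A B f) (\<eta> A)"
    if "A \<in> Ob (src G)" "B \<in> Ob (src G)" "f \<in> Mor (src G) A B" for A B f
    unfolding dgla_comp_def compose_def by (rule HOL.ext, rule restrict_ext, rule nat[OF that])
  ultimately show ?thesis
    using G F hom by (simp add: dgla_nat_trans_def)
qed

section \<open>Identities and composites of isomorphisms of coisotropic algebras\<close>

lemma core_groupoid_simps [simp]:
  "Ob (core_groupoid C) = Ob C" "Idt (core_groupoid C) = Idt C" "Cmp (core_groupoid C) = Cmp C"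
  by (simp_all add: core_groupoid_def)

lemma algebra_homs_closed: "\<lbrakk>f \<in> algebra_homs K A B; x \<in> carrier A\<rbrakk> \<Longrightarrow> f x \<in> carrier B"
  by (auto simp: algebra_homs_def linear_maps_def dest: PiE_mem)

lemma algebra_homs_id:
  assumes "assoc_algebra K A"
  shows "(\<lambda>x \<in> carrier A. x) \<in> algebra_homs K A A"
proof -
  interpret assoc_algebra K A by fact
  show ?thesis by (auto simp: algebra_homs_def ring_hom_def intro!: linear_mapsI)
qed

lemma algebra_homs_compose:
  assumes "assoc_algebra K A" "f \<in> algebra_homs K A B" "g \<in> algebra_homs K B D"
  shows "compose (carrier A) g f \<in> algebra_homs K A D"
proof -
  interpret assoc_algebra K A by fact
  show ?thesis
    using assms(2,3) algebra_homs_closed[OF assms(2)] algebra_homs_closed[OF assms(3)]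
    by (auto simp: algebra_homs_def ring_hom_def compose_def linear_maps_def)
qed

definition inverse_on :: "'a set \<Rightarrow> 'b set \<Rightarrow> ('a \<Rightarrow> 'b) \<Rightarrow> ('b \<Rightarrow> 'a) \<Rightarrow> bool" where
  "inverse_on X Y f g \<longleftrightarrow> (\<forall>x \<in> X. g (f x) = x) \<and> (\<forall>y \<in> Y. f (g y) = y)"

lemma compose_eq_id_iff: "compose X g f = (\<lambda>x \<in> X. x) \<longleftrightarrow> (\<forall>x \<in> X. g (f x) = x)"
  unfolding compose_def by (metis (mono_tags, lifting) restrict_apply' restrict_ext)

lemma coiso_iso_iff:
  "\<phi> \<in> Mor (core_groupoid (coiso_alg_cat K)) A B \<longleftrightarrow> \<phi> \<in> coiso_alg_homs K A B \<and>
    (\<exists>\<psi> \<in> coiso_alg_homs K B A. inverse_on (carrier (atot A)) (carrier (atot B)) (fst \<phi>) (fst \<psi>) \<and>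
      inverse_on (carrier (aN A)) (carrier (aN B)) (snd \<phi>) (snd \<psi>))"
  by (auto simp: core_groupoid_def coiso_alg_cat_def compose_eq_id_iff inverse_on_def)

lemma coiso_alg_homs_iff:
  "\<phi> \<in> coiso_alg_homs K A B \<longleftrightarrow> fst \<phi> \<in> algebra_homs K (atot A) (atot B) \<and>
     snd \<phi> \<in> algebra_homs K (aN A) (aN B) \<and>
     (\<forall>a \<in> carrier (aN A). aiota B (snd \<phi> a) = fst \<phi> (aiota A a)) \<and> snd \<phi> ` azero A \<subseteq> azero B"
  by (auto simp: coiso_alg_homs_def)

lemma coiso_alg_homs_compose:
  assumes A: "coiso_algebra K A" and f: "f \<in> coiso_alg_homs K A B" and g: "g \<in> coiso_alg_homs K B D"
  shows "Cmp (coiso_alg_cat K) A g f \<in> coiso_alg_homs K A D"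
proof -
  interpret coiso K A by (rule coisoI[OF A])
  have J: "x \<in> carrier (aN A)" if "x \<in> azero A" for x
    by (rule J.a_Hcarr[OF that])
  have fg: "fst f \<in> algebra_homs K (atot A) (atot B)" "snd f \<in> algebra_homs K (aN A) (aN B)"
    "fst g \<in> algebra_homs K (atot B) (atot D)" "snd g \<in> algebra_homs K (aN B) (aN D)"
    using f g by (simp_all add: coiso_alg_homs_iff)
  have "compose (carrier (atot A)) (fst g) (fst f) \<in> algebra_homs K (atot A) (atot D)"
    "compose (carrier (aN A)) (snd g) (snd f) \<in> algebra_homs K (aN A) (aN D)"
    by (rule algebra_homs_compose[OF T.assoc_algebra_axioms fg(1,3)],
        rule algebra_homs_compose[OF N.assoc_algebra_axioms fg(2,4)])
  moreover have "snd f a \<in> carrier (aN B)" if "a \<in> carrier (aN A)" for a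
    by (rule algebra_homs_closed[OF fg(2) that])
  moreover have "snd g (snd f a) \<in> azero D" if "a \<in> azero A" for a
    using f g that by (simp add: coiso_alg_homs_iff image_subset_iff)
  ultimately show ?thesis
    using f g J unfolding coiso_alg_homs_iff coiso_alg_cat_def
    by (simp add: compose_def iota.map_closed image_subset_iff)
qed

lemma coiso_iso_id:
  assumes "coiso_algebra K A"
  shows "Idt (coiso_alg_cat K) A \<in> Mor (core_groupoid (coiso_alg_cat K)) A A"
proof -
  interpret coiso K A by (rule coisoI[OF assms])
  have "Idt (coiso_alg_cat K) A \<in> coiso_alg_homs K A A"
    unfolding coiso_alg_homs_iff
    by (auto simp: coiso_alg_cat_def intro: algebra_homs_id T.assoc_algebra_axioms N.assoc_algebra_axioms)
  then show ?thesis
    unfolding coiso_iso_iff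
    by (intro conjI bexI[of _ "Idt (coiso_alg_cat K) A"]) (auto simp: coiso_alg_cat_def inverse_on_def)
qed

lemma coiso_iso_compose:
  assumes A: "coiso_algebra K A" and B: "coiso_algebra K B" and D: "coiso_algebra K D"
    and f: "f \<in> Mor (core_groupoid (coiso_alg_cat K)) A B"
    and g: "g \<in> Mor (core_groupoid (coiso_alg_cat K)) B D"
  shows "Cmp (coiso_alg_cat K) A g f \<in> Mor (core_groupoid (coiso_alg_cat K)) A D"
proof -
  obtain f' where f': "f' \<in> coiso_alg_homs K B A"
    "inverse_on (carrier (atot A)) (carrier (atot B)) (fst f) (fst f')"
    "inverse_on (carrier (aN A)) (carrier (aN B)) (snd f) (snd f')"
    using f by (auto simp: coiso_iso_iff)
  obtain g' where g': "g' \<in> coiso_alg_homs K D B"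
    "inverse_on (carrier (atot B)) (carrier (atot D)) (fst g) (fst g')"
    "inverse_on (carrier (aN B)) (carrier (aN D)) (snd g) (snd g')"
    using g by (auto simp: coiso_iso_iff)
  have fg: "f \<in> coiso_alg_homs K A B" "g \<in> coiso_alg_homs K B D"
    using f g by (auto simp: coiso_iso_iff)
  have c1: "fst h x \<in> carrier (atot Y)"
    if "h \<in> coiso_alg_homs K X Y" "x \<in> carrier (atot X)" for h X Y x
    using that algebra_homs_closed by (auto simp: coiso_alg_homs_iff)
  have c2: "snd h y \<in> carrier (aN Y)"
    if "h \<in> coiso_alg_homs K X Y" "y \<in> carrier (aN X)" for h X Y y
    using that algebra_homs_closed by (auto simp: coiso_alg_homs_iff)
  show ?thesis
    unfolding coiso_iso_iff
  proof (intro conjI bexI[of _ "Cmp (coiso_alg_cat K) D f' g'"])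
    show "Cmp (coiso_alg_cat K) A g f \<in> coiso_alg_homs K A D"
      by (rule coiso_alg_homs_compose[OF A fg])
    show "Cmp (coiso_alg_cat K) D f' g' \<in> coiso_alg_homs K D A"
      by (rule coiso_alg_homs_compose[OF D g'(1) f'(1)])
    show "inverse_on (carrier (atot A)) (carrier (atot D)) (fst (Cmp (coiso_alg_cat K) A g f))
        (fst (Cmp (coiso_alg_cat K) D f' g'))"
      using f' g' c1[OF fg(1)] c1[OF fg(2)] c1[OF f'(1)] c1[OF g'(1)]
      by (simp add: inverse_on_def coiso_alg_cat_def compose_def)
    show "inverse_on (carrier (aN A)) (carrier (aN D)) (snd (Cmp (coiso_alg_cat K) A g f))
        (snd (Cmp (coiso_alg_cat K) D f' g'))"
      using f' g' c2[OF fg(1)] c2[OF fg(2)] c2[OF f'(1)] c2[OF g'(1)]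
      by (simp add: inverse_on_def coiso_alg_cat_def compose_def)
  qed
qed

subsection \<open>Isomorphisms of coisotropic algebras\<close>

text \<open>Tuples of \<open>N\<close> lift along \<open>\<phi>\<close>, so a relation over
  \<open>N\<close> may be tested after precomposition with \<open>\<phi>\<close>. This carries the
  relations along \<open>\<iota>\<close> and the projection from \<open>A\<close> over to an
  isomorphic \<open>B\<close>.\<close>

lemma (in linear_map) intertwines_factor:
  assumes surj: "\<phi> ` carrier M = carrier N" and f: "intertwines M \<phi> n f f'"
    and h: "\<And>xs. xs \<in> tuples M n \<Longrightarrow> h (map \<chi> (map \<phi> xs)) = \<chi> (\<phi> (f xs))"
  shows "intertwines N \<chi> n f' h"
  unfolding intertwines_def
proof
  fix ys assume "ys \<in> tuples N n"
  then obtain xs where xs: "xs \<in> tuples M n" "map \<phi> xs = ys"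
    by (rule tuples_lift[OF surj])
  have "f' (map \<phi> xs) = \<phi> (f xs)"
    using f xs(1) by (simp add: intertwines_def)
  then show "h (map \<chi> ys) = \<chi> (f' ys)"
    using h[OF xs(1)] unfolding xs(2) by simp
qed

text \<open>The inverse \<open>\<psi>\<close> is a parameter in order to make the setting symmetric:
  facts about \<open>\<psi>\<close> arise by interchanging the roles.\<close>

locale coiso_iso = A: coiso_rat K A + B: coiso_rat K B
  for K :: "('k, 'r) ring_scheme" and A B :: "('k, 't, 'n) coiso_alg" +
  fixes \<phi> \<psi>
  assumes hom: "\<phi> \<in> coiso_alg_homs K A B" and inv_hom: "\<psi> \<in> coiso_alg_homs K B A"
    and inverse_tot: "inverse_on (carrier (atot A)) (carrier (atot B)) (fst \<phi>) (fst \<psi>)"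
    and inverse_N: "inverse_on (carrier (aN A)) (carrier (aN B)) (snd \<phi>) (snd \<psi>)"
begin

definition red_map :: "'n set \<Rightarrow> 'n set" where
  "red_map = quot_map (aN A) (azero A) (aN B) (azero B) (snd \<phi>)"

lemma red_map_hom: "red_map \<in> algebra_homs K A.red B.red"
  unfolding red_map_def A.red_def B.red_def
  using hom by (intro A.N.quot_map_algebra_homs A.J.ideal_axioms B.J.ideal_axioms
      B.N.assoc_algebra_axioms) (auto simp: coiso_alg_homs_iff)

sublocale tot: assoc_hom K "atot A" "atot B" "fst \<phi>"
  using hom by (intro assoc_homI A.T.assoc_algebra_axioms B.T.assoc_algebra_axioms)
    (simp add: coiso_alg_homs_iff)

sublocale N: assoc_hom K "aN A" "aN B" "snd \<phi>"
  using hom by (intro assoc_homI A.N.assoc_algebra_axioms B.N.assoc_algebra_axioms)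
    (simp add: coiso_alg_homs_iff)

sublocale r: assoc_hom K A.red B.red red_map
  by (intro assoc_homI A.red_assoc_algebra B.red_assoc_algebra red_map_hom)

lemma red_map_proj: "x \<in> carrier (aN A) \<Longrightarrow> red_map (A.proj x) = B.proj (snd \<phi> x)"
  using A.NJ.quot_map_rcos[OF B.NJ.quotient_module_axioms N.linear] hom
  by (simp add: red_map_def A.proj_def B.proj_def coiso_alg_homs_iff)

lemma iota_map: "x \<in> carrier (aN A) \<Longrightarrow> fst \<phi> (aiota A x) = aiota B (snd \<phi> x)"
  using hom by (simp add: coiso_alg_homs_iff)

lemma bij_tot: "bij_betw (fst \<phi>) (carrier (atot A)) (carrier (atot B))"
proof (rule bij_betwI[of _ _ _ "fst \<psi>"])
  show "fst \<psi> \<in> carrier (atot B) \<rightarrow> carrier (atot A)"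
    using inv_hom algebra_homs_closed[of "fst \<psi>" K "atot B" "atot A"] by (simp add: coiso_alg_homs_iff)
qed (use inverse_tot in \<open>simp_all add: inverse_on_def\<close>)

lemma bij_N: "bij_betw (snd \<phi>) (carrier (aN A)) (carrier (aN B))"
proof (rule bij_betwI[of _ _ _ "snd \<psi>"])
  show "snd \<psi> \<in> carrier (aN B) \<rightarrow> carrier (aN A)"
    using inv_hom algebra_homs_closed[of "snd \<psi>" K "aN B" "aN A"] by (simp add: coiso_alg_homs_iff)
qed (use inverse_N in \<open>simp_all add: inverse_on_def\<close>)

end

lemma (in coiso_iso) inverse: "coiso_iso K B A \<psi> \<phi>"
proof (intro coiso_iso.intro coiso_iso_axioms.intro A.coiso_rat_axioms B.coiso_rat_axioms hom inv_hom)
qed (use inverse_tot inverse_N in \<open>simp_all add: inverse_on_def\<close>)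

context coiso_iso
begin

text \<open>The reduction of \<open>\<psi>\<close> is inverse to that of \<open>\<phi>\<close>, as
  both are computed on representatives in \<open>A_N\<close> and \<open>B_N\<close>.\<close>

lemma bij_red: "bij_betw red_map (carrier A.red) (carrier B.red)"
proof -
  interpret inv: coiso_iso K B A \<psi> \<phi> by (rule inverse)
  have "inv.red_map (red_map X) = X" if X: "X \<in> carrier A.red" for X
  proof -
    obtain x where "x \<in> carrier (aN A)" "X = A.proj x"
      using X by (rule A.red_cases)
    then show ?thesis
      using inverse_N by (simp add: red_map_proj inv.red_map_proj inverse_on_def)
  qed
  moreover have "red_map (inv.red_map X) = X" if X: "X \<in> carrier B.red" for X
  proof -
    obtain x where "x \<in> carrier (aN B)" "X = B.proj x"
      using X by (rule B.red_cases)
    then show ?thesis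
      using inverse_N by (simp add: red_map_proj inv.red_map_proj inverse_on_def)
  qed
  ultimately show ?thesis
    using r.map_closed inv.r.map_closed by (intro bij_betwI[of _ _ _ inv.red_map]) simp_all
qed

lemma red_map_surj: "red_map ` carrier A.red = carrier B.red"
  using bij_red by (simp add: bij_betw_def)

definition transport_N ::
    "int \<Rightarrow> ('t list \<Rightarrow> 't) \<times> ('n list \<Rightarrow> 'n) \<Rightarrow> ('t list \<Rightarrow> 't) \<times> ('n list \<Rightarrow> 'n)" where
  "transport_N p = (\<lambda>f \<in> carrier (gr A.dgN p).
     (transport (atot A) (atot B) (fst \<phi>) (p + 1) (fst f),
      transport (aN A) (aN B) (snd \<phi>) (p + 1) (snd f)))"

text \<open>An isomorphism commutes with the structure maps \<open>\<iota>\<close> and with the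
  projections, so transported cochains stay related along both. The second claim is the naturality
  of reduction before passing to cosets.\<close>

lemma transport_N:
  assumes f: "f \<in> carrier (gr A.dgN p)"
  shows "transport_N p f \<in> carrier (gr B.dgN p)"
    and "B.barmap p (transport_N p f) = transport A.red B.red red_map (p + 1) (A.barmap p f)"
proof -
  note D = A.coiso_cochainsD[OF f[unfolded A.dgN_simps]]
  let ?T = "transport (atot A) (atot B) (fst \<phi>) (p + 1) (fst f)"
  let ?N = "transport (aN A) (aN B) (snd \<phi>) (p + 1) (snd f)"
  \<comment> \<open>The witness over \<open>B.red\<close> for the pair \<open>(?T, ?N)\<close>; it
    also turns out to be the reduction of \<open>?N\<close>.\<close>
  let ?R = "transport A.red B.red red_map (p + 1) (A.bar (p + 1) (snd f))"
  have surj: "fst \<phi> ` carrier (atot A) = carrier (atot B)" "snd \<phi> ` carrier (aN A) = carrier (aN B)"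
    and inj: "inj_on (fst \<phi>) (carrier (atot A))" "inj_on (snd \<phi>) (carrier (aN A))"
      "inj_on red_map (carrier A.red)"
    using bij_tot bij_N bij_red by (auto simp: bij_betw_def)
  have T: "?T \<in> carrier (cochains K (atot B) (p + 1))"
    "intertwines (atot A) (fst \<phi>) (p + 1) (fst f) ?T"
    by (intro tot.transport_closed tot.transport_intertwines tot.inj_respects_kernel D surj inj)+
  have N: "?N \<in> carrier (cochains K (aN B) (p + 1))"
    "intertwines (aN A) (snd \<phi>) (p + 1) (snd f) ?N"
    by (intro N.transport_closed N.transport_intertwines N.inj_respects_kernel D surj inj)+
  have R: "?R \<in> carrier (cochains K B.red (p + 1))"
    "intertwines A.red red_map (p + 1) (A.bar (p + 1) (snd f)) ?R"
    by (intro r.transport_closed r.transport_intertwines r.inj_respects_kernel D red_map_surj inj)+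
  have NT: "intertwines (aN B) (aiota B) (p + 1) ?N ?T"
  proof (rule N.intertwines_factor[OF surj(2) N(2)])
    fix xs assume xs: "xs \<in> tuples (aN A) (p + 1)"
    have e: "map (aiota B) (map (snd \<phi>) xs) = map (fst \<phi>) (map (aiota A) xs)"
      using xs by (auto simp: tuples_def iota_map)
    show "?T (map (aiota B) (map (snd \<phi>) xs)) = aiota B (snd \<phi> (snd f xs))"
      unfolding e using T(2) D(3) xs A.iota.map_tuples[OF xs] A.N.cochains_closed[OF D(2) xs]
      by (simp only: intertwines_def iota_map)
  qed
  have NR: "intertwines (aN B) B.proj (p + 1) ?N ?R"
  proof (rule N.intertwines_factor[OF surj(2) N(2)])
    fix xs assume xs: "xs \<in> tuples (aN A) (p + 1)"
    have e: "map B.proj (map (snd \<phi>) xs) = map red_map (map A.proj xs)"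
      using xs by (auto simp: tuples_def red_map_proj)
    show "?R (map B.proj (map (snd \<phi>) xs)) = B.proj (snd \<phi> (snd f xs))"
      unfolding e using R(2) D(6) xs A.pi.map_tuples[OF xs] A.N.cochains_closed[OF D(2) xs]
      by (simp only: intertwines_def red_map_proj)
  qed
  have "(?T, ?N) \<in> carrier (gr B.dgN p)"
    unfolding B.dgN_simps by (rule B.coiso_cochainsI[OF T(1) N(1) NT R(1) NR])
  moreover have "B.bar (p + 1) ?N = ?R"
    unfolding B.bar_def by (rule B.pi.transport_eqI[OF N(1) R(1) NR B.proj_surj])
  ultimately show "transport_N p f \<in> carrier (gr B.dgN p)"
    "B.barmap p (transport_N p f) = transport A.red B.red red_map (p + 1) (A.barmap p f)"
    using f by (simp_all add: transport_N_def A.barmap_def B.barmap_def)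
qed

lemma
  shows tot_transport_linear: "(\<lambda>f \<in> carrier (cochains K (atot A) (p + 1)).
      transport (atot A) (atot B) (fst \<phi>) (p + 1) f)
      \<in> linear_maps K (cochains K (atot A) (p + 1)) (cochains K (atot B) (p + 1))"
    and N_transport_linear: "(\<lambda>f \<in> carrier (cochains K (aN A) (p + 1)).
      transport (aN A) (aN B) (snd \<phi>) (p + 1) f)
      \<in> linear_maps K (cochains K (aN A) (p + 1)) (cochains K (aN B) (p + 1))"
    and red_transport_linear: "(\<lambda>f \<in> carrier (cochains K A.red (p + 1)).
      transport A.red B.red red_map (p + 1) f)
      \<in> linear_maps K (cochains K A.red (p + 1)) (cochains K B.red (p + 1))"
  using dgla_homsD(1)[OF tot.transport_iso_dgla_homs[OF bij_tot], of p]
    dgla_homsD(1)[OF N.transport_iso_dgla_homs[OF bij_N], of p]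
    dgla_homsD(1)[OF r.transport_iso_dgla_homs[OF bij_red], of p]
  by (simp_all add: hoch_dgla_simps)

lemma transport_N_linear: "transport_N p \<in> linear_maps K (gr A.dgN p) (gr B.dgN p)"
proof -
  have D: "fst f \<in> carrier (cochains K (atot A) (p + 1))" "snd f \<in> carrier (cochains K (aN A) (p + 1))"
    if "f \<in> carrier (gr A.dgN p)" for f
    using that A.coiso_cochainsD by (auto simp: A.dgN_simps)
  have transport_apply: "transport_N p f = (transport (atot A) (atot B) (fst \<phi>) (p + 1) (fst f),
      transport (aN A) (aN B) (snd \<phi>) (p + 1) (snd f))" if "f \<in> carrier (gr A.dgN p)" for f
    using that by (simp add: transport_N_def)
  note T = linear_mapI[OF A.T.cochains_module B.T.cochains_module tot_transport_linear[of p]]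
  note N = linear_mapI[OF A.N.cochains_module B.N.cochains_module N_transport_linear[of p]]
  show ?thesis
  proof (rule linear_mapsI)
    show "transport_N p \<in> carrier (gr A.dgN p) \<rightarrow>\<^sub>E carrier (gr B.dgN p)"
      using transport_N(1) by (auto simp: transport_N_def)
    fix f g assume fg: "f \<in> carrier (gr A.dgN p)" "g \<in> carrier (gr A.dgN p)"
    have c: "f \<oplus>\<^bsub>gr A.dgN p\<^esub> g \<in> carrier (gr A.dgN p)"
      using fg by (rule abelian_groupE(1)[OF module.axioms(2)[OF A.kd.gr_module]])
    \<comment> \<open>The linearity statements concern restricted maps; knowing that the component
      sums are cochains removes the restrictions.\<close>
    note D' = D[OF c, unfolded A.dgN_simps(1) A.coiso_cochains_simps fst_conv snd_conv]
    show "transport_N p (f \<oplus>\<^bsub>gr A.dgN p\<^esub> g) = transport_N p f \<oplus>\<^bsub>gr B.dgN p\<^esub> transport_N p g"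
      using linear_map.map_add[OF T D(1)[OF fg(1)] D(1)[OF fg(2)]]
        linear_map.map_add[OF N D(2)[OF fg(1)] D(2)[OF fg(2)]] D[OF fg(1)] D[OF fg(2)] D'
      unfolding transport_apply[OF c] transport_apply[OF fg(1)] transport_apply[OF fg(2)]
      unfolding A.dgN_simps(1) B.dgN_simps(1)
        A.coiso_cochains_simps B.coiso_cochains_simps fst_conv snd_conv by simp
  next
    fix k f assume kf: "k \<in> carrier K" "f \<in> carrier (gr A.dgN p)"
    have c: "k \<odot>\<^bsub>gr A.dgN p\<^esub> f \<in> carrier (gr A.dgN p)"
      using kf by (rule module.smult_closed[OF A.kd.gr_module])
    note D' = D[OF c, unfolded A.dgN_simps(1) A.coiso_cochains_simps fst_conv snd_conv]
    show "transport_N p (k \<odot>\<^bsub>gr A.dgN p\<^esub> f) = k \<odot>\<^bsub>gr B.dgN p\<^esub> transport_N p f"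
      using linear_map.map_smult[OF T kf(1) D(1)[OF kf(2)]]
        linear_map.map_smult[OF N kf(1) D(2)[OF kf(2)]] D[OF kf(2)] D'
      unfolding transport_apply[OF c] transport_apply[OF kf(2)]
      unfolding A.dgN_simps(1) B.dgN_simps(1)
        A.coiso_cochains_simps B.coiso_cochains_simps fst_conv snd_conv by simp
  qed
qed

text \<open>Both zero components are kernels of \<open>barmap\<close>, which commutes with
  transport, and transport between the reductions is linear.\<close>

lemma transport_N_zero: "transport_N p ` coiso_cochains_0 K A (p + 1) \<subseteq> coiso_cochains_0 K B (p + 1)"
proof (rule image_subsetI)
  fix f assume "f \<in> coiso_cochains_0 K A (p + 1)"
  then have f: "f \<in> carrier (gr A.dgN p)" "A.barmap p f = \<zero>\<^bsub>cochains K A.red (p + 1)\<^esub>"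
    unfolding A.coiso_cochains_0_kernel hoch_dgla_simps by simp_all
  interpret CQ: module K "cochains K A.red (p + 1)" by (rule A.pi.N.cochains_module)
  have "transport A.red B.red red_map (p + 1) \<zero>\<^bsub>cochains K A.red (p + 1)\<^esub> = \<zero>\<^bsub>cochains K B.red (p + 1)\<^esub>"
    using linear_map.map_zero[OF linear_mapI[OF A.pi.N.cochains_module B.pi.N.cochains_module
      red_transport_linear[of p]]] by simp
  then show "transport_N p f \<in> coiso_cochains_0 K B (p + 1)"
    using transport_N[OF f(1)] f(2) unfolding B.coiso_cochains_0_kernel hoch_dgla_simps by simp
qed

lemma mm_coiso_rcos:
  assumes "f \<in> carrier (gr A.dgN p)"
  shows "quot_map (gr A.dgN p) (coiso_cochains_0 K A (p + 1)) (gr B.dgN p) (coiso_cochains_0 K B (p + 1))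
      (transport_N p) (coiso_cochains_0 K A (p + 1) +>\<^bsub>gr A.dgN p\<^esub> f) =
    coiso_cochains_0 K B (p + 1) +>\<^bsub>gr B.dgN p\<^esub> transport_N p f"
  by (rule A.kd.kq.quot_map_rcos[OF B.kd.kq.quotient_module_axioms transport_N_linear transport_N_zero assms])

end

section \<open>Functoriality of the Hochschild complex of the reduction\<close>

lemma coiso_iso_obtain:
  assumes "coiso_algebra K A" "coiso_algebra K B" "contains_rationals K"
    and "\<phi> \<in> Mor (core_groupoid (coiso_alg_cat K)) A B"
  obtains \<psi> where "coiso_iso K A B \<phi> \<psi>"
proof -
  obtain \<psi> where "\<psi> \<in> coiso_alg_homs K B A" "\<phi> \<in> coiso_alg_homs K A B"
    "inverse_on (carrier (atot A)) (carrier (atot B)) (fst \<phi>) (fst \<psi>)"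
    "inverse_on (carrier (aN A)) (carrier (aN B)) (snd \<phi>) (snd \<psi>)"
    using assms(4) unfolding coiso_iso_iff by blast
  then have "coiso_iso K A B \<phi> \<psi>"
    using assms(1-3) by (intro coiso_iso.intro coiso_iso_axioms.intro coiso_rat.intro
        coiso_rat_axioms.intro coisoI)
  then show thesis by (rule that)
qed

lemma (in coiso_iso) red_transport:
  assumes "f \<in> carrier (cochains K A.red n)"
  shows "transport A.red B.red red_map n f \<in> carrier (cochains K B.red n)"
    and "intertwines A.red red_map n f (transport A.red B.red red_map n f)"
proof -
  have inj: "inj_on red_map (carrier A.red)"
    using bij_red by (simp add: bij_betw_def)
  show "transport A.red B.red red_map n f \<in> carrier (cochains K B.red n)"
    "intertwines A.red red_map n f (transport A.red B.red red_map n f)"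
    by (intro r.transport_closed r.transport_intertwines r.inj_respects_kernel assms red_map_surj inj)+
qed

lemma red_transport_id:
  assumes "coiso_iso K A A \<phi> \<psi>" and id: "\<And>x. x \<in> carrier (aN A) \<Longrightarrow> snd \<phi> x = x"
    and f: "f \<in> carrier (cochains K (coiso.red A) n)"
  shows "transport (coiso.red A) (coiso.red A) (coiso_iso.red_map A A \<phi>) n f = f"
proof -
  interpret coiso_iso K A A \<phi> \<psi> by fact
  have rid: "red_map X = X" if "X \<in> carrier A.red" for X
    using that by (rule A.red_cases) (simp add: red_map_proj id)
  show ?thesis
  proof (rule r.transport_eqI[OF f f _ red_map_surj])
    show "intertwines A.red red_map n f f"
      unfolding intertwines_def
    proof
      fix xs assume xs: "xs \<in> tuples A.red n"
      then have "map red_map xs = xs"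
        by (auto simp: tuples_def rid subset_iff intro!: map_idI)
      then show "f (map red_map xs) = red_map (f xs)"
        using rid[OF A.pi.N.cochains_closed[OF f xs]] by simp
    qed
  qed
qed

text \<open>Intertwining relations can be chained, and the intertwined cochain is unique along the
  surjective reduced map; no formula for the inverse of a composite is involved.\<close>

lemma red_transport_compose:
  assumes "coiso_iso K A B \<phi> \<psi>" "coiso_iso K B D \<phi>' \<psi>'" "coiso_iso K A D \<phi>'' \<psi>''"
    and comp: "\<And>x. x \<in> carrier (aN A) \<Longrightarrow> snd \<phi>'' x = snd \<phi>' (snd \<phi> x)"
    and f: "f \<in> carrier (cochains K (coiso.red A) n)"
  shows "transport (coiso.red A) (coiso.red D) (coiso_iso.red_map A D \<phi>'') n f =
    transport (coiso.red B) (coiso.red D) (coiso_iso.red_map B D \<phi>') n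
      (transport (coiso.red A) (coiso.red B) (coiso_iso.red_map A B \<phi>) n f)"
proof -
  interpret f: coiso_iso K A B \<phi> \<psi> by fact
  interpret g: coiso_iso K B D \<phi>' \<psi>' by fact
  interpret h: coiso_iso K A D \<phi>'' \<psi>'' by fact
  have rcomp: "h.red_map X = g.red_map (f.red_map X)" if "X \<in> carrier f.A.red" for X
    using that
    by (rule f.A.red_cases) (simp add: f.red_map_proj g.red_map_proj h.red_map_proj comp)
  note tf = f.red_transport[OF f]
  note tg = g.red_transport[OF tf(1)]
  show ?thesis
  proof (rule h.r.transport_eqI[OF f tg(1) _ h.red_map_surj])
    show "intertwines f.A.red h.red_map n f
      (transport f.B.red g.B.red g.red_map n (transport f.A.red f.B.red f.red_map n f))"
      unfolding intertwines_def
    proof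
      fix xs assume xs: "xs \<in> tuples f.A.red n"
      have e: "map h.red_map xs = map g.red_map (map f.red_map xs)"
        using xs by (auto simp: tuples_def rcomp subset_iff)
      show "transport f.B.red g.B.red g.red_map n (transport f.A.red f.B.red f.red_map n f)
          (map h.red_map xs) = h.red_map (f xs)"
        unfolding e using tf(2) tg(2) xs f.r.map_tuples[OF xs] rcomp[OF f.A.pi.N.cochains_closed[OF f xs]]
        by (simp only: intertwines_def)
    qed
  qed
qed

lemma om_hochschild_red_alg:
  "om (func_comp (hochschild K) (red_alg K)) A = hoch_dgla K (coiso.red A)"
  if "coiso K A"
  using coiso.red_def[OF that] by (simp add: func_comp_def hochschild_def red_alg_def)

lemma mm_hochschild_red_alg:
  assumes "coiso_iso K A B \<phi> \<psi>"
  shows "mm (func_comp (hochschild K) (red_alg K)) A B \<phi> =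
    (\<lambda>p. \<lambda>f \<in> carrier (cochains K (coiso.red A) (p + 1)).
      transport (coiso.red A) (coiso.red B) (coiso_iso.red_map A B \<phi>) (p + 1) f)"
proof -
  interpret coiso_iso K A B \<phi> \<psi> by fact
  show ?thesis
    by (simp add: func_comp_def hochschild_def red_alg_def red_map_def A.red_def B.red_def)
qed

lemma func_comp_simps:
  "src (func_comp (hochschild K) (red_alg K)) = core_groupoid (coiso_alg_cat K)"
  "tgt (func_comp (hochschild K) (red_alg K)) = dgla_cat K"
  "src (func_comp (red_dgla K) (coiso_hochschild K)) = core_groupoid (coiso_alg_cat K)"
  "tgt (func_comp (red_dgla K) (coiso_hochschild K)) = dgla_cat K"
  "Ob (coiso_alg_cat K) = {A. coiso_algebra K A}"
  by (simp_all add: func_comp_def hochschild_def red_alg_def red_dgla_def coiso_hochschild_def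
      coiso_alg_cat_def)

text \<open>Treated as one functor on coisotropic algebras: the maps to transport along are then
  reductions of isomorphisms, and equations between them are checked on representatives in
  \<open>A_N\<close>.\<close>

lemma functor_hochschild_red_alg:
  fixes K :: "('k, 'r) ring_scheme"
  assumes rat: "contains_rationals K"
  shows "is_functor (func_comp (hochschild K)
    (red_alg K :: (('k, 't, 'n) coiso_alg, _, _, _) func))"
  unfolding is_functor_def func_comp_simps core_groupoid_simps
proof (intro conjI ballI, goal_cases)
  case (1 A)
  then interpret coiso K A by (simp add: coisoI)
  show ?case
    unfolding om_hochschild_red_alg[OF coiso_axioms]
    using pi.N.hoch_dgla[OF rat] by (simp add: dgla_cat_def)
next
  case (2 A B \<phi>)
  then obtain \<psi> where iso: "coiso_iso K A B \<phi> \<psi>"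
    using coiso_iso_obtain[of K A B \<phi>] rat by blast
  then interpret coiso_iso K A B \<phi> \<psi> .
  show ?case
    unfolding om_hochschild_red_alg[OF A.coiso_axioms] om_hochschild_red_alg[OF B.coiso_axioms]
      mm_hochschild_red_alg[OF iso]
    using r.transport_iso_dgla_homs[OF bij_red] by (simp add: dgla_cat_def)
next
  case (3 A)
  then have A: "coiso_algebra K A" by simp
  obtain \<psi> where iso: "coiso_iso K A A (Idt (coiso_alg_cat K) A) \<psi>"
    using coiso_iso_obtain[OF A A rat coiso_iso_id[OF A]] .
  then interpret coiso_iso K A A "Idt (coiso_alg_cat K) A" \<psi> .
  show ?case
    unfolding om_hochschild_red_alg[OF A.coiso_axioms] mm_hochschild_red_alg[OF iso]
    using red_transport_id[OF iso]
    by (intro ext) (simp add: dgla_cat_def hoch_dgla_simps coiso_alg_cat_def cong: restrict_cong)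
next
  case (4 A B D f g)
  then have ob: "coiso_algebra K A" "coiso_algebra K B" "coiso_algebra K D" by simp_all
  note gf = coiso_iso_compose[OF ob 4(4,5)]
  obtain f' where iso_f: "coiso_iso K A B f f'"
    using coiso_iso_obtain[OF ob(1,2) rat 4(4)] .
  obtain g' where iso_g: "coiso_iso K B D g g'"
    using coiso_iso_obtain[OF ob(2,3) rat 4(5)] .
  obtain h' where iso_h: "coiso_iso K A D (Cmp (coiso_alg_cat K) A g f) h'"
    using coiso_iso_obtain[OF ob(1,3) rat gf] .
  have "transport (coiso.red A) (coiso.red D) (coiso_iso.red_map A D (Cmp (coiso_alg_cat K) A g f)) n x =
      transport (coiso.red B) (coiso.red D) (coiso_iso.red_map B D g) n
      (transport (coiso.red A) (coiso.red B) (coiso_iso.red_map A B f) n x)"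
    if "x \<in> carrier (cochains K (coiso.red A) n)" for x n
    by (rule red_transport_compose[OF iso_f iso_g iso_h _ that]) (simp add: coiso_alg_cat_def compose_def)
  then show ?case
    unfolding om_hochschild_red_alg[OF coisoI[OF ob(1)]] mm_hochschild_red_alg[OF iso_f]
      mm_hochschild_red_alg[OF iso_g] mm_hochschild_red_alg[OF iso_h]
    using coiso_iso.red_transport(1)[OF iso_f]
    by (intro ext) (simp add: dgla_cat_def dgla_comp_def hoch_dgla_simps compose_def cong: restrict_cong)
qed

text \<open>Formed for arbitrary \<open>K\<close> and \<open>A\<close>, because a transformation is
  a single function on all objects; on coisotropic algebras over a ring containing the rationals it
  is the map \<open>kd.ind\<close> out of the quotient by the kernel.\<close>

definition eta :: "('k, 'r) ring_scheme \<Rightarrow> ('k, 't, 'n) coiso_alg \<Rightarrow> int \<Rightarrow>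
    (('t list \<Rightarrow> 't) \<times> ('n list \<Rightarrow> 'n)) set \<Rightarrow> 'n set list \<Rightarrow> 'n set" where
  "eta K A p = induced (coiso_cochains_N K A (p + 1)) (coiso_cochains_0 K A (p + 1)) (coiso.barmap K A p)"

lemma (in coiso_rat) eta_eq_ind: "eta K A = kd.ind"
  by (intro ext) (simp add: eta_def kd.ind_def dgN_simps)

lemma (in coiso) om_red_coiso_hochschild:
  "om (func_comp (red_dgla K) (coiso_hochschild K)) A = quot_dgla dgN (\<lambda>p. coiso_cochains_0 K A (p + 1))"
  by (simp add: func_comp_def red_dgla_def coiso_hochschild_def dgN_def coiso_hoch_dgla_def)

lemma (in coiso_iso) mm_red_coiso_hochschild:
  "mm (func_comp (red_dgla K) (coiso_hochschild K)) A B \<phi> p =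
    quot_map (gr A.dgN p) (coiso_cochains_0 K A (p + 1)) (gr B.dgN p) (coiso_cochains_0 K B (p + 1))
      (transport_N p)"
  by (simp add: func_comp_def red_dgla_def coiso_hochschild_def A.dgN_def B.dgN_def coiso_hoch_dgla_def
      transport_N_def)

theorem proposition4p9:
  fixes K :: "('k, 'r) ring_scheme"
  assumes "cring K" and "contains_rationals K"
  shows "\<exists>\<eta> :: ('k, 't, 'n) coiso_alg \<Rightarrow> int \<Rightarrow>
      (('t list \<Rightarrow> 't) \<times> ('n list \<Rightarrow> 'n)) set \<Rightarrow> 'n set list \<Rightarrow> 'n set.
    dgla_nat_trans K (func_comp (red_dgla K) (coiso_hochschild K))
                     (func_comp (hochschild K) (red_alg K)) \<eta> \<and>
    (\<forall>A. coiso_algebra K A \<longrightarrow>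
      (\<forall>p. inj_on (\<eta> A p) (carrier (gr (om (func_comp (red_dgla K) (coiso_hochschild K)) A) p))))"
proof (intro exI[of _ "eta K"] conjI allI impI)
  let ?F = "func_comp (red_dgla K) (coiso_hochschild K) ::
    (('k, 't, 'n) coiso_alg, _, ('k, (('t list \<Rightarrow> 't) \<times> ('n list \<Rightarrow> 'n)) set) dgla, _) func"
  let ?G = "func_comp (hochschild K) (red_alg K) :: (('k, 't, 'n) coiso_alg, _, _, _) func"
  have rat: "coiso_rat K A" if "coiso_algebra K A" for A :: "('k, 't, 'n) coiso_alg"
    using that assms(2) by (intro coiso_rat.intro coiso_rat_axioms.intro coisoI)
  have inj: "inj_on (eta K A p) (carrier (gr (om ?F A) p))" if "coiso_algebra K A" for A p
  proof -
    interpret coiso_rat K A by (rule rat[OF that])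
    show ?thesis
      unfolding om_red_coiso_hochschild eta_eq_ind by (rule kd.inj_ind)
  qed
  then show "inj_on (eta K A p) (carrier (gr (om ?F A) p))" if "coiso_algebra K A" for A p
    using that .
  show "dgla_nat_trans K ?F ?G (eta K)"
  proof (rule dgla_nat_trans_of_inj, unfold func_comp_simps core_groupoid_simps mem_Collect_eq)
    show "is_functor ?G"
      by (rule functor_hochschild_red_alg[OF assms(2)])
    fix A :: "('k, 't, 'n) coiso_alg"
    assume A: "coiso_algebra K A"
    interpret A: coiso_rat K A by (rule rat[OF A])
    show "Idt (coiso_alg_cat K) A \<in> Mor (core_groupoid (coiso_alg_cat K)) A A"
      by (rule coiso_iso_id[OF A])
    show "dgla K (om ?F A)"
      unfolding A.om_red_coiso_hochschild by (rule A.kd.dgla_quot)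
    show "eta K A \<in> dgla_homs K (om ?F A) (om ?G A)"
      unfolding A.om_red_coiso_hochschild om_hochschild_red_alg[OF A.coiso_axioms] A.eta_eq_ind
      by (rule A.kd.ind_hom)
    show "inj_on (eta K A p) (carrier (gr (om ?F A) p))" for p
      by (rule inj[OF A])
    fix B :: "('k, 't, 'n) coiso_alg" and \<phi>
    assume B: "coiso_algebra K B" and \<phi>: "\<phi> \<in> Mor (core_groupoid (coiso_alg_cat K)) A B"
    show "Cmp (coiso_alg_cat K) A \<chi> \<phi> \<in> Mor (core_groupoid (coiso_alg_cat K)) A D"
      if "coiso_algebra K D" "\<chi> \<in> Mor (core_groupoid (coiso_alg_cat K)) B D" for D \<chi>
      by (rule coiso_iso_compose[OF A B that(1) \<phi> that(2)])
    obtain \<psi> where iso: "coiso_iso K A B \<phi> \<psi>"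
      using coiso_iso_obtain[OF A B assms(2) \<phi>] .
    then interpret coiso_iso K A B \<phi> \<psi> .
    show "mm ?F A B \<phi> p \<in> carrier (gr (om ?F A) p) \<rightarrow>\<^sub>E carrier (gr (om ?F B) p)" for p
      using A.kd.kq.quot_map_linear[OF B.kd.kq.quotient_module_axioms transport_N_linear transport_N_zero]
      unfolding mm_red_coiso_hochschild A.om_red_coiso_hochschild B.om_red_coiso_hochschild
      by (simp add: linear_maps_def quot_dgla_def)
    show "eta K B p (mm ?F A B \<phi> p X) = mm ?G A B \<phi> p (eta K A p X)"
      if "X \<in> carrier (gr (om ?F A) p)" for p X
    proof -
      \<comment> \<open>On a coset with representative \<open>f\<close> both sides of the naturality
        square become the transport of \<open>A.barmap p f\<close> along the reduced map.\<close>
      have "X \<in> a_rcosets\<^bsub>gr A.dgN p\<^esub> (coiso_cochains_0 K A (p + 1))"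
        using that unfolding A.om_red_coiso_hochschild A.kd.quot_carrier .
      then obtain f where f: "f \<in> carrier (gr A.dgN p)"
        "X = coiso_cochains_0 K A (p + 1) +>\<^bsub>gr A.dgN p\<^esub> f"
        by (rule A.kd.kq.rcosets_cases)
      \<comment> \<open>The morphism part of \<open>?G\<close> is restricted to cochains, so its
        value can be read off only for a cochain.\<close>
      have "A.barmap p f \<in> carrier (cochains K A.red (p + 1))"
        using A.kd.kq.map_closed[OF f(1)] by (simp add: hoch_dgla_simps)
      then show ?thesis
        unfolding mm_red_coiso_hochschild mm_hochschild_red_alg[OF iso] A.eta_eq_ind B.eta_eq_ind f(2)
          mm_coiso_rcos[OF f(1)] A.kd.ind_rcos[OF f(1)] B.kd.ind_rcos[OF transport_N(1)[OF f(1)]]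
          transport_N(2)[OF f(1)]
        by simp
    qed
  qed simp_all
qed

end
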